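(* Let $\mathbb{B}$ be a subcategory of $\infty\text{-}\mathbf{CAT}$ and let $L$, $L'$ be two strict $\infty$-categories concrete over $\mathbb{B}$ with representable (strictly faithful) forgetful functors $U=L(A_0,-):L\to\mathbb{B}$, $V=L'(B_0,-):L'\to\mathbb{B}$. Suppose there are objects $\tilde A\in L^0$, $\tilde B\in L'^0$ such that 1. $U\tilde A\sim V\tilde B$; 2. the hom-functors $L(-,\tilde A):L^{op}\to\mathbb{B}$ and $L'(-,\tilde B):L'^{op}\to\mathbb{B}$ satisfy the initial lifting condition for evaluation cones. Then there exists a natural strict concrete dual adjunction given by functors $G:L^{op}\to L'$, $F:L'\to L^{op}$, i.e. there are isomorphisms of $\infty$-categories $L(A,FB)\simeq L'(B,GA)$ natural in $A$ and $B$, with $V\circ G=L(-,\tilde A)$ and $U\circ F^{op}=L'(-,\tilde B)$, having $(\tilde A,\tilde B)$ as its schizophrenic object.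
   Context: An $\infty$-precategory is a (possibly large) set $L$ with (1) a grading $L=\coprod_{n\ge 0}L^n$; (2) operations $d,c:L^{n+1}\to L^n$ ($n\ge 0$) with $dd=dc$, $cc=cd$; (3) an operation $e:L^n\to L^{n+1}$ with $de=ce=1$; (4) partial binary operations $\circ_k$ ($k\ge1$) of degree $0$, $f\circ_k g$ being defined iff $d^kf=c^kg$. For $a,a'\in L^m$ put $L(a,a')=\{f\in L:\exists k\ge1,\ d^kf=a,\ c^kf=a'\}$, graded by $L^n(a,a')=L(a,a')\cap L^{m+n+1}$; each $L(a,a')$ inherits the structure (1)–(4), and $\circ_{n+1}$ maps $L^n(a',a'')\times L^n(a,a')$ to $L^n(a,a'')$. These maps form the horizontal composite $\mu(g,f)=g*f$, extended to $g\in L^p(a',a'')$, $f\in L^q(a,a')$ by $g*f=\mu(e^{\max(p,q)-p}g,e^{\max(p,q)-q}f)$. The relation $\sim$ is defined (coinductively) for $a,b\in L^n$: $a\sim b$ iff there are $f\in L^0(a,b)$, $g\in L^0(b,a)$ with $ea\sim g\circ_1 f$ and $f\circ_1 g\sim eb$. An $\infty$-category is an $\infty$-precategory such that: $\sim$ is transitive; $f\sim g$, $h\sim k$ imply $f\circ_n h\sim g\circ_n k$ when defined; horizontal composites preserve degree and (whenever the expressions make sense) $\mu(df,dg)=d\mu(f,g)$, $\mu(cf,cg)=c\mu(f,g)$, $\mu(ef,eg)\sim e\mu(f,g)$, $\mu(f\circ_kf',g\circ_kg')\sim\mu(f,g)\circ_k\mu(f',g')$; $(f\circ_kg)\circ_kh\sim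 f\circ_k(g\circ_kh)$; $e^kc^kf\circ_kf\sim f$ and $f\circ_ke^kd^kf\sim f$. It is strict if associativity and unit laws hold with $=$ and horizontal composites preserve identities and composites with $=$. A functor is a degree-preserving map with $F(dx)=dF(x)$, $F(cx)=cF(x)$, $F(ex)\sim eF(x)$, $F(x\circ_ky)\sim F(x)\circ_kF(y)$. An isomorphism of $\infty$-categories is a bijective functor whose inverse is a functor. For functors $F,G:L\to L'$ a natural transformation ($0$-modification) $\alpha:F\to G$ assigns to each $a\in L^0$ some $\alpha(a)\in L'^0(F(a),G(a))$ with $e^k\alpha(b)*F(f)\sim G(f)*e^k\alpha(a)$ for all $f\in L^k(a,b)$, $k\ge0$. Given two parallel $(n-1)$-modifications $\alpha_1,\alpha_2$ from $F$ to $G$, an $n$-modification $\alpha^n:\alpha_1\to\alpha_2$ assigns to each $a\in L^0$ an arrow $\alpha^n(a):\alpha_1(a)\to\alpha_2(a)$ in $L'^n(F(a),G(a))$ with $e^k\alpha^n(b)*F(f)\sim G(f)*e^k\alpha^n(a)$ for all $f\in L^{n+k}(a,b)$, $k\ge0$. $\infty\text{-}\mathbf{CAT}$ is the $\infty$-category with $\infty$-categories in degree $0$, functors in degree $1$, $n$-modifications in degree $n+2$; $d,c$ are source and target, $(e\alpha)(a)=e(\alpha(a))$; composites of $n$-modifications are $(\alpha_1\circ_k\alpha_2)(a)=\alpha_1(a)\circ_k\alpha_2(a)$ for $k<n+2$, and $(\alpha_1\circ_{n+2}\alpha_2)(a)=\alpha_1(F'(a))\circ_{n+1}G'(\alpha_2(a))$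 with $F'=c^{n+1}\alpha_2$, $G'=d^{n+1}\alpha_1$. $L^{op}$ has the same cells as $L$, with $d,c$ interchanged on degree-$1$ cells and the order of $\circ_n$ reversed on degree-$n$ cells. $L(a,-):L\to\infty\text{-}\mathbf{CAT}$ sends $b$ to $L(a,b)$ and a cell $\alpha\in L^n(b,b')$ to $x\mapsto\alpha*x$ (for $n=0$ on all cells $x$, for $n\ge1$ with components at $x\in L^0(a,b)$); $L(-,b)$ is defined dually by $x\mapsto x*\alpha$. A functor $P$ is strictly faithful if it is injective on each hom-set between fixed objects. Evaluations: for $x^n\in L^n(A_0,A)$ put $ev_{A,x^n}:=L(x^n,\tilde A)\in\mathbb{B}^n(L(A,\tilde A),L(A_0,\tilde A))$; similarly $ev_{B,y^n}:=L'(y^n,\tilde B)\in\mathbb{B}^n(L'(B,\tilde B),L'(B_0,\tilde B))$ for $y^n\in L'^n(B_0,B)$. Here $L(A_0,\tilde A)=U\tilde A$ and $L'(B_0,\tilde B)=V\tilde B$ are identified via $U\tilde A\sim V\tilde B$. A cell $f^n\in\mathbb{B}^n(VY,VY')$ is an $L'$-arrow if $f^n=V(\Phi^n)$ for some $\Phi^n\in L'^n(Y,Y')$; $L$-arrows are defined similarly with $U$. The initial lifting condition for evaluation cones consists of: (i) the $\infty$-categories $L(A,\tilde A)$, $L'(B,\tilde B)\in\mathrm{Ob}(\mathbb{B})$ lift to objects $G(A)$ of $L'$ with $VG(A)=L(A,\tilde A)$, respectively $F(B)$ of $L$ with $UF(B)=L'(B,\tilde B)$; (ii) all $ev_{A,x^n}$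 ($x^n\in L^n(A_0,A)$, $n\ge0$) lift to cells in $L'^n(G(A),\tilde B)$, and all $ev_{B,y^n}$ ($y^n\in L'^n(B_0,B)$, $n\geq 0$) lift to cells in $L^n(F(B),\tilde A)$; (iii) for every $X\in L'^0$, a cell $f^n\in\mathbb{B}^n(VX,L(A,\tilde A))$ is an $L'$-arrow iff $\mu(ev_{A,x^n},f^n)\in\mathbb{B}^n(VX,L(A_0,\tilde A))$ is an $L'$-arrow for all $x^n\in L^n(A_0,A)$; symmetrically, for every $Y\in L^0$, $g^n\in\mathbb{B}^n(UY,L'(B,\tilde B))$ is an $L$-arrow iff $\mu(ev_{B,y^n},g^n)$ is an $L$-arrow for all $y^n\in L'^n(B_0,B)$. A strict concrete dual adjunction over $\mathbb{B}$ with schizophrenic object $(\tilde A,\tilde B)$ consists of functors $G:L^{op}\to L'$, $F:L'\to L^{op}$ lifting $L(-,\tilde A)$, $L'(-,\tilde B)$ along $V$, $U$, with isomorphisms $L(A,FB)\simeq L'(B,GA)$ natural in $A,B$. It is natural if both liftings are initial, i.e. satisfy the equivalences in (iii).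
   Formalization: Added: the lifted evaluation cones L(A_0,A)→L'(GA,B̃) and L'(B_0,B)→L(FB,Ã) are cells of 𝔹 (for non-full 𝔹 the claim fails otherwise), and the identification of UÃ with VB̃ is an isomorphism in 𝔹, not merely an equivalence ∼. *)

theory Defs
  imports Main "HOL-Library.FuncSet"
begin

section \<open>Infinity-precategories\<close>

text \<open>The fields are the graded family of cells and the operations \<open>d\<close>, \<open>c\<close>, \<open>e\<close>
  and \<open>\<circ>\<^sub>k\<close>.\<close>

record 'a cells =
  Cell :: "nat \<Rightarrow> 'a set"
  dm :: "'a \<Rightarrow> 'a"
  cd :: "'a \<Rightarrow> 'a"
  idn :: "'a \<Rightarrow> 'a"
  cmp :: "nat \<Rightarrow> 'a \<Rightarrow> 'a \<Rightarrow> 'a"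

definition all_cells :: "'a cells \<Rightarrow> 'a set" where
  "all_cells L = (\<Union>n. Cell L n)"

definition deg :: "'a cells \<Rightarrow> 'a \<Rightarrow> nat" where
  "deg L x = (THE n. x \<in> Cell L n)"

definition composable :: "'a cells \<Rightarrow> nat \<Rightarrow> nat \<Rightarrow> 'a \<Rightarrow> 'a \<Rightarrow> bool" where
  "composable L k n f g \<longleftrightarrow> 1 \<le> k \<and> k \<le> n \<and> f \<in> Cell L n \<and> g \<in> Cell L n \<and>
     (dm L ^^ k) f = (cd L ^^ k) g"

text \<open>The operations are partial. They are kept \<open>undefined\<close> outside their domains, so that
  equality of records is equality of structures.\<close>

definition canon :: "'a cells \<Rightarrow> 'a cells" where
  "canon L =
     \<lparr> Cell = Cell L,
       dm = restrict (dm L) (\<Union>n. Cell L (Suc n)),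
       cd = restrict (cd L) (\<Union>n. Cell L (Suc n)),
       idn = restrict (idn L) (all_cells L),
       cmp = (\<lambda>k f g. if \<exists>n. composable L k n f g then cmp L k f g else undefined) \<rparr>"

text \<open>\<open>hom_cells L n a a'\<close> is \<open>L\<^sup>n(a,a')\<close> for \<open>a\<close>, \<open>a'\<close> of the same degree \<open>m\<close>; its elements
  have degree \<open>m + n + 1\<close> in \<open>L\<close>.\<close>

definition hom_cells :: "'a cells \<Rightarrow> nat \<Rightarrow> 'a \<Rightarrow> 'a \<Rightarrow> 'a set" where
  "hom_cells L n a a' = {f. \<exists>m. a \<in> Cell L m \<and> a' \<in> Cell L m \<and> f \<in> Cell L (m + n + 1) \<and>
     (dm L ^^ (n + 1)) f = a \<and> (cd L ^^ (n + 1)) f = a'}"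

definition hom :: "'a cells \<Rightarrow> 'a \<Rightarrow> 'a \<Rightarrow> 'a cells" where
  "hom L a a' = canon (L\<lparr> Cell := (\<lambda>n. hom_cells L n a a') \<rparr>)"

text \<open>\<open>mu L n\<close> is the horizontal composite on cells of hom-degree \<open>n\<close>, and \<open>hcomp L p q g f\<close> is
  \<open>g * f\<close> for \<open>g\<close>, \<open>f\<close> of hom-degrees \<open>p\<close>, \<open>q\<close>.\<close>

definition mu :: "'a cells \<Rightarrow> nat \<Rightarrow> 'a \<Rightarrow> 'a \<Rightarrow> 'a" where
  "mu L n g f = cmp L (n + 1) g f"

definition hcomp :: "'a cells \<Rightarrow> nat \<Rightarrow> nat \<Rightarrow> 'a \<Rightarrow> 'a \<Rightarrow> 'a" where
  "hcomp L p q g f =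
     mu L (max p q) ((idn L ^^ (max p q - p)) g) ((idn L ^^ (max p q - q)) f)"

coinductive eqv :: "'a cells \<Rightarrow> 'a \<Rightarrow> 'a \<Rightarrow> bool" for L where
  eqvI: "\<lbrakk> a \<in> Cell L n; b \<in> Cell L n; f \<in> hom_cells L 0 a b; g \<in> hom_cells L 0 b a;
     eqv L (idn L a) (cmp L 1 g f); eqv L (cmp L 1 f g) (idn L b) \<rbrakk> \<Longrightarrow> eqv L a b"

text \<open>The axioms \<open>dm_cmp\<close>, \<open>cd_cmp\<close> say that \<open>\<circ>\<^sub>n\<^sub>+\<^sub>1\<close> maps \<open>L\<^sup>n(a',a'') \<times> L\<^sup>n(a,a')\<close> to \<open>L\<^sup>n(a,a'')\<close>.\<close>

locale inf_precategory =
  fixes L :: "'a cells"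
  assumes grading: "m \<noteq> n \<Longrightarrow> Cell L m \<inter> Cell L n = {}"
    and dm_cell: "x \<in> Cell L (Suc n) \<Longrightarrow> dm L x \<in> Cell L n"
    and cd_cell: "x \<in> Cell L (Suc n) \<Longrightarrow> cd L x \<in> Cell L n"
    and dm_dm: "x \<in> Cell L (Suc (Suc n)) \<Longrightarrow> dm L (dm L x) = dm L (cd L x)"
    and cd_cd: "x \<in> Cell L (Suc (Suc n)) \<Longrightarrow> cd L (cd L x) = cd L (dm L x)"
    and idn_cell: "x \<in> Cell L n \<Longrightarrow> idn L x \<in> Cell L (Suc n)"
    and dm_idn: "x \<in> Cell L n \<Longrightarrow> dm L (idn L x) = x"
    and cd_idn: "x \<in> Cell L n \<Longrightarrow> cd L (idn L x) = x"
    and cmp_cell: "composable L k n f g \<Longrightarrow> cmp L k f g \<in> Cell L n"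
    and dm_cmp: "composable L k n f g \<Longrightarrow> (dm L ^^ k) (cmp L k f g) = (dm L ^^ k) g"
    and cd_cmp: "composable L k n f g \<Longrightarrow> (cd L ^^ k) (cmp L k f g) = (cd L ^^ k) f"
    and canonical: "canon L = L"

section \<open>Infinity-categories and functors\<close>

text \<open>In the axioms on horizontal composites, \<open>f\<close> and \<open>g\<close> have the same hom-degree, which is
  positive where \<open>d\<close>, \<open>c\<close> are taken, because \<open>d\<close>, \<open>c\<close> lower the degree inside the hom.\<close>

locale inf_category = inf_precategory +
  assumes eqv_trans: "\<lbrakk> eqv L x y; eqv L y z \<rbrakk> \<Longrightarrow> eqv L x z"
    and eqv_cmp: "\<lbrakk> eqv L f g; eqv L h h'; composable L k n f h; composable L k n g h' \<rbrakk>
      \<Longrightarrow> eqv L (cmp L k f h) (cmp L k g h')"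
    and dm_mu: "\<lbrakk> f \<in> hom_cells L (Suc n) a' a''; g \<in> hom_cells L (Suc n) a a' \<rbrakk>
      \<Longrightarrow> mu L n (dm L f) (dm L g) = dm L (mu L (Suc n) f g)"
    and cd_mu: "\<lbrakk> f \<in> hom_cells L (Suc n) a' a''; g \<in> hom_cells L (Suc n) a a' \<rbrakk>
      \<Longrightarrow> mu L n (cd L f) (cd L g) = cd L (mu L (Suc n) f g)"
    and idn_mu: "\<lbrakk> f \<in> hom_cells L n a' a''; g \<in> hom_cells L n a a' \<rbrakk>
      \<Longrightarrow> eqv L (mu L (Suc n) (idn L f) (idn L g)) (idn L (mu L n f g))"
    and cmp_mu: "\<lbrakk> f \<in> hom_cells L n a' a''; f' \<in> hom_cells L n a' a'';
        g \<in> hom_cells L n a a'; g' \<in> hom_cells L n a a';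
        composable (hom L a' a'') k n f f'; composable (hom L a a') k n g g' \<rbrakk>
      \<Longrightarrow> eqv L (mu L n (cmp L k f f') (cmp L k g g')) (cmp L k (mu L n f g) (mu L n f' g'))"
    and cmp_assoc: "\<lbrakk> composable L k n f g; composable L k n g h \<rbrakk>
      \<Longrightarrow> eqv L (cmp L k (cmp L k f g) h) (cmp L k f (cmp L k g h))"
    and unit_left: "\<lbrakk> f \<in> Cell L n; 1 \<le> k; k \<le> n \<rbrakk>
      \<Longrightarrow> eqv L (cmp L k ((idn L ^^ k) ((cd L ^^ k) f)) f) f"
    and unit_right: "\<lbrakk> f \<in> Cell L n; 1 \<le> k; k \<le> n \<rbrakk>
      \<Longrightarrow> eqv L (cmp L k f ((idn L ^^ k) ((dm L ^^ k) f))) f"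

locale strict_inf_category = inf_category +
  assumes strict_idn_mu: "\<lbrakk> f \<in> hom_cells L n a' a''; g \<in> hom_cells L n a a' \<rbrakk>
      \<Longrightarrow> mu L (Suc n) (idn L f) (idn L g) = idn L (mu L n f g)"
    and strict_cmp_mu: "\<lbrakk> f \<in> hom_cells L n a' a''; f' \<in> hom_cells L n a' a'';
        g \<in> hom_cells L n a a'; g' \<in> hom_cells L n a a';
        composable (hom L a' a'') k n f f'; composable (hom L a a') k n g g' \<rbrakk>
      \<Longrightarrow> mu L n (cmp L k f f') (cmp L k g g') = cmp L k (mu L n f g) (mu L n f' g')"
    and strict_assoc: "\<lbrakk> composable L k n f g; composable L k n g h \<rbrakk>
      \<Longrightarrow> cmp L k (cmp L k f g) h = cmp L k f (cmp L k g h)"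
    and strict_unit_left: "\<lbrakk> f \<in> Cell L n; 1 \<le> k; k \<le> n \<rbrakk>
      \<Longrightarrow> cmp L k ((idn L ^^ k) ((cd L ^^ k) f)) f = f"
    and strict_unit_right: "\<lbrakk> f \<in> Cell L n; 1 \<le> k; k \<le> n \<rbrakk>
      \<Longrightarrow> cmp L k f ((idn L ^^ k) ((dm L ^^ k) f)) = f"

definition inf_functor :: "'a cells \<Rightarrow> 'b cells \<Rightarrow> ('a \<Rightarrow> 'b) \<Rightarrow> bool" where
  "inf_functor L M F \<longleftrightarrow>
     (\<forall>n. \<forall>x \<in> Cell L n. F x \<in> Cell M n) \<and>
     (\<forall>n. \<forall>x \<in> Cell L (Suc n). F (dm L x) = dm M (F x) \<and> F (cd L x) = cd M (F x)) \<and>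
     (\<forall>n. \<forall>x \<in> Cell L n. eqv M (F (idn L x)) (idn M (F x))) \<and>
     (\<forall>k n x y. composable L k n x y \<longrightarrow> eqv M (F (cmp L k x y)) (cmp M k (F x) (F y)))"

definition inf_iso :: "'a cells \<Rightarrow> 'b cells \<Rightarrow> ('a \<Rightarrow> 'b) \<Rightarrow> bool" where
  "inf_iso L M F \<longleftrightarrow> bij_betw F (all_cells L) (all_cells M) \<and>
     inf_functor L M F \<and> inf_functor M L (inv_into (all_cells L) F)"

definition strictly_faithful :: "'a cells \<Rightarrow> ('a \<Rightarrow> 'b) \<Rightarrow> bool" where
  "strictly_faithful L P \<longleftrightarrow>
     (\<forall>a \<in> Cell L 0. \<forall>b \<in> Cell L 0. inj_on P (all_cells (hom L a b)))"

definition opp :: "'a cells \<Rightarrow> 'a cells" where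
  "opp L = canon
     \<lparr> Cell = Cell L,
       dm = (\<lambda>x. if x \<in> Cell L 1 then cd L x else dm L x),
       cd = (\<lambda>x. if x \<in> Cell L 1 then dm L x else cd L x),
       idn = idn L,
       cmp = (\<lambda>n f g. if f \<in> Cell L n then cmp L n g f else cmp L n f g) \<rparr>"

definition subcategory :: "'a cells \<Rightarrow> 'a cells \<Rightarrow> bool" where
  "subcategory B M \<longleftrightarrow>
     (\<forall>n. Cell B n \<subseteq> Cell M n) \<and>
     B = canon (M\<lparr> Cell := Cell B \<rparr>) \<and>
     (\<forall>n. \<forall>x \<in> Cell B (Suc n). dm M x \<in> Cell B n \<and> cd M x \<in> Cell B n) \<and>
     (\<forall>n. \<forall>x \<in> Cell B n. idn M x \<in> Cell B (Suc n)) \<and>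
     (\<forall>k n f g. f \<in> Cell B n \<and> g \<in> Cell B n \<and> composable M k n f g \<longrightarrow> cmp M k f g \<in> Cell B n)"

section \<open>Modifications and the infinity-category of infinity-categories\<close>

text \<open>\<open>modification n L M F G p q h\<close>: \<open>h\<close> is an \<open>n\<close>-modification \<open>p \<rightarrow> q\<close>, where \<open>p\<close>, \<open>q\<close> are the
  component maps of parallel \<open>(n-1)\<close>-modifications from \<open>F\<close> to \<open>G\<close>. For \<open>n = 0\<close> one has
  \<open>p = F\<close> and \<open>q = G\<close>.\<close>

definition modification ::
  "nat \<Rightarrow> 'a cells \<Rightarrow> 'b cells \<Rightarrow> ('a \<Rightarrow> 'b) \<Rightarrow> ('a \<Rightarrow> 'b) \<Rightarrow> ('a \<Rightarrow> 'b) \<Rightarrow> ('a \<Rightarrow> 'b) \<Rightarrow> ('a \<Rightarrow> 'b) \<Rightarrow> bool"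
  where
  "modification n L M F G p q h \<longleftrightarrow>
     (\<forall>a \<in> Cell L 0. h a \<in> hom_cells M n (F a) (G a) \<and> dm M (h a) = p a \<and> cd M (h a) = q a) \<and>
     (\<forall>a \<in> Cell L 0. \<forall>b \<in> Cell L 0. \<forall>k. \<forall>f \<in> hom_cells L (n + k) a b.
        eqv M (mu M (n + k) ((idn M ^^ k) (h b)) (F f)) (mu M (n + k) (G f) ((idn M ^^ k) (h a))))"

abbreviation natural_transformation ::
  "'a cells \<Rightarrow> 'b cells \<Rightarrow> ('a \<Rightarrow> 'b) \<Rightarrow> ('a \<Rightarrow> 'b) \<Rightarrow> ('a \<Rightarrow> 'b) \<Rightarrow> bool" where
  "natural_transformation L M F G h \<equiv> modification 0 L M F G F G h"

text \<open>The type \<open>'x\<close> plays the role of the universe: the objects are the infinity-categories with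
  cells in \<open>'x\<close>, so that cells of different categories can be compared, as in \<open>V(G A) = L(A,At)\<close>. Functors carry their source and target category, and modifications their
  source and target cell. A functor is a map on all cells, the component map of a modification
  is a map on objects; both are \<open>undefined\<close> elsewhere.\<close>

datatype 'x cat_cell =
    CatObj "'x cells"
  | CatFun "'x cells" "'x cells" "'x \<Rightarrow> 'x"
  | CatMod "'x cat_cell" "'x cat_cell" "'x \<Rightarrow> 'x"

fun cat_deg :: "'x cat_cell \<Rightarrow> nat" where
  "cat_deg (CatObj X) = 0"
| "cat_deg (CatFun X Y f) = 1"
| "cat_deg (CatMod s t h) = Suc (cat_deg s)"

fun cat_dm :: "'x cat_cell \<Rightarrow> 'x cat_cell" where
  "cat_dm (CatObj X) = undefined"
| "cat_dm (CatFun X Y f) = CatObj X"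
| "cat_dm (CatMod s t h) = s"

fun cat_cd :: "'x cat_cell \<Rightarrow> 'x cat_cell" where
  "cat_cd (CatObj X) = undefined"
| "cat_cd (CatFun X Y f) = CatObj Y"
| "cat_cd (CatMod s t h) = t"

fun cat_map :: "'x cat_cell \<Rightarrow> 'x \<Rightarrow> 'x" where
  "cat_map (CatObj X) = undefined"
| "cat_map (CatFun X Y f) = f"
| "cat_map (CatMod s t h) = h"

text \<open>The categories between which a cell of positive degree ultimately goes.\<close>

fun dom_cat :: "'x cat_cell \<Rightarrow> 'x cells" where
  "dom_cat (CatObj X) = X"
| "dom_cat (CatFun X Y f) = X"
| "dom_cat (CatMod s t h) = dom_cat s"

fun cod_cat :: "'x cat_cell \<Rightarrow> 'x cells" where
  "cod_cat (CatObj X) = X"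
| "cod_cat (CatFun X Y f) = Y"
| "cod_cat (CatMod s t h) = cod_cat s"

fun cat_Cell :: "nat \<Rightarrow> 'x cat_cell set" where
  "cat_Cell 0 = {CatObj X | X. inf_category X}"
| "cat_Cell (Suc 0) = {CatFun X Y f | X Y f. inf_category X \<and> inf_category Y \<and>
     inf_functor X Y f \<and> f \<in> extensional (all_cells X)}"
| "cat_Cell (Suc (Suc n)) = {CatMod s t h | s t h.
     s \<in> cat_Cell (Suc n) \<and> t \<in> cat_Cell (Suc n) \<and> cat_dm s = cat_dm t \<and> cat_cd s = cat_cd t \<and>
     modification n (dom_cat s) (cod_cat s)
       (cat_map ((cat_dm ^^ n) s)) (cat_map ((cat_cd ^^ n) t)) (cat_map s) (cat_map t) h \<and>
     h \<in> extensional (Cell (dom_cat s) 0)}"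

fun cat_idn :: "'x cat_cell \<Rightarrow> 'x cat_cell" where
  "cat_idn (CatObj X) = CatFun X X (restrict id (all_cells X))"
| "cat_idn \<alpha> = CatMod \<alpha> \<alpha> (\<lambda>a \<in> Cell (dom_cat \<alpha>) 0. idn (cod_cat \<alpha>) (cat_map \<alpha> a))"

text \<open>An \<open>n\<close>-modification has degree \<open>n + 2\<close>. The source and target of a composite are
  \<open>d(\<alpha> \<circ>\<^sub>1 \<beta>) = d\<beta>\<close>, \<open>c(\<alpha> \<circ>\<^sub>1 \<beta>) = c\<alpha>\<close> and, for \<open>k > 1\<close>, \<open>d(\<alpha> \<circ>\<^sub>k \<beta>) = d\<alpha> \<circ>\<^sub>k\<^sub>-\<^sub>1 d\<beta>\<close>,
  \<open>c(\<alpha> \<circ>\<^sub>k \<beta>) = c\<alpha> \<circ>\<^sub>k\<^sub>-\<^sub>1 c\<beta>\<close>. The first case of the component map below is \<open>k < n + 2\<close>; in the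
  second one \<open>m\<close> is \<open>n + 1\<close>.\<close>

fun cat_cmp :: "nat \<Rightarrow> 'x cat_cell \<Rightarrow> 'x cat_cell \<Rightarrow> 'x cat_cell" where
  "cat_cmp k (CatFun Y Z g) (CatFun X Y' f) = CatFun X Z (restrict (g \<circ> f) (all_cells X))"
| "cat_cmp k (CatMod s t h) (CatMod s' t' h') =
     CatMod (if k = 1 then s' else cat_cmp (k - 1) s s')
            (if k = 1 then t else cat_cmp (k - 1) t t')
            (\<lambda>a \<in> Cell (dom_cat s') 0.
               if k < cat_deg (CatMod s t h) then cmp (cod_cat s) k (h a) (h' a)
               else let m = cat_deg s in
                 cmp (cod_cat s) m
                   (h (cat_map ((cat_cd ^^ m) (CatMod s' t' h')) a))
                   (cat_map ((cat_dm ^^ m) (CatMod s t h)) (h' a)))"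
| "cat_cmp k _ _ = undefined"

definition CAT :: "'x cat_cell cells" where
  "CAT = canon \<lparr> Cell = cat_Cell, dm = cat_dm, cd = cat_cd, idn = cat_idn, cmp = cat_cmp \<rparr>"

section \<open>Hom-functors\<close>

text \<open>\<open>hom_from L a\<close> is \<open>L(a,-)\<close> and \<open>hom_to L b\<close> is \<open>L(-,b)\<close>. A cell of hom-degree \<open>n + 1\<close>
  goes to an \<open>n\<close>-modification, whose components are taken at the cells of hom-degree 0.\<close>

fun hom_from_at :: "'x cells \<Rightarrow> 'x \<Rightarrow> nat \<Rightarrow> 'x \<Rightarrow> 'x cat_cell" where
  "hom_from_at L a 0 b = CatObj (hom L a b)"
| "hom_from_at L a (Suc 0) \<alpha> =
     CatFun (hom L a (dm L \<alpha>)) (hom L a (cd L \<alpha>))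
       (\<lambda>x \<in> all_cells (hom L a (dm L \<alpha>)). hcomp L 0 (deg (hom L a (dm L \<alpha>)) x) \<alpha> x)"
| "hom_from_at L a (Suc (Suc n)) \<alpha> =
     CatMod (hom_from_at L a (Suc n) (dm L \<alpha>)) (hom_from_at L a (Suc n) (cd L \<alpha>))
       (\<lambda>x \<in> hom_cells L 0 a ((dm L ^^ (n + 2)) \<alpha>). hcomp L (n + 1) 0 \<alpha> x)"

definition hom_from :: "'x cells \<Rightarrow> 'x \<Rightarrow> 'x \<Rightarrow> 'x cat_cell" where
  "hom_from L a \<alpha> = hom_from_at L a (deg L \<alpha>) \<alpha>"

fun hom_to_at :: "'x cells \<Rightarrow> 'x \<Rightarrow> nat \<Rightarrow> 'x \<Rightarrow> 'x cat_cell" where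
  "hom_to_at L b 0 a = CatObj (hom L a b)"
| "hom_to_at L b (Suc 0) \<alpha> =
     CatFun (hom L (cd L \<alpha>) b) (hom L (dm L \<alpha>) b)
       (\<lambda>x \<in> all_cells (hom L (cd L \<alpha>) b). hcomp L (deg (hom L (cd L \<alpha>) b) x) 0 x \<alpha>)"
| "hom_to_at L b (Suc (Suc n)) \<alpha> =
     CatMod (hom_to_at L b (Suc n) (dm L \<alpha>)) (hom_to_at L b (Suc n) (cd L \<alpha>))
       (\<lambda>x \<in> hom_cells L 0 ((cd L ^^ (n + 2)) \<alpha>) b. hcomp L 0 (n + 1) x \<alpha>)"

definition hom_to :: "'x cells \<Rightarrow> 'x \<Rightarrow> 'x \<Rightarrow> 'x cat_cell" where
  "hom_to L b \<alpha> = hom_to_at L b (deg L \<alpha>) \<alpha>"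

section \<open>Concrete dual adjunctions\<close>

text \<open>The pair \<open>L\<close>, \<open>A0\<close> stands for the category \<open>L\<close> with forgetful functor
  \<open>U = L(A0,-)\<close>.\<close>

definition concrete_over :: "'x cat_cell cells \<Rightarrow> 'x cells \<Rightarrow> 'x \<Rightarrow> bool" where
  "concrete_over B L A0 \<longleftrightarrow> A0 \<in> Cell L 0 \<and> inf_functor L B (hom_from L A0) \<and>
     strictly_faithful L (hom_from L A0)"

definition is_arrow :: "'x cells \<Rightarrow> 'x \<Rightarrow> nat \<Rightarrow> 'x \<Rightarrow> 'x \<Rightarrow> 'x cat_cell \<Rightarrow> bool" where
  "is_arrow L A0 n Y Y' f \<longleftrightarrow> (\<exists>\<Phi> \<in> hom_cells L n Y Y'. f = hom_from L A0 \<Phi>)"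

text \<open>\<open>\<theta>\<close>, \<open>\<theta>'\<close> are mutually inverse functors in \<open>B\<close> along which two objects are identified.\<close>

definition identification ::
  "'a cells \<Rightarrow> 'a \<Rightarrow> 'a \<Rightarrow> 'a \<Rightarrow> 'a \<Rightarrow> bool" where
  "identification B X Y \<theta> \<theta>' \<longleftrightarrow> \<theta> \<in> hom_cells B 0 X Y \<and> \<theta>' \<in> hom_cells B 0 Y X \<and>
     cmp B 1 \<theta>' \<theta> = idn B X \<and> cmp B 1 \<theta> \<theta>' = idn B Y"

text \<open>The following notions are stated for one side, with \<open>G\<close> an object map from \<open>L\<close> to \<open>L'\<close>, where
  \<open>At\<close>, \<open>Bt\<close> are the objects \<open>A\<close>-tilde, \<open>B\<close>-tilde, and \<open>\<theta>\<close> identifies \<open>L(A0,At)\<close> with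
  \<open>L'(B0,Bt)\<close>; the other side is obtained by exchanging the roles of \<open>L\<close> and \<open>L'\<close>. The
  evaluation \<open>ev\<close> at \<open>x\<close> is \<open>hom_to L At x\<close>, and \<open>ev_at\<close> is the same cell with its target
  identified with \<open>L'(B0,Bt)\<close>.\<close>

definition ev_at ::
  "'x cat_cell cells \<Rightarrow> 'x cells \<Rightarrow> 'x \<Rightarrow> 'x cat_cell \<Rightarrow> nat \<Rightarrow> 'x \<Rightarrow> 'x cat_cell" where
  "ev_at B L At \<theta> n x = hcomp B 0 n \<theta> (hom_to L At x)"

definition lifts_objects :: "'x cells \<Rightarrow> 'x \<Rightarrow> 'x cells \<Rightarrow> 'x \<Rightarrow> ('x \<Rightarrow> 'x) \<Rightarrow> bool" where
  "lifts_objects L At L' B0 G \<longleftrightarrow>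
     (\<forall>A \<in> Cell L 0. G A \<in> Cell L' 0 \<and> hom_from L' B0 (G A) = hom_to L At A)"

definition lifts_evaluations ::
  "'x cat_cell cells \<Rightarrow> 'x cells \<Rightarrow> 'x \<Rightarrow> 'x \<Rightarrow> 'x cells \<Rightarrow> 'x \<Rightarrow> 'x \<Rightarrow> 'x cat_cell \<Rightarrow> ('x \<Rightarrow> 'x) \<Rightarrow> bool"
  where
  "lifts_evaluations B L A0 At L' B0 Bt \<theta> G \<longleftrightarrow>
     (\<forall>A \<in> Cell L 0. \<forall>n. \<forall>x \<in> hom_cells L n A0 A.
        is_arrow L' B0 n (G A) Bt (ev_at B L At \<theta> n x))"

definition initial_lifting ::
  "'x cat_cell cells \<Rightarrow> 'x cells \<Rightarrow> 'x \<Rightarrow> 'x \<Rightarrow> 'x cells \<Rightarrow> 'x \<Rightarrow> 'x \<Rightarrow> 'x cat_cell \<Rightarrow> ('x \<Rightarrow> 'x) \<Rightarrow> bool"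
  where
  "initial_lifting B L A0 At L' B0 Bt \<theta> G \<longleftrightarrow>
     (\<forall>A \<in> Cell L 0. \<forall>X \<in> Cell L' 0. \<forall>n. \<forall>f \<in> hom_cells B n (hom_from L' B0 X) (hom_to L At A).
        is_arrow L' B0 n X (G A) f \<longleftrightarrow>
        (\<forall>x \<in> hom_cells L n A0 A.
           is_arrow L' B0 n X Bt (hcomp B 0 n \<theta> (mu B n (hom_to L At x) f))))"

definition initial_lifting_condition ::
  "'x cat_cell cells \<Rightarrow> 'x cells \<Rightarrow> 'x \<Rightarrow> 'x \<Rightarrow> 'x cells \<Rightarrow> 'x \<Rightarrow> 'x \<Rightarrow> 'x cat_cell \<Rightarrow> 'x cat_cell \<Rightarrow>
    ('x \<Rightarrow> 'x) \<Rightarrow> ('x \<Rightarrow> 'x) \<Rightarrow> bool"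
  where
  "initial_lifting_condition B L A0 At L' B0 Bt \<theta> \<theta>' G F \<longleftrightarrow>
     lifts_objects L At L' B0 G \<and> lifts_objects L' Bt L A0 F \<and>
     lifts_evaluations B L A0 At L' B0 Bt \<theta> G \<and> lifts_evaluations B L' B0 Bt L A0 At \<theta>' F \<and>
     initial_lifting B L A0 At L' B0 Bt \<theta> G \<and> initial_lifting B L' B0 Bt L A0 At \<theta>' F"

text \<open>The lifted evaluation cone at \<open>A\<close>, as a map \<open>L(A0,A) \<rightarrow> L'(G A,Bt)\<close> sending \<open>x\<close> to the lift of
  \<open>ev\<close> at \<open>x\<close>, is a cell of \<open>B\<close>. The transpose of \<open>g \<in> L'(Y,G A)\<close> is this cell followed by
  \<open>L'(g,Bt)\<close>, and \<open>initial_lifting\<close> speaks only about cells of \<open>B\<close>. If \<open>B\<close> is a full subcategory and \<open>\<theta>\<close> preserves identities and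
  composites strictly, this follows from \<open>lifts_evaluations\<close> and strict faithfulness.\<close>

definition evaluation_cones_in ::
  "'x cat_cell cells \<Rightarrow> 'x cells \<Rightarrow> 'x \<Rightarrow> 'x \<Rightarrow> 'x cells \<Rightarrow> 'x \<Rightarrow> 'x \<Rightarrow> 'x cat_cell \<Rightarrow> ('x \<Rightarrow> 'x) \<Rightarrow> bool"
  where
  "evaluation_cones_in B L A0 At L' B0 Bt \<theta> G \<longleftrightarrow>
     (\<forall>A \<in> Cell L 0. \<exists>\<eta> \<in> hom_cells B 0 (hom_from L A0 A) (hom_to L' Bt (G A)).
        \<forall>n. \<forall>x \<in> hom_cells L n A0 A.
          cat_map \<eta> x \<in> hom_cells L' n (G A) Bt \<and>
          hom_from L' B0 (cat_map \<eta> x) = ev_at B L At \<theta> n x)"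

text \<open>The maps \<open>\<Theta> A Y\<close> are the isomorphisms \<open>L(A,F Y) \<rightarrow> L'(Y,G A)\<close>.\<close>

definition strict_concrete_dual_adjunction ::
  "'x cells \<Rightarrow> 'x \<Rightarrow> 'x \<Rightarrow> 'x cells \<Rightarrow> 'x \<Rightarrow> 'x \<Rightarrow>
    ('x \<Rightarrow> 'x) \<Rightarrow> ('x \<Rightarrow> 'x) \<Rightarrow> ('x \<Rightarrow> 'x \<Rightarrow> 'x \<Rightarrow> 'x) \<Rightarrow> bool"
  where
  "strict_concrete_dual_adjunction L A0 At L' B0 Bt G F \<Theta> \<longleftrightarrow>
     inf_functor (opp L) L' G \<and> inf_functor L' (opp L) F \<and>
     (\<forall>\<alpha> \<in> all_cells L. hom_from L' B0 (G \<alpha>) = hom_to L At \<alpha>) \<and>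
     (\<forall>\<beta> \<in> all_cells L'. hom_from L A0 (F \<beta>) = hom_to L' Bt \<beta>) \<and>
     (\<forall>A \<in> Cell L 0. \<forall>Y \<in> Cell L' 0. inf_iso (hom L A (F Y)) (hom L' Y (G A)) (\<Theta> A Y)) \<and>
     (\<forall>Y \<in> Cell L' 0. natural_transformation (opp L) CAT (hom_to L (F Y)) (hom_from L' Y \<circ> G)
        (\<lambda>A. CatFun (hom L A (F Y)) (hom L' Y (G A))
               (restrict (\<Theta> A Y) (all_cells (hom L A (F Y)))))) \<and>
     (\<forall>A \<in> Cell L 0. natural_transformation (opp L') CAT (hom_from L A \<circ> F) (hom_to L' (G A))
        (\<lambda>Y. CatFun (hom L A (F Y)) (hom L' Y (G A))
               (restrict (\<Theta> A Y) (all_cells (hom L A (F Y))))))"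

definition natural_strict_concrete_dual_adjunction ::
  "'x cat_cell cells \<Rightarrow> 'x cells \<Rightarrow> 'x \<Rightarrow> 'x \<Rightarrow> 'x cells \<Rightarrow> 'x \<Rightarrow> 'x \<Rightarrow> 'x cat_cell \<Rightarrow> 'x cat_cell \<Rightarrow>
    ('x \<Rightarrow> 'x) \<Rightarrow> ('x \<Rightarrow> 'x) \<Rightarrow> ('x \<Rightarrow> 'x \<Rightarrow> 'x \<Rightarrow> 'x) \<Rightarrow> bool"
  where
  "natural_strict_concrete_dual_adjunction B L A0 At L' B0 Bt \<theta> \<theta>' G F \<Theta> \<longleftrightarrow>
     strict_concrete_dual_adjunction L A0 At L' B0 Bt G F \<Theta> \<and>
     initial_lifting B L A0 At L' B0 Bt \<theta> G \<and> initial_lifting B L' B0 Bt L A0 At \<theta>' F"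

end

theory Submission
  imports Defs
begin

text \<open>
  The functor \<open>G\<close> is forced on cells. A cell \<open>\<alpha> : A \<rightarrow> A'\<close> of \<open>L\<close> gives the cell \<open>L(\<alpha>,At)\<close> of \<open>B\<close> from
  \<open>L(A',At) = V (G A')\<close> to \<open>L(A,At) = V (G A)\<close>. Followed by the evaluation at \<open>x\<close> it becomes the evaluation
  at \<open>\<alpha> \<circ> x\<close>, which lifts to \<open>L'\<close>; so \<open>L(\<alpha>,At)\<close> lifts by the initial lifting condition, uniquely because
  \<open>V\<close> is faithful. Since \<open>V\<close> and \<open>L(-,At)\<close> preserve all operations of the strict categories on the nose,
  faithfulness makes \<open>G\<close> a strict functor.

  The transpose of \<open>\<Phi> : A \<rightarrow> F Y\<close> is found in the same way. Let \<open>\<eta>\<close> be the lifted evaluation cone of \<open>Y\<close>, so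
  that \<open>\<eta>(y) : F Y \<rightarrow> At\<close> lies over the evaluation at \<open>y\<close>. The cell of \<open>B\<close> underlying the transpose must be
  \<open>y \<mapsto> \<eta>(y) \<circ> \<Phi>\<close>. Followed by the evaluation at \<open>x\<close> and by \<open>\<theta>\<close> it is \<open>y \<mapsto> \<theta>(\<eta>(y) \<circ> (\<Phi> \<circ> x))\<close>. Now \<open>\<Phi> \<circ> x\<close> is
  a cell of \<open>L(A0,F Y) = L'(Y,Bt)\<close>, and \<open>\<theta>(\<eta>(y) \<circ> z) = z \<circ> y\<close> for every such \<open>z\<close>, by the choice of \<open>\<eta>(y)\<close>. So the
  composite is \<open>V (\<Phi> \<circ> x)\<close>, an arrow of \<open>L'\<close> (lemma \<open>evaluation_identity\<close>), and the transpose exists by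
  the initial lifting condition (lemma \<open>transpose_exists\<close>).

  Transposing back recovers \<open>\<Phi>\<close> because \<open>\<Phi> \<circ> x = \<epsilon>(x) \<circ> \<Theta> \<Phi>\<close>, where \<open>\<epsilon>\<close> is the lifted evaluation cone of \<open>A\<close>:
  both sides have the same image under \<open>V\<close>, again by \<open>evaluation_identity\<close> (lemma \<open>transpose_symmetric\<close>).
  The situation is symmetric in \<open>L\<close> and \<open>L'\<close>, so \<open>\<Theta>\<close> is bijective; that it is a strict functor and natural
  in both variables is checked after applying \<open>V\<close>.

  Two features of the higher-dimensional setting shape the argument. The identification \<open>\<theta>\<close> and the cones
  \<open>\<eta>\<close>, \<open>\<epsilon>\<close> preserve identities and composites only up to equivalence, while all the equations above hold
  on the nose. They hold because \<open>\<theta>\<close> and the cones enter only through whiskering: composing with the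
  iterated identity of a functor acts on components by applying that functor, and this uses nothing but
  the strict laws of the hom-categories (lemmas \<open>cat_cmp_idn_pow_left\<close> and \<open>cat_cmp_idn_pow_right\<close>). Secondly,
  naturality is an equivalence in the infinity-category of infinity-categories. Here both sides are
  equal, and a cell whose target category is strict is equivalent to itself (lemma \<open>eqv_CAT_refl\<close>).
\<close>

section \<open>Globular structure\<close>

locale globular =
  fixes L :: "'a cells"
  assumes grading: "x \<in> Cell L m \<Longrightarrow> x \<in> Cell L n \<Longrightarrow> m = n"
    and dm_cell: "x \<in> Cell L (Suc n) \<Longrightarrow> dm L x \<in> Cell L n"
    and cd_cell: "x \<in> Cell L (Suc n) \<Longrightarrow> cd L x \<in> Cell L n"
    and dm_cd: "x \<in> Cell L (Suc (Suc n)) \<Longrightarrow> dm L (cd L x) = dm L (dm L x)"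
    and cd_dm: "x \<in> Cell L (Suc (Suc n)) \<Longrightarrow> cd L (dm L x) = cd L (cd L x)"
    and idn_cell: "x \<in> Cell L n \<Longrightarrow> idn L x \<in> Cell L (Suc n)"
    and dm_idn: "x \<in> Cell L n \<Longrightarrow> dm L (idn L x) = x"
    and cd_idn: "x \<in> Cell L n \<Longrightarrow> cd L (idn L x) = x"
begin

lemma dm_pow_cell: "x \<in> Cell L (n + k) \<Longrightarrow> (dm L ^^ k) x \<in> Cell L n"
  by (induction k arbitrary: x) (auto simp: funpow_swap1 dm_cell)

lemma cd_pow_cell: "x \<in> Cell L (n + k) \<Longrightarrow> (cd L ^^ k) x \<in> Cell L n"
  by (induction k arbitrary: x) (auto simp: funpow_swap1 cd_cell)

lemma idn_pow_cell: "x \<in> Cell L n \<Longrightarrow> (idn L ^^ k) x \<in> Cell L (n + k)"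
  by (induction k) (auto simp: idn_cell)

lemma dm_pow_idn_pow: "x \<in> Cell L n \<Longrightarrow> (dm L ^^ k) ((idn L ^^ k) x) = x"
proof (induction k arbitrary: x)
  case (Suc k)
  have "(idn L ^^ k) x \<in> Cell L (n + k)" using Suc.prems by (rule idn_pow_cell)
  then have "dm L (idn L ((idn L ^^ k) x)) = (idn L ^^ k) x" by (rule dm_idn)
  then show ?case using Suc by (simp add: funpow_swap1[of "dm L"])
qed simp

lemma cd_pow_idn_pow: "x \<in> Cell L n \<Longrightarrow> (cd L ^^ k) ((idn L ^^ k) x) = x"
proof (induction k arbitrary: x)
  case (Suc k)
  have "(idn L ^^ k) x \<in> Cell L (n + k)" using Suc.prems by (rule idn_pow_cell)
  then have "cd L (idn L ((idn L ^^ k) x)) = (idn L ^^ k) x" by (rule cd_idn)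
  then show ?case using Suc by (simp add: funpow_swap1[of "cd L"])
qed simp

lemma dm_pow_cd:
  assumes "1 \<le> k" "Suc k \<le> n" "x \<in> Cell L n"
  shows "(dm L ^^ k) (cd L x) = (dm L ^^ k) (dm L x)"
proof -
  obtain j where k: "k = Suc j" using assms(1) by (cases k) auto
  obtain m where n: "n = Suc (Suc m)" using assms(2) k by (intro that[of "n - 2"]) auto
  show ?thesis using dm_cd[of x m] assms(3) by (simp add: k n funpow_swap1)
qed

lemma cd_pow_dm:
  assumes "1 \<le> k" "Suc k \<le> n" "x \<in> Cell L n"
  shows "(cd L ^^ k) (dm L x) = (cd L ^^ k) (cd L x)"
proof -
  obtain j where k: "k = Suc j" using assms(1) by (cases k) auto
  obtain m where n: "n = Suc (Suc m)" using assms(2) k by (intro that[of "n - 2"]) auto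
  show ?thesis using cd_dm[of x m] assms(3) by (simp add: k n funpow_swap1)
qed

text \<open>A source step is absorbed by a later target step, which is why \<open>j\<close> must be positive.\<close>

lemma cd_dm_pow:
  "Suc k \<le> n \<Longrightarrow> 1 \<le> j \<Longrightarrow> j + k \<le> n \<Longrightarrow> x \<in> Cell L n \<Longrightarrow> (cd L ^^ j) ((dm L ^^ k) x) = (cd L ^^ (j + k)) x"
proof (induction k arbitrary: x n)
  case (Suc k)
  then obtain n' where n: "n = Suc n'" by (cases n) auto
  have "(cd L ^^ j) ((dm L ^^ Suc k) x) = (cd L ^^ j) ((dm L ^^ k) (dm L x))"
    by (simp add: funpow_swap1)
  also have "\<dots> = (cd L ^^ (j + k)) (dm L x)"
    using Suc.prems by (intro Suc.IH[of n']) (auto simp: n dm_cell)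
  also have "\<dots> = (cd L ^^ (j + k)) (cd L x)"
    using Suc.prems by (intro cd_pow_dm[of _ n]) auto
  finally show ?case by (simp add: funpow_swap1)
qed simp

lemma dm_cd_pow:
  "Suc k \<le> n \<Longrightarrow> 1 \<le> j \<Longrightarrow> j + k \<le> n \<Longrightarrow> x \<in> Cell L n \<Longrightarrow> (dm L ^^ j) ((cd L ^^ k) x) = (dm L ^^ (j + k)) x"
proof (induction k arbitrary: x n)
  case (Suc k)
  then obtain n' where n: "n = Suc n'" by (cases n) auto
  have "(dm L ^^ j) ((cd L ^^ Suc k) x) = (dm L ^^ j) ((cd L ^^ k) (cd L x))"
    by (simp add: funpow_swap1)
  also have "\<dots> = (dm L ^^ (j + k)) (cd L x)"
    using Suc.prems by (intro Suc.IH[of n']) (auto simp: n cd_cell)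
  also have "\<dots> = (dm L ^^ (j + k)) (dm L x)"
    using Suc.prems by (intro dm_pow_cd[of _ n]) auto
  finally show ?case by (simp add: funpow_swap1)
qed simp

lemma hom_cells_dm: "f \<in> hom_cells L (Suc n) a b \<Longrightarrow> dm L f \<in> hom_cells L n a b"
proof -
  assume "f \<in> hom_cells L (Suc n) a b"
  then obtain m where m: "a \<in> Cell L m" "b \<in> Cell L m" "f \<in> Cell L (Suc (m + Suc n))"
    "(dm L ^^ Suc n) (dm L f) = a" "(cd L ^^ Suc n) (cd L f) = b"
    unfolding hom_cells_def by (auto simp: funpow_swap1)
  then show ?thesis using cd_pow_dm[of "Suc n" "Suc (m + Suc n)" f] dm_cell[OF m(3)]
    unfolding hom_cells_def by (auto simp del: funpow.simps intro!: exI[of _ m])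
qed

lemma hom_cells_cd: "f \<in> hom_cells L (Suc n) a b \<Longrightarrow> cd L f \<in> hom_cells L n a b"
proof -
  assume "f \<in> hom_cells L (Suc n) a b"
  then obtain m where m: "a \<in> Cell L m" "b \<in> Cell L m" "f \<in> Cell L (Suc (m + Suc n))"
    "(dm L ^^ Suc n) (dm L f) = a" "(cd L ^^ Suc n) (cd L f) = b"
    unfolding hom_cells_def by (auto simp: funpow_swap1)
  then show ?thesis using dm_pow_cd[of "Suc n" "Suc (m + Suc n)" f] cd_cell[OF m(3)]
    unfolding hom_cells_def by (auto simp del: funpow.simps intro!: exI[of _ m])
qed

lemma hom_cells_idn: "f \<in> hom_cells L n a b \<Longrightarrow> idn L f \<in> hom_cells L (Suc n) a b"
proof -
  assume "f \<in> hom_cells L n a b"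
  then obtain m where m: "a \<in> Cell L m" "b \<in> Cell L m" "f \<in> Cell L (m + Suc n)"
    "(dm L ^^ Suc n) f = a" "(cd L ^^ Suc n) f = b"
    unfolding hom_cells_def by auto
  have "(dm L ^^ Suc (Suc n)) (idn L f) = a" "(cd L ^^ Suc (Suc n)) (idn L f) = b"
    using dm_idn[OF m(3)] cd_idn[OF m(3)] m(4,5)
    by (simp_all only: funpow_Suc_right[of "Suc n"] o_apply)
  then show ?thesis using m(1,2) idn_cell[OF m(3)]
    unfolding hom_cells_def mem_Collect_eq by (intro exI[of _ m]) (simp del: funpow.simps)
qed

lemma hom_cells_idn_pow: "f \<in> hom_cells L n a b \<Longrightarrow> (idn L ^^ k) f \<in> hom_cells L (n + k) a b"
  by (induction k) (auto simp: hom_cells_idn)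

lemma hom_cells_dm_pow: "f \<in> hom_cells L (n + k) a b \<Longrightarrow> (dm L ^^ k) f \<in> hom_cells L n a b"
  by (induction k arbitrary: f) (auto simp: funpow_swap1 hom_cells_dm)

lemma hom_cells_cd_pow: "f \<in> hom_cells L (n + k) a b \<Longrightarrow> (cd L ^^ k) f \<in> hom_cells L n a b"
  by (induction k arbitrary: f) (auto simp: funpow_swap1 hom_cells_cd)

lemma hom_cells_iff:
  assumes "a \<in> Cell L 0"
  shows "f \<in> hom_cells L n a b \<longleftrightarrow>
    f \<in> Cell L (Suc n) \<and> (dm L ^^ Suc n) f = a \<and> (cd L ^^ Suc n) f = b"
proof -
  have *: "a \<in> Cell L m \<longleftrightarrow> m = 0" for m using grading assms by blast
  show ?thesis unfolding hom_cells_def * using cd_pow_cell[of f 0 "Suc n"]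
    by (auto simp del: funpow.simps)
qed

lemma hom_cells_unique: "f \<in> hom_cells L m a b \<Longrightarrow> f \<in> hom_cells L n a b \<Longrightarrow> m = n"
proof -
  assume "f \<in> hom_cells L m a b" "f \<in> hom_cells L n a b"
  then obtain p q where "a \<in> Cell L p" "a \<in> Cell L q" "f \<in> Cell L (p + m + 1)" "f \<in> Cell L (q + n + 1)"
    unfolding hom_cells_def by auto
  then have "p = q" "p + m + 1 = q + n + 1" using grading by blast+
  then show "m = n" by simp
qed

lemma deg_eq: "x \<in> Cell L n \<Longrightarrow> deg L x = n"
  unfolding deg_def using grading by blast

end

section \<open>Strict composition\<close>

text \<open>The equational content of a strict category, with \<open>eqv\<close> removed. The laws of the horizontal composite are
  stated for \<open>\<circ>\<^sub>j\<close> and \<open>\<circ>\<^sub>k\<close> with \<open>k < j\<close>: in this form they do not mention hom-categories, and they pass to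
  opposite and to hom-categories.\<close>

locale strict_omega = globular +
  assumes cmp_cell: "composable L k n f g \<Longrightarrow> cmp L k f g \<in> Cell L n"
    and dm_cmp_1: "composable L 1 n f g \<Longrightarrow> dm L (cmp L 1 f g) = dm L g"
    and cd_cmp_1: "composable L 1 n f g \<Longrightarrow> cd L (cmp L 1 f g) = cd L f"
    and dm_cmp_Suc: "composable L (Suc k) n f g \<Longrightarrow> 1 \<le> k \<Longrightarrow>
      dm L (cmp L (Suc k) f g) = cmp L k (dm L f) (dm L g)"
    and cd_cmp_Suc: "composable L (Suc k) n f g \<Longrightarrow> 1 \<le> k \<Longrightarrow>
      cd L (cmp L (Suc k) f g) = cmp L k (cd L f) (cd L g)"
    and idn_cmp: "composable L k n f g \<Longrightarrow> idn L (cmp L k f g) = cmp L (Suc k) (idn L f) (idn L g)"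
    and interchange: "\<lbrakk> composable L j n f g; composable L j n f' g'; composable L k n f f';
      composable L k n g g'; k < j \<rbrakk> \<Longrightarrow>
      cmp L j (cmp L k f f') (cmp L k g g') = cmp L k (cmp L j f g) (cmp L j f' g')"
    and assoc: "\<lbrakk> composable L k n f g; composable L k n g h \<rbrakk>
      \<Longrightarrow> cmp L k (cmp L k f g) h = cmp L k f (cmp L k g h)"
    and unit_left: "\<lbrakk> f \<in> Cell L n; 1 \<le> k; k \<le> n \<rbrakk>
      \<Longrightarrow> cmp L k ((idn L ^^ k) ((cd L ^^ k) f)) f = f"
    and unit_right: "\<lbrakk> f \<in> Cell L n; 1 \<le> k; k \<le> n \<rbrakk>
      \<Longrightarrow> cmp L k f ((idn L ^^ k) ((dm L ^^ k) f)) = f"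

lemma (in globular) composable_dm:
  assumes "composable L (Suc k) n f g" "1 \<le> k"
  shows "composable L k (n - 1) (dm L f) (dm L g)" "composable L k (n - 1) (cd L f) (cd L g)"
proof -
  obtain m where n: "n = Suc m" using assms by (cases n) (auto simp: composable_def)
  have c: "f \<in> Cell L (Suc m)" "g \<in> Cell L (Suc m)" "k \<le> m" "(dm L ^^ k) (dm L f) = (cd L ^^ k) (cd L g)"
    using assms by (auto simp: composable_def n funpow_swap1)
  show "composable L k (n - 1) (dm L f) (dm L g)"
    using c assms(2) cd_pow_dm[of k "Suc m" g] by (simp add: composable_def n dm_cell)
  show "composable L k (n - 1) (cd L f) (cd L g)"
    using c assms(2) dm_pow_cd[of k "Suc m" f] by (simp add: composable_def n cd_cell)
qed

lemma (in globular) composable_in_hom: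
  assumes "composable L (Suc j) N f g"
  shows "f \<in> hom_cells L j ((dm L ^^ Suc j) f) ((cd L ^^ Suc j) f)"
    "g \<in> hom_cells L j ((dm L ^^ Suc j) g) ((dm L ^^ Suc j) f)"
  using assms dm_pow_cell[of f "N - Suc j" "Suc j"] cd_pow_cell[of f "N - Suc j" "Suc j"]
    dm_pow_cell[of g "N - Suc j" "Suc j"]
  by (auto simp: composable_def hom_cells_def simp del: funpow.simps intro!: exI[of _ "N - Suc j"])

lemma Cell_hom [simp]: "Cell (hom L a b) n = hom_cells L n a b"
  by (simp add: hom_def canon_def)

lemma dm_hom: "f \<in> hom_cells L (Suc n) a b \<Longrightarrow> dm (hom L a b) f = dm L f"
  by (auto simp: hom_def canon_def)

lemma cd_hom: "f \<in> hom_cells L (Suc n) a b \<Longrightarrow> cd (hom L a b) f = cd L f"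
  by (auto simp: hom_def canon_def)

lemma idn_hom: "f \<in> hom_cells L n a b \<Longrightarrow> idn (hom L a b) f = idn L f"
  by (auto simp: hom_def canon_def all_cells_def)

context globular begin

lemma dm_hom_pow: "f \<in> hom_cells L n a b \<Longrightarrow> k \<le> n \<Longrightarrow> (dm (hom L a b) ^^ k) f = (dm L ^^ k) f"
proof (induction k arbitrary: f n)
  case (Suc k)
  obtain n' where n: "n = Suc n'" using Suc.prems(2) by (cases n) auto
  have f: "f \<in> hom_cells L (Suc n') a b" using Suc.prems(1) n by simp
  have "(dm (hom L a b) ^^ k) (dm L f) = (dm L ^^ k) (dm L f)"
    using Suc.IH[OF hom_cells_dm[OF f]] Suc.prems(2) n by simp
  then show ?case unfolding funpow_Suc_right o_apply dm_hom[OF f] .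
qed simp

lemma cd_hom_pow: "f \<in> hom_cells L n a b \<Longrightarrow> k \<le> n \<Longrightarrow> (cd (hom L a b) ^^ k) f = (cd L ^^ k) f"
proof (induction k arbitrary: f n)
  case (Suc k)
  obtain n' where n: "n = Suc n'" using Suc.prems(2) by (cases n) auto
  have f: "f \<in> hom_cells L (Suc n') a b" using Suc.prems(1) n by simp
  have "(cd (hom L a b) ^^ k) (cd L f) = (cd L ^^ k) (cd L f)"
    using Suc.IH[OF hom_cells_cd[OF f]] Suc.prems(2) n by simp
  then show ?case unfolding funpow_Suc_right o_apply cd_hom[OF f] .
qed simp

lemma idn_hom_pow: "f \<in> hom_cells L n a b \<Longrightarrow> (idn (hom L a b) ^^ k) f = (idn L ^^ k) f"
proof (induction k)
  case (Suc k)
  then show ?case using idn_hom[OF hom_cells_idn_pow[of f n a b k]] by simp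
qed simp

lemma composable_hom_iff:
  "composable (hom L a b) k n f g \<longleftrightarrow>
     1 \<le> k \<and> k \<le> n \<and> f \<in> hom_cells L n a b \<and> g \<in> hom_cells L n a b \<and> (dm L ^^ k) f = (cd L ^^ k) g"
  by (auto simp: composable_def dm_hom_pow cd_hom_pow)

lemma cmp_hom: "composable (hom L a b) k n f g \<Longrightarrow> cmp (hom L a b) k f g = cmp L k f g"
proof -
  assume *: "composable (hom L a b) k n f g"
  have "composable (hom L a b) k n f g \<Longrightarrow> composable (L\<lparr>Cell := \<lambda>n. hom_cells L n a b\<rparr>) k n f g"
    unfolding composable_hom_iff by (simp add: composable_def)
  then show ?thesis using * by (auto simp: hom_def canon_def)
qed

text \<open>By globularity two cells that meet in degree \<open>k\<close> below their own have equal sources, and equal targets,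
  further down; so they lie in a common hom-category.\<close>

lemma composable_hom:
  assumes "composable L k N f g" "composable L (Suc n) N f h" "k \<le> n"
  shows "composable (hom L ((dm L ^^ Suc n) f) ((cd L ^^ Suc n) f)) k n f g"
proof -
  have k: "f \<in> Cell L N" "g \<in> Cell L N" "Suc n \<le> N" "1 \<le> k" "(dm L ^^ k) f = (cd L ^^ k) g"
    using assms by (auto simp: composable_def simp del: funpow.simps)
  obtain j where j: "Suc n = j + k" "1 \<le> j" using assms(3)
    by (intro that[of "Suc n - k"]) auto
  have "(dm L ^^ Suc n) g = (dm L ^^ j) ((cd L ^^ k) g)"
    using k j dm_cd_pow[of k N j g] by (simp del: funpow.simps)
  also have "\<dots> = (dm L ^^ Suc n) f" by (simp add: j k(5)[symmetric] funpow_add del: funpow.simps)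
  finally have d: "(dm L ^^ Suc n) g = (dm L ^^ Suc n) f" .
  have "(cd L ^^ Suc n) f = (cd L ^^ j) ((dm L ^^ k) f)"
    using k j cd_dm_pow[of k N j f] by (simp del: funpow.simps)
  also have "\<dots> = (cd L ^^ Suc n) g" by (simp add: j k(5) funpow_add del: funpow.simps)
  finally have c: "(cd L ^^ Suc n) g = (cd L ^^ Suc n) f" by simp
  have *: "(dm L ^^ Suc n) f \<in> Cell L (N - Suc n)"  "(cd L ^^ Suc n) f \<in> Cell L (N - Suc n)"
    using k dm_pow_cell[of f "N - Suc n" "Suc n"] cd_pow_cell[of f "N - Suc n" "Suc n"] by (auto simp del: funpow.simps)
  show ?thesis unfolding composable_hom_iff hom_cells_def using k assms(3) d c *
    by (auto simp del: funpow.simps intro!: exI[of _ "N - Suc n"])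
qed

end

lemma (in inf_precategory) globular: "globular L"
proof
  show "x \<in> Cell L m \<Longrightarrow> x \<in> Cell L n \<Longrightarrow> m = n" for x m n using grading[of m n] by blast
qed (use dm_dm cd_cd in \<open>auto simp: dm_cell cd_cell idn_cell dm_idn cd_idn\<close>)

text \<open>\<open>mu L n\<close> is \<open>\<circ>\<^sub>n\<^sub>+\<^sub>1\<close>, and any two cells composable along \<open>\<circ>\<^sub>n\<^sub>+\<^sub>1\<close> lie in homs on which \<open>mu L n\<close> is defined. So
  the axioms on horizontal composites are laws between \<open>\<circ>\<^sub>n\<^sub>+\<^sub>1\<close> and the lower \<open>\<circ>\<^sub>k\<close>.\<close>

lemma (in strict_inf_category) strict_omega: "strict_omega L"
proof -
  interpret globular L by (rule globular)
  show ?thesis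
  proof
    fix k n f g assume c: "composable L k n f g"
    then show "cmp L k f g \<in> Cell L n" by (rule inf_precategory_axioms[THEN inf_precategory.cmp_cell])
    obtain j where j: "k = Suc j" using c by (cases k) (auto simp: composable_def)
    show "idn L (cmp L k f g) = cmp L (Suc k) (idn L f) (idn L g)"
      using strict_idn_mu[OF composable_in_hom[OF c[unfolded j]]] by (simp add: mu_def j)
  next
    fix k n f g assume c: "composable L (Suc k) n f g" and k: "1 \<le> k"
    obtain j where j: "k = Suc j" using k by (cases k) auto
    show "dm L (cmp L (Suc k) f g) = cmp L k (dm L f) (dm L g)"
      "cd L (cmp L (Suc k) f g) = cmp L k (cd L f) (cd L g)"
      using dm_mu[OF composable_in_hom[OF c, unfolded j]] cd_mu[OF composable_in_hom[OF c, unfolded j]]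
      by (simp_all add: mu_def j)
  next
    fix j n f g f' g' k
    assume c: "composable L j n f g" "composable L j n f' g'" "composable L k n f f'"
      "composable L k n g g'" "k < j"
    obtain i where j: "j = Suc i" using c by (cases j) auto
    have k: "k \<le> i" using c j by simp
    \<comment> \<open>A unit serves as a partner of \<open>g\<close> along \<open>\<circ>\<^sub>j\<close>, which places \<open>g\<close> and \<open>g'\<close> in a common hom.\<close>
    have g: "composable L j n g ((idn L ^^ j) ((dm L ^^ j) g))"
      using c idn_pow_cell[OF dm_pow_cell[of g "n - j" j], of j] cd_pow_idn_pow[OF dm_pow_cell[of g "n - j" j], of j] unfolding composable_def by simp
    have 1: "composable (hom L ((dm L ^^ Suc i) f) ((cd L ^^ Suc i) f)) k i f f'"
      by (rule composable_hom[OF c(3) c(1)[unfolded j] k])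
    have 2: "composable (hom L ((dm L ^^ Suc i) g) ((cd L ^^ Suc i) g)) k i g g'"
      by (rule composable_hom[OF c(4) g[unfolded j] k])
    have 3: "(cd L ^^ Suc i) g = (dm L ^^ Suc i) f" using c(1) by (simp add: composable_def j del: funpow.simps)
    show "cmp L j (cmp L k f f') (cmp L k g g') = cmp L k (cmp L j f g) (cmp L j f' g')"
      using strict_cmp_mu[OF _ _ _ _ 1 2[unfolded 3]] 1[unfolded composable_hom_iff] 2[unfolded composable_hom_iff 3]
      by (simp add: mu_def j del: funpow.simps)
  next
    fix n f g assume c: "composable L 1 n f g"
    show "dm L (cmp L 1 f g) = dm L g" "cd L (cmp L 1 f g) = cd L f"
      using dm_cmp[OF c] cd_cmp[OF c] by simp_all
  qed (fact strict_assoc strict_unit_left strict_unit_right)+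
qed

context globular begin

lemma composable_idn:
  assumes "composable L k n f g"
  shows "composable L (Suc k) (Suc n) (idn L f) (idn L g)"
proof -
  have c: "f \<in> Cell L n" "g \<in> Cell L n" "1 \<le> k" "k \<le> n" "(dm L ^^ k) f = (cd L ^^ k) g"
    using assms by (auto simp: composable_def)
  show ?thesis unfolding composable_def funpow_Suc_right o_apply dm_idn[OF c(1)] cd_idn[OF c(2)]
    using c by (simp add: idn_cell)
qed

lemma composable_idn_pow:
  "composable L k n f g \<Longrightarrow> composable L (k + j) (n + j) ((idn L ^^ j) f) ((idn L ^^ j) g)"
  by (induction j) (auto simp: composable_idn)

lemma hom_cells_target:
  assumes "a \<in> Cell L 0" "f \<in> hom_cells L n a b" shows "b \<in> Cell L 0"
  using assms grading unfolding hom_cells_def by blast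

lemma composable_mu:
  assumes "a \<in> Cell L 0" "f \<in> hom_cells L n b c" "g \<in> hom_cells L n a b"
  shows "composable L (Suc n) (Suc n) f g"
proof -
  have b: "b \<in> Cell L 0" using hom_cells_target assms(1,3) .
  show ?thesis using assms(2,3) unfolding hom_cells_iff[OF b] hom_cells_iff[OF assms(1)]
    by (auto simp: composable_def simp del: funpow.simps)
qed

lemma hom_cells_Cell: "a \<in> Cell L 0 \<Longrightarrow> f \<in> hom_cells L n a b \<Longrightarrow> f \<in> Cell L (Suc n)"
  by (simp add: hom_cells_iff)

lemma composable_of_hom:
  assumes "a \<in> Cell L 0" "composable (hom L a b) k n f g"
  shows "composable L k (Suc n) f g"
  using assms(2)[unfolded composable_hom_iff] hom_cells_Cell[OF assms(1)] by (auto simp: composable_def)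

lemma dm_idn_pow_less: "x \<in> Cell L n \<Longrightarrow> (dm L ^^ k) ((idn L ^^ (k + j)) x) = (idn L ^^ j) x"
  using dm_pow_idn_pow[of "(idn L ^^ j) x" "n + j" k] by (simp add: funpow_add idn_pow_cell)

lemma cd_idn_pow_less: "x \<in> Cell L n \<Longrightarrow> (cd L ^^ k) ((idn L ^^ (k + j)) x) = (idn L ^^ j) x"
  using cd_pow_idn_pow[of "(idn L ^^ j) x" "n + j" k] by (simp add: funpow_add idn_pow_cell)

end

context strict_omega begin

lemma dm_pow_cmp: "composable L k n f g \<Longrightarrow> (dm L ^^ k) (cmp L k f g) = (dm L ^^ k) g"
proof (induction k arbitrary: n f g)
  case (Suc k)
  show ?case
  proof (cases "k = 0")
    case True
    then show ?thesis using dm_cmp_1[of n f g] Suc.prems by simp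
  next
    case False
    then show ?thesis unfolding funpow_Suc_right o_apply
      using Suc.IH[OF composable_dm(1)[OF Suc.prems]] dm_cmp_Suc[OF Suc.prems] by simp
  qed
qed (simp add: composable_def)

lemma cd_pow_cmp: "composable L k n f g \<Longrightarrow> (cd L ^^ k) (cmp L k f g) = (cd L ^^ k) f"
proof (induction k arbitrary: n f g)
  case (Suc k)
  show ?case
  proof (cases "k = 0")
    case True
    then show ?thesis using cd_cmp_1[of n f g] Suc.prems by simp
  next
    case False
    then show ?thesis unfolding funpow_Suc_right o_apply
      using Suc.IH[OF composable_dm(2)[OF Suc.prems]] cd_cmp_Suc[OF Suc.prems] by simp
  qed
qed (simp add: composable_def)

lemma dm_pow_cmp_less:
  "composable L (j + k) n f g \<Longrightarrow> 1 \<le> k \<Longrightarrow> (dm L ^^ j) (cmp L (j + k) f g) = cmp L k ((dm L ^^ j) f) ((dm L ^^ j) g)"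
proof (induction j arbitrary: n f g)
  case (Suc j)
  have c: "composable L (Suc (j + k)) n f g" using Suc.prems by simp
  then show ?case unfolding funpow_Suc_right o_apply
    using Suc.IH[OF composable_dm(1)[OF c]] dm_cmp_Suc[OF c] Suc.prems(2) by simp
qed simp

lemma cd_pow_cmp_less:
  "composable L (j + k) n f g \<Longrightarrow> 1 \<le> k \<Longrightarrow> (cd L ^^ j) (cmp L (j + k) f g) = cmp L k ((cd L ^^ j) f) ((cd L ^^ j) g)"
proof (induction j arbitrary: n f g)
  case (Suc j)
  have c: "composable L (Suc (j + k)) n f g" using Suc.prems by simp
  then show ?case unfolding funpow_Suc_right o_apply
    using Suc.IH[OF composable_dm(2)[OF c]] cd_cmp_Suc[OF c] Suc.prems(2) by simp
qed simp

lemma idn_pow_cmp: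
  assumes "composable L k n f g"
  shows "(idn L ^^ j) (cmp L k f g) = cmp L (k + j) ((idn L ^^ j) f) ((idn L ^^ j) g)"
proof (induction j)
  case (Suc j)
  then show ?case using idn_cmp[OF composable_idn_pow[OF assms, of j]] by simp
qed simp

lemma mu_cell:
  assumes "a \<in> Cell L 0" "f \<in> hom_cells L n b c" "g \<in> hom_cells L n a b"
  shows "mu L n f g \<in> hom_cells L n a c"
proof -
  have b: "b \<in> Cell L 0" using hom_cells_target assms(1,3) .
  note c = composable_mu[OF assms]
  show ?thesis using cmp_cell[OF c] dm_pow_cmp[OF c] cd_pow_cmp[OF c] assms(2,3)
    unfolding mu_def hom_cells_iff[OF assms(1)] hom_cells_iff[OF b]
    by (simp del: funpow.simps)
qed

lemma dm_mu:
  assumes "a \<in> Cell L 0" "f \<in> hom_cells L (Suc n) b c" "g \<in> hom_cells L (Suc n) a b"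
  shows "dm L (mu L (Suc n) f g) = mu L n (dm L f) (dm L g)"
  using dm_cmp_Suc[OF composable_mu[OF assms]] by (simp add: mu_def)

lemma cd_mu:
  assumes "a \<in> Cell L 0" "f \<in> hom_cells L (Suc n) b c" "g \<in> hom_cells L (Suc n) a b"
  shows "cd L (mu L (Suc n) f g) = mu L n (cd L f) (cd L g)"
  using cd_cmp_Suc[OF composable_mu[OF assms]] by (simp add: mu_def)

lemma dm_pow_mu:
  assumes "a \<in> Cell L 0" "f \<in> hom_cells L (n + k) b c" "g \<in> hom_cells L (n + k) a b"
  shows "(dm L ^^ k) (mu L (n + k) f g) = mu L n ((dm L ^^ k) f) ((dm L ^^ k) g)"
  using dm_pow_cmp_less[of k "Suc n"] composable_mu[OF assms] by (simp add: mu_def add.commute)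

lemma cd_pow_mu:
  assumes "a \<in> Cell L 0" "f \<in> hom_cells L (n + k) b c" "g \<in> hom_cells L (n + k) a b"
  shows "(cd L ^^ k) (mu L (n + k) f g) = mu L n ((cd L ^^ k) f) ((cd L ^^ k) g)"
  using cd_pow_cmp_less[of k "Suc n"] composable_mu[OF assms] by (simp add: mu_def add.commute)

lemma idn_pow_mu:
  assumes "a \<in> Cell L 0" "f \<in> hom_cells L n b c" "g \<in> hom_cells L n a b"
  shows "(idn L ^^ k) (mu L n f g) = mu L (n + k) ((idn L ^^ k) f) ((idn L ^^ k) g)"
  using idn_pow_cmp[OF composable_mu[OF assms], of k] by (simp add: mu_def)

lemma mu_assoc:
  assumes "a \<in> Cell L 0" "f \<in> hom_cells L n c d" "g \<in> hom_cells L n b c" "h \<in> hom_cells L n a b"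
  shows "mu L n (mu L n f g) h = mu L n f (mu L n g h)"
  using assoc composable_mu[OF assms(1,3,4)] composable_mu[OF hom_cells_target[OF assms(1,4)] assms(2,3)]
  by (simp add: mu_def)

lemma mu_unit_left:
  assumes "a \<in> Cell L 0" "f \<in> hom_cells L n a b"
  shows "mu L n ((idn L ^^ Suc n) b) f = f"
  using unit_left[of f "Suc n" "Suc n"] assms hom_cells_iff by (simp add: mu_def del: funpow.simps)

lemma mu_unit_right:
  assumes "a \<in> Cell L 0" "f \<in> hom_cells L n a b"
  shows "mu L n f ((idn L ^^ Suc n) a) = f"
  using unit_right[of f "Suc n" "Suc n"] assms hom_cells_iff by (simp add: mu_def del: funpow.simps)

lemma mu_interchange:
  assumes a: "a \<in> Cell L 0" "b \<in> Cell L 0"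
    and f: "composable (hom L b c) k n f f'" and g: "composable (hom L a b) k n g g'"
  shows "mu L n (cmp L k f f') (cmp L k g g') = cmp L k (mu L n f g) (mu L n f' g')"
    and "composable (hom L a c) k n (mu L n f g) (mu L n f' g')"
proof -
  have F: "f \<in> hom_cells L n b c" "f' \<in> hom_cells L n b c" "1 \<le> k" "k \<le> n" "(dm L ^^ k) f = (cd L ^^ k) f'"
    and G: "g \<in> hom_cells L n a b" "g' \<in> hom_cells L n a b" "(dm L ^^ k) g = (cd L ^^ k) g'"
    using f g by (auto simp: composable_hom_iff)
  show "mu L n (cmp L k f f') (cmp L k g g') = cmp L k (mu L n f g) (mu L n f' g')"
    unfolding mu_def using F(4)
    by (intro interchange[of _ "Suc n"]) (auto intro: composable_mu a F G composable_of_hom f g)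
  obtain m where n: "n = m + k" using F(4) by (metis le_add_diff_inverse2)
  show "composable (hom L a c) k n (mu L n f g) (mu L n f' g')"
    unfolding composable_hom_iff using F G dm_pow_mu[OF a(1), of f m k b c g] cd_pow_mu[OF a(1), of f' m k b c g']
    by (auto simp: n intro: mu_cell a)
qed

lemma cmp_hom_cell:
  assumes "a \<in> Cell L 0" "composable (hom L a b) k n f g"
  shows "cmp L k f g \<in> hom_cells L n a b"
proof -
  have F: "f \<in> hom_cells L n a b" "g \<in> hom_cells L n a b" "1 \<le> k" "k \<le> n"
    using assms by (auto simp: composable_hom_iff)
  note c = composable_of_hom[OF assms]
  have b: "b \<in> Cell L 0" using hom_cells_target assms(1) F(1) .
  have "(dm L ^^ Suc n) x = (dm L ^^ (Suc n - k)) ((dm L ^^ k) x)" for x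
    using F(4) by (simp add: funpow_add[symmetric, unfolded o_def fun_eq_iff, rule_format] del: funpow.simps)
  moreover have "(cd L ^^ Suc n) x = (cd L ^^ (Suc n - k)) ((cd L ^^ k) x)" for x
    using F(4) by (simp add: funpow_add[symmetric, unfolded o_def fun_eq_iff, rule_format] del: funpow.simps)
  ultimately show ?thesis using cmp_cell[OF c] dm_pow_cmp[OF c] cd_pow_cmp[OF c] F(1,2)
    unfolding hom_cells_iff[OF assms(1)] by (simp del: funpow.simps)
qed

text \<open>The horizontal composite of two cells is also the \<open>\<circ>\<^sub>n\<close>-composite of two whiskered cells, in either order:
  write \<open>g\<close> as \<open>e\<^sup>nc\<^sup>ng \<circ>\<^sub>n g\<close> and \<open>f\<close> as \<open>f \<circ>\<^sub>n e\<^sup>nd\<^sup>nf\<close>, and interchange. The composite of modifications is defined by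
  the first expression, and naturality of a hom-functor's value compares the two.\<close>

lemma whisker_interchange:
  assumes a: "a \<in> Cell L 0" and f: "f \<in> hom_cells L n b c" and g: "g \<in> hom_cells L n a b" and n: "1 \<le> n"
  shows "cmp L n (mu L n f ((idn L ^^ n) ((cd L ^^ n) g))) (mu L n ((idn L ^^ n) ((dm L ^^ n) f)) g) = mu L n f g"
    and "composable (hom L a c) n n (mu L n f ((idn L ^^ n) ((cd L ^^ n) g))) (mu L n ((idn L ^^ n) ((dm L ^^ n) f)) g)"
    and "cmp L n (mu L n ((idn L ^^ n) ((cd L ^^ n) f)) g) (mu L n f ((idn L ^^ n) ((dm L ^^ n) g))) = mu L n f g"
    and "composable (hom L a c) n n (mu L n ((idn L ^^ n) ((cd L ^^ n) f)) g) (mu L n f ((idn L ^^ n) ((dm L ^^ n) g)))"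
proof -
  have b: "b \<in> Cell L 0" using hom_cells_target a g .
  have e: "(idn L ^^ n) ((cd L ^^ n) x) \<in> hom_cells L n p q" "(idn L ^^ n) ((dm L ^^ n) x) \<in> hom_cells L n p q"
    "(dm L ^^ n) ((idn L ^^ n) ((cd L ^^ n) x)) = (cd L ^^ n) x"
    "(dm L ^^ n) ((idn L ^^ n) ((dm L ^^ n) x)) = (dm L ^^ n) x"
    "(cd L ^^ n) ((idn L ^^ n) ((cd L ^^ n) x)) = (cd L ^^ n) x"
    "(cd L ^^ n) ((idn L ^^ n) ((dm L ^^ n) x)) = (dm L ^^ n) x"
    "cmp L n ((idn L ^^ n) ((cd L ^^ n) x)) x = x" "cmp L n x ((idn L ^^ n) ((dm L ^^ n) x)) = x"
    if x: "x \<in> hom_cells L n p q" and p: "p \<in> Cell L 0" for x p q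
  proof -
    have c: "(cd L ^^ n) x \<in> hom_cells L 0 p q" using hom_cells_cd_pow[of x 0 n] x by simp
    have d: "(dm L ^^ n) x \<in> hom_cells L 0 p q" using hom_cells_dm_pow[of x 0 n] x by simp
    note cc = hom_cells_Cell[OF p c] hom_cells_Cell[OF p d]
    show "(idn L ^^ n) ((cd L ^^ n) x) \<in> hom_cells L n p q" "(idn L ^^ n) ((dm L ^^ n) x) \<in> hom_cells L n p q"
      using hom_cells_idn_pow[OF c, of n] hom_cells_idn_pow[OF d, of n] by simp_all
    show "(dm L ^^ n) ((idn L ^^ n) ((cd L ^^ n) x)) = (cd L ^^ n) x"
    "(dm L ^^ n) ((idn L ^^ n) ((dm L ^^ n) x)) = (dm L ^^ n) x"
    "(cd L ^^ n) ((idn L ^^ n) ((cd L ^^ n) x)) = (cd L ^^ n) x"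
    "(cd L ^^ n) ((idn L ^^ n) ((dm L ^^ n) x)) = (dm L ^^ n) x"
      using cc by (auto intro: dm_pow_idn_pow cd_pow_idn_pow)
    show "cmp L n ((idn L ^^ n) ((cd L ^^ n) x)) x = x" "cmp L n x ((idn L ^^ n) ((dm L ^^ n) x)) = x"
      using hom_cells_Cell[OF p x] n by (auto intro!: unit_left unit_right)
  qed
  note ef = e[OF f b] and eg = e[OF g a]
  have 1: "composable (hom L b c) n n f ((idn L ^^ n) ((dm L ^^ n) f))"
    "composable (hom L a b) n n ((idn L ^^ n) ((cd L ^^ n) g)) g"
    "composable (hom L b c) n n ((idn L ^^ n) ((cd L ^^ n) f)) f"
    "composable (hom L a b) n n g ((idn L ^^ n) ((dm L ^^ n) g))"
    unfolding composable_hom_iff using ef eg n f g by auto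
  show "cmp L n (mu L n f ((idn L ^^ n) ((cd L ^^ n) g))) (mu L n ((idn L ^^ n) ((dm L ^^ n) f)) g) = mu L n f g"
    using mu_interchange(1)[OF a b 1(1,2)] ef eg by simp
  show "cmp L n (mu L n ((idn L ^^ n) ((cd L ^^ n) f)) g) (mu L n f ((idn L ^^ n) ((dm L ^^ n) g))) = mu L n f g"
    using mu_interchange(1)[OF a b 1(3,4)] ef eg by simp
  show "composable (hom L a c) n n (mu L n f ((idn L ^^ n) ((cd L ^^ n) g))) (mu L n ((idn L ^^ n) ((dm L ^^ n) f)) g)"
    "composable (hom L a c) n n (mu L n ((idn L ^^ n) ((cd L ^^ n) f)) g) (mu L n f ((idn L ^^ n) ((dm L ^^ n) g)))"
    using mu_interchange(2)[OF a b 1(1,2)] mu_interchange(2)[OF a b 1(3,4)] by auto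
qed

end

section \<open>Hom-categories of a strict category\<close>

lemma (in globular) composable_unit:
  assumes "f \<in> Cell L n" "1 \<le> k" "k \<le> n"
  shows "composable L k n ((idn L ^^ k) ((cd L ^^ k) f)) f"
    and "composable L k n f ((idn L ^^ k) ((dm L ^^ k) f))"
proof -
  obtain m where n: "n = m + k" using assms(3) by (metis le_add_diff_inverse2)
  have c: "(cd L ^^ k) f \<in> Cell L m" "(dm L ^^ k) f \<in> Cell L m"
    using assms(1) by (auto simp: n intro: cd_pow_cell dm_pow_cell)
  show "composable L k n ((idn L ^^ k) ((cd L ^^ k) f)) f"
    "composable L k n f ((idn L ^^ k) ((dm L ^^ k) f))"
    using assms c dm_pow_idn_pow[OF c(1), of k] cd_pow_idn_pow[OF c(2), of k]
    by (auto simp: composable_def n idn_pow_cell)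
qed

context strict_omega begin

lemma composable_assoc:
  assumes "composable L k n f g" "composable L k n g h"
  shows "composable L k n (cmp L k f g) h" "composable L k n f (cmp L k g h)"
  using assms cmp_cell[OF assms(1)] cmp_cell[OF assms(2)] dm_pow_cmp[OF assms(1)] cd_pow_cmp[OF assms(2)]
  by (auto simp: composable_def)

lemma composable_interchange:
  assumes "composable L j n f g" "composable L j n f' g'" "composable L k n f f'"
      "composable L k n g g'" "k < j"
  shows "composable L j n (cmp L k f f') (cmp L k g g')"
    and "composable L k n (cmp L j f g) (cmp L j f' g')"
proof -
  obtain i where j: "j = i + k" "1 \<le> i" using assms(5) by (intro that[of "j - k"]) auto
  have c: "f \<in> Cell L n" "f' \<in> Cell L n" "g \<in> Cell L n" "g' \<in> Cell L n" "j \<le> n" "1 \<le> k"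
    "(dm L ^^ k) f = (cd L ^^ k) f'" "(dm L ^^ k) g = (cd L ^^ k) g'"
    "(dm L ^^ j) f = (cd L ^^ j) g" "(dm L ^^ j) f' = (cd L ^^ j) g'"
    using assms by (auto simp: composable_def)
  have 1: "(dm L ^^ j) (cmp L k f f') = (dm L ^^ j) f'"
    using dm_pow_cmp[OF assms(3)] by (simp add: j funpow_add)
  have 2: "(cd L ^^ j) (cmp L k g g') = (cd L ^^ j) g"
    using cd_pow_cmp[OF assms(4)] by (simp add: j funpow_add)
  have "(cd L ^^ j) g' = (cd L ^^ i) ((dm L ^^ k) g)"
    by (simp add: j funpow_add c)
  also have "\<dots> = (cd L ^^ j) g" using c j cd_dm_pow[of k n i g] by simp
  finally have 3: "(cd L ^^ j) g' = (cd L ^^ j) g" .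
  show "composable L j n (cmp L k f f') (cmp L k g g')"
    using c 1 2 3 cmp_cell[OF assms(3)] cmp_cell[OF assms(4)] j unfolding composable_def by auto
  have "(dm L ^^ k) (cmp L j f g) = cmp L i ((dm L ^^ k) f) ((dm L ^^ k) g)"
    using dm_pow_cmp_less[of k i n f g] assms(1) j by (simp add: add.commute)
  moreover have "(cd L ^^ k) (cmp L j f' g') = cmp L i ((cd L ^^ k) f') ((cd L ^^ k) g')"
    using cd_pow_cmp_less[of k i n f' g'] assms(2) j by (simp add: add.commute)
  ultimately show "composable L k n (cmp L j f g) (cmp L j f' g')"
    using c cmp_cell[OF assms(1)] cmp_cell[OF assms(2)] assms(5) unfolding composable_def by auto
qed

text \<open>The identity of \<open>x\<close> is an equivalence: \<open>ex \<circ>\<^sub>1 ex = ex\<close> closes the coinduction with the same statement for \<open>ex\<close>.\<close>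

lemma eqv_refl: "x \<in> Cell L n \<Longrightarrow> eqv L x x"
proof (coinduction arbitrary: x n)
  case eqv
  have c: "composable L 1 (Suc n) (idn L x) (idn L x)"
    using eqv by (auto simp: composable_def idn_cell dm_idn cd_idn)
  have u: "cmp L 1 (idn L x) (idn L x) = idn L x"
    using unit_left[of "idn L x" "Suc n" 1] eqv by (simp add: idn_cell cd_idn)
  have "idn L x \<in> hom_cells L 0 x x"
    using eqv by (auto simp: hom_cells_def idn_cell dm_idn cd_idn)
  then show ?case using eqv u idn_cell[OF eqv]
    by (intro exI[of _ x] exI[of _ n] exI[of _ "idn L x"]) auto
qed

lemma hom_cells_composable:
  assumes "f \<in> hom_cells L n b c" "g \<in> hom_cells L n a b" "b \<in> Cell L m"
  shows "composable L (Suc n) (m + n + 1) f g"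
proof -
  have *: "b \<in> Cell L k \<longleftrightarrow> k = m" for k using assms(3) grading by blast
  show ?thesis using assms(1,2) unfolding hom_cells_def composable_def * by auto
qed

lemma inf_precategory:
  assumes "canon L = L" shows "inf_precategory L"
proof
  show "m \<noteq> n \<Longrightarrow> Cell L m \<inter> Cell L n = {}" for m n using grading by blast
qed (use assms dm_cd cd_dm dm_pow_cmp cd_pow_cmp in \<open>auto simp: dm_cell cd_cell idn_cell dm_idn cd_idn cmp_cell\<close>)

text \<open>Each law demanded up to \<open>eqv\<close> holds as an equality, so only the closure properties of \<open>eqv\<close> itself have to
  be supplied.\<close>

lemma inf_category:
  assumes "canon L = L"
    and "\<And>x y z. eqv L x y \<Longrightarrow> eqv L y z \<Longrightarrow> eqv L x z"
    and "\<And>f g h h' k n. \<lbrakk> eqv L f g; eqv L h h'; composable L k n f h; composable L k n g h' \<rbrakk>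
      \<Longrightarrow> eqv L (cmp L k f h) (cmp L k g h')"
  shows "inf_category L"
proof -
  interpret inf_precategory L using assms(1) by (rule inf_precategory)
  show ?thesis
  proof
    fix f n a' a'' g a assume *: "f \<in> hom_cells L (Suc n) a' a''" "g \<in> hom_cells L (Suc n) a a'"
    obtain m where "a' \<in> Cell L m" using * unfolding hom_cells_def by auto
    note N = hom_cells_composable[OF * this]
    show "mu L n (dm L f) (dm L g) = dm L (mu L (Suc n) f g)"
      "mu L n (cd L f) (cd L g) = cd L (mu L (Suc n) f g)"
      using dm_cmp_Suc[OF N] cd_cmp_Suc[OF N] by (simp_all add: mu_def)
  next
    fix f n a' a'' g a assume *: "f \<in> hom_cells L n a' a''" "g \<in> hom_cells L n a a'"
    obtain m where "a' \<in> Cell L m" using * unfolding hom_cells_def by auto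
    note N = hom_cells_composable[OF * this]
    show "eqv L (mu L (Suc n) (idn L f) (idn L g)) (idn L (mu L n f g))"
      using idn_cmp[OF N] eqv_refl[OF idn_cell[OF cmp_cell[OF N]]] by (simp add: mu_def)
  next
    fix f n a' a'' f' g a g' k
    assume *: "f \<in> hom_cells L n a' a''" "f' \<in> hom_cells L n a' a''"
        "g \<in> hom_cells L n a a'" "g' \<in> hom_cells L n a a'"
        "composable (hom L a' a'') k n f f'" "composable (hom L a a') k n g g'"
    obtain m where m: "a' \<in> Cell L m" using * unfolding hom_cells_def by auto
    note N = hom_cells_composable[OF *(1,3) m] and N' = hom_cells_composable[OF *(2,4) m]
    have c: "composable L k (m + n + 1) f f'" "composable L k (m + n + 1) g g'" "k < Suc n"
      using *(5,6) N N' unfolding composable_hom_iff by (auto simp: composable_def simp del: funpow.simps)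
    show "eqv L (mu L n (cmp L k f f') (cmp L k g g')) (cmp L k (mu L n f g) (mu L n f' g'))"
      using interchange[OF N N' c] eqv_refl[OF cmp_cell[OF composable_interchange(1)[OF N N' c]]]
      by (simp add: mu_def)
  next
    fix k n f g h assume c: "composable L k n f g" "composable L k n g h"
    show "eqv L (cmp L k (cmp L k f g) h) (cmp L k f (cmp L k g h))"
      using assoc[OF c] eqv_refl[OF cmp_cell[OF composable_assoc(1)[OF c]]] by simp
  qed (use assms unit_left unit_right eqv_refl in auto)
qed

lemma globular_hom: assumes "a \<in> Cell L 0" shows "globular (hom L a b)"
proof
  fix x n assume x: "x \<in> Cell (hom L a b) (Suc (Suc n))"
  then have X: "x \<in> hom_cells L (Suc (Suc n)) a b" by simp
  note d = dm_hom[OF X] cd_hom[OF X] dm_hom[OF hom_cells_dm[OF X]] dm_hom[OF hom_cells_cd[OF X]]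
    cd_hom[OF hom_cells_dm[OF X]] cd_hom[OF hom_cells_cd[OF X]]
  show "dm (hom L a b) (cd (hom L a b) x) = dm (hom L a b) (dm (hom L a b) x)"
    "cd (hom L a b) (dm (hom L a b) x) = cd (hom L a b) (cd (hom L a b) x)"
    using hom_cells_Cell[OF assms X] by (auto simp: d dm_cd cd_dm)
next
  fix x n assume "x \<in> Cell (hom L a b) n"
  then have X: "x \<in> hom_cells L n a b" by simp
  note d = idn_hom[OF X] dm_hom[OF hom_cells_idn[OF X]] cd_hom[OF hom_cells_idn[OF X]]
  show "dm (hom L a b) (idn (hom L a b) x) = x" "cd (hom L a b) (idn (hom L a b) x) = x"
    using hom_cells_Cell[OF assms X] by (auto simp: d dm_idn cd_idn)
qed (auto simp: hom_cells_dm hom_cells_cd hom_cells_idn dm_hom cd_hom idn_hom dest: hom_cells_unique)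

lemma strict_omega_hom:
  assumes a: "a \<in> Cell L 0" shows "strict_omega (hom L a b)"
proof -
  interpret M: globular "hom L a b" using a by (rule globular_hom)
  let ?M = "hom L a b"
  have cell: "cmp L k f g \<in> hom_cells L n a b" if "composable ?M k n f g" for k n f g
    by (rule cmp_hom_cell[OF a that])
  have toL: "composable L k (Suc n) f g" if "composable ?M k n f g" for k n f g
    by (rule composable_of_hom[OF a that])
  have toM: "composable ?M k n f g" if "composable L k (Suc n) f g" "f \<in> hom_cells L n a b" "g \<in> hom_cells L n a b" "k \<le> n"
    for k n f g using that unfolding composable_hom_iff by (simp add: composable_def)
  show ?thesis
  proof
    fix k n f g assume c: "composable ?M k n f g"
    then show "cmp ?M k f g \<in> Cell ?M n" by (simp add: cmp_hom cell)
    have fg: "f \<in> hom_cells L n a b" "g \<in> hom_cells L n a b" using c by (auto simp: composable_hom_iff)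
    show "idn ?M (cmp ?M k f g) = cmp ?M (Suc k) (idn ?M f) (idn ?M g)"
      using idn_cmp[OF toL[OF c]] idn_hom[OF fg(1)] idn_hom[OF fg(2)] idn_hom[OF cell[OF c]]
        cmp_hom[OF c] cmp_hom[OF M.composable_idn[OF c]] by simp
  next
    fix n f g assume c: "composable ?M 1 n f g"
    obtain m where n: "n = Suc m" using c by (cases n) (auto simp: composable_def)
    have fg: "f \<in> hom_cells L (Suc m) a b" "g \<in> hom_cells L (Suc m) a b" using c n by (auto simp: composable_hom_iff)
    show "dm ?M (cmp ?M 1 f g) = dm ?M g" "cd ?M (cmp ?M 1 f g) = cd ?M f"
      using fg c dm_hom[OF cell[OF c[unfolded n]]] cd_hom[OF cell[OF c[unfolded n]]] dm_cmp_1[OF toL[OF c]] cd_cmp_1[OF toL[OF c]]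
      by (simp_all add: cmp_hom dm_hom cd_hom)
  next
    fix k n f g assume c: "composable ?M (Suc k) n f g" and k: "1 \<le> k"
    obtain m where n: "n = Suc m" using c by (cases n) (auto simp: composable_def)
    have fg: "f \<in> hom_cells L (Suc m) a b" "g \<in> hom_cells L (Suc m) a b" using c n by (auto simp: composable_hom_iff)
    note d = M.composable_dm[OF c k]
    show "dm ?M (cmp ?M (Suc k) f g) = cmp ?M k (dm ?M f) (dm ?M g)"
      "cd ?M (cmp ?M (Suc k) f g) = cmp ?M k (cd ?M f) (cd ?M g)"
      using fg c dm_hom[OF cell[OF c[unfolded n]]] cd_hom[OF cell[OF c[unfolded n]]] dm_cmp_Suc[OF toL[OF c] k] cd_cmp_Suc[OF toL[OF c] k]
       cmp_hom[OF d(1)] cmp_hom[OF d(2)]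
      by (simp_all add: cmp_hom dm_hom cd_hom)
  next
    fix j n f g f' g' k
    assume c: "composable ?M j n f g" "composable ?M j n f' g'" "composable ?M k n f f'"
      "composable ?M k n g g'" "k < j"
    note cL = c(1)[THEN toL] c(2)[THEN toL] c(3)[THEN toL] c(4)[THEN toL] c(5)
    have 1: "composable ?M j n (cmp L k f f') (cmp L k g g')"
      using composable_interchange(1)[OF cL] c(1) by (intro toM cell c) (auto simp: composable_def)
    have 2: "composable ?M k n (cmp L j f g) (cmp L j f' g')"
      using composable_interchange(2)[OF cL] c(3) by (intro toM cell c) (auto simp: composable_def)
    show "cmp ?M j (cmp ?M k f f') (cmp ?M k g g') = cmp ?M k (cmp ?M j f g) (cmp ?M j f' g')"
      using c interchange[OF cL] cmp_hom[OF 1] cmp_hom[OF 2] by (simp add: cmp_hom)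
  next
    fix k n f g h assume c: "composable ?M k n f g" "composable ?M k n g h"
    have fg: "f \<in> hom_cells L n a b" "h \<in> hom_cells L n a b" "k \<le> n" using c by (auto simp: composable_hom_iff)
    have 1: "composable ?M k n (cmp L k f g) h" "composable ?M k n f (cmp L k g h)"
      using composable_assoc[OF c[THEN toL]] by (intro toM cell c; simp add: fg)+
    show "cmp ?M k (cmp ?M k f g) h = cmp ?M k f (cmp ?M k g h)"
      using c assoc[OF c[THEN toL]] cmp_hom[OF 1(1)] cmp_hom[OF 1(2)] by (simp add: cmp_hom)
  next
    fix f n k assume f: "f \<in> Cell ?M n" "1 \<le> k" "k \<le> n"
    then obtain m where n: "n = m + k" by (metis le_add_diff_inverse2)
    have F: "f \<in> hom_cells L (m + k) a b" using f n by simp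
    note e = idn_hom_pow[OF hom_cells_cd_pow[OF F]] idn_hom_pow[OF hom_cells_dm_pow[OF F]]
      cd_hom_pow[OF F, of k] dm_hom_pow[OF F, of k]
    note u = M.composable_unit[OF f]
    show "cmp ?M k ((idn ?M ^^ k) ((cd ?M ^^ k) f)) f = f"
      using cmp_hom[OF u(1)] unit_left[of f "Suc n" k] hom_cells_Cell[OF a] f by (simp add: e)
    show "cmp ?M k f ((idn ?M ^^ k) ((dm ?M ^^ k) f)) = f"
      using cmp_hom[OF u(2)] unit_right[of f "Suc n" k] hom_cells_Cell[OF a] f by (simp add: e)
  qed
qed

end

lemma (in globular) canon_hom: "canon (hom L a b) = hom L a b"
proof -
  have "composable (hom L a b) k n f g = composable (L\<lparr>Cell := \<lambda>n. hom_cells L n a b\<rparr>) k n f g" for k n f g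
    unfolding composable_hom_iff by (auto simp: composable_def)
  then show ?thesis by (auto simp: canon_def hom_def all_cells_def fun_eq_iff restrict_def)
qed

text \<open>A cell between parallel cells of \<open>L(a,b)\<close> has itself the boundary \<open>a\<close>, \<open>b\<close>.\<close>

lemma (in globular) hom_cells_hom:
  assumes "a \<in> Cell L 0" "x \<in> hom_cells L m a b" "y \<in> hom_cells L m a b"
  shows "hom_cells (hom L a b) n x y = hom_cells L n x y"
proof -
  have u: "x \<in> hom_cells L k a b \<longleftrightarrow> k = m" "y \<in> hom_cells L k a b \<longleftrightarrow> k = m" for k
    using assms hom_cells_unique by blast+
  have v: "x \<in> Cell L k \<longleftrightarrow> k = Suc m" "y \<in> Cell L k \<longleftrightarrow> k = Suc m" for k
    using assms hom_cells_Cell grading by blast+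
  have x: "(dm L ^^ Suc m) x = a" "(cd L ^^ Suc m) y = b" using assms hom_cells_iff by auto
  have "f \<in> hom_cells L (m + n + 1) a b \<and> (dm (hom L a b) ^^ (n + 1)) f = x \<and> (cd (hom L a b) ^^ (n + 1)) f = y
    \<longleftrightarrow> f \<in> Cell L (Suc m + n + 1) \<and> (dm L ^^ (n + 1)) f = x \<and> (cd L ^^ (n + 1)) f = y" (is "?l \<longleftrightarrow> ?r") for f
  proof
    assume ?l
    then show ?r using dm_hom_pow[of f "m + n + 1" a b "n + 1"] cd_hom_pow[of f "m + n + 1" a b "n + 1"] hom_cells_Cell[OF assms(1), of f]
      by (auto simp del: funpow.simps)
  next
    assume r: ?r
    have s: "Suc (m + n + 1) = Suc m + (n + 1)" by simp
    have "f \<in> hom_cells L (m + n + 1) a b"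
      using r x fun_cong[OF funpow_add[of "Suc m" "n + 1" "dm L"], of f]
        fun_cong[OF funpow_add[of "Suc m" "n + 1" "cd L"], of f]
      by (simp add: hom_cells_iff[OF assms(1)] s del: funpow.simps)
    then show ?l using r dm_hom_pow[of f "m + n + 1" a b "n + 1"] cd_hom_pow[of f "m + n + 1" a b "n + 1"]
      by (auto simp del: funpow.simps)
  qed
  then show ?thesis unfolding hom_cells_def[of "hom L a b"] hom_cells_def[of L n x y] v Cell_hom u
    by (auto simp del: funpow.simps)
qed

text \<open>An equivalence in \<open>L\<close> between cells of \<open>L(a,b)\<close> has its witnesses in \<open>L(a,b)\<close>, in all degrees; so the
  equivalences of a hom-category are those of \<open>L\<close>.\<close>

lemma (in strict_omega) eqv_hom_iff:
  assumes a: "a \<in> Cell L 0" and b: "x \<in> hom_cells L m a b" "y \<in> hom_cells L m a b"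
  shows "eqv (hom L a b) x y \<longleftrightarrow> eqv L x y"
proof
  have comp: "composable (hom L a b) 1 (Suc n) g f" if "x \<in> hom_cells L n a b" "y \<in> hom_cells L n a b"
    "f \<in> hom_cells (hom L a b) 0 x y" "g \<in> hom_cells (hom L a b) 0 y x" for x y f g n
  proof -
    note t = that
    obtain k k' where "x \<in> hom_cells L k a b" "f \<in> hom_cells L (Suc k) a b"
      "y \<in> hom_cells L k' a b" "g \<in> hom_cells L (Suc k') a b"
      "cd (hom L a b) f = y" "dm (hom L a b) g = y"
      using t(3,4) unfolding hom_cells_def[of "hom L a b"] Cell_hom by auto
    moreover from this have "k = n" "k' = n" using t(1,2) hom_cells_unique by blast+
    ultimately show ?thesis by (simp add: composable_def)
  qed
  show "eqv L x y" if "eqv (hom L a b) x y"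
    using that
  proof (coinduction arbitrary: x y)
    case eqv
    then obtain n f g where *: "x \<in> hom_cells L n a b" "y \<in> hom_cells L n a b"
      "f \<in> hom_cells (hom L a b) 0 x y" "g \<in> hom_cells (hom L a b) 0 y x"
      "eqv (hom L a b) (idn (hom L a b) x) (cmp (hom L a b) 1 g f)"
      "eqv (hom L a b) (cmp (hom L a b) 1 f g) (idn (hom L a b) y)"
      by (auto elim: eqv.cases)
    have "cmp (hom L a b) 1 g f = cmp L 1 g f" "cmp (hom L a b) 1 f g = cmp L 1 f g"
      using cmp_hom[OF comp] * by blast+
    then show ?case using * hom_cells_Cell[OF a] idn_hom[OF *(1)] idn_hom[OF *(2)]
        hom_cells_hom[OF a *(1,2)] hom_cells_hom[OF a *(2,1)]
      by (intro exI[of _ x] exI[of _ "Suc n"] exI[of _ y] exI[of _ f] exI[of _ g]) auto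
  qed
  show "eqv (hom L a b) x y" if "eqv L x y"
    using that b
  proof (coinduction arbitrary: x y m)
    case eqv
    note b = eqv(2,3)
    obtain f g where *:
      "f \<in> hom_cells (hom L a b) 0 x y" "g \<in> hom_cells (hom L a b) 0 y x"
      "eqv L (idn L x) (cmp L 1 g f)" "eqv L (cmp L 1 f g) (idn L y)"
      using eqv hom_cells_hom[OF a b, of 0] hom_cells_hom[OF a b(2,1), of 0] by (auto elim: eqv.cases)
    have c: "composable (hom L a b) 1 (Suc m) g f" "composable (hom L a b) 1 (Suc m) f g"
      using comp[OF b *(1,2)] comp[OF b(2,1) *(2,1)] .
    have c': "cmp L 1 g f \<in> hom_cells L (Suc m) a b" "cmp L 1 f g \<in> hom_cells L (Suc m) a b"
      using cmp_hom_cell[OF a c(1)] cmp_hom_cell[OF a c(2)] .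
    have "\<exists>m. idn L x \<in> hom_cells L m a b \<and> cmp L 1 g f \<in> hom_cells L m a b"
      "\<exists>m. cmp L 1 f g \<in> hom_cells L m a b \<and> idn L y \<in> hom_cells L m a b"
      using c' hom_cells_idn[OF b(1)] hom_cells_idn[OF b(2)] by blast+
    then show ?case
      apply -
      apply (rule exI[of _ x], rule exI[of _ m], rule exI[of _ y], rule exI[of _ f], rule exI[of _ g])
      using * b cmp_hom[OF c(1)] cmp_hom[OF c(2)] idn_hom[OF b(1)] idn_hom[OF b(2)] by simp
  qed
qed

text \<open>Objects of the infinity-category of infinity-categories must satisfy the axioms with \<open>eqv\<close>. Transitivity
  and congruence of \<open>eqv\<close> are inherited from \<open>L\<close>; the rest follows from strictness.\<close>

lemma (in strict_inf_category) inf_category_hom: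
  assumes a: "a \<in> Cell L 0" shows "inf_category (hom L a b)"
proof -
  interpret strict_omega L by (rule strict_omega)
  let ?M = "hom L a b"
  interpret M: strict_omega ?M using a by (rule strict_omega_hom)
  have same: "\<exists>n. x \<in> hom_cells L n a b \<and> y \<in> hom_cells L n a b" if "eqv ?M x y" for x y
    using that
  proof cases
    case (eqvI n f g)
    then show ?thesis by auto
  qed
  show ?thesis
  proof (rule M.inf_category)
    show "canon ?M = ?M" by (rule canon_hom)
  next
    fix x y z assume e: "eqv ?M x y" "eqv ?M y z"
    obtain n where n: "x \<in> hom_cells L n a b" "y \<in> hom_cells L n a b" using same[OF e(1)] by blast
    obtain n' where "y \<in> hom_cells L n' a b" "z \<in> hom_cells L n' a b" using same[OF e(2)] by blast
    then have z: "z \<in> hom_cells L n a b" using hom_cells_unique n by blast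
    show "eqv ?M x z" using e eqv_trans unfolding eqv_hom_iff[OF a n] eqv_hom_iff[OF a n(2) z] eqv_hom_iff[OF a n(1) z] by blast
  next
    fix f g h h' k n
    assume e: "eqv ?M f g" "eqv ?M h h'" and c: "composable ?M k n f h" "composable ?M k n g h'"
    have m: "f \<in> hom_cells L n a b" "g \<in> hom_cells L n a b" "h \<in> hom_cells L n a b" "h' \<in> hom_cells L n a b"
      using c by (auto simp: composable_def)
    show "eqv ?M (cmp ?M k f h) (cmp ?M k g h')"
      unfolding cmp_hom[OF c(1)] cmp_hom[OF c(2)] eqv_hom_iff[OF a cmp_hom_cell[OF a c(1)] cmp_hom_cell[OF a c(2)]]
      using e eqv_cmp composable_of_hom[OF a c(1)] composable_of_hom[OF a c(2)]
      unfolding eqv_hom_iff[OF a m(1,2)] eqv_hom_iff[OF a m(3,4)] by blast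
  qed
qed

section \<open>The opposite category\<close>

context globular begin

lemma Cell_opp [simp]: "Cell (opp L) n = Cell L n"
  by (simp add: opp_def canon_def)

lemma in_Cell_iff: "x \<in> Cell L n \<Longrightarrow> x \<in> Cell L k \<longleftrightarrow> k = n"
  using grading by blast

lemma dm_opp: "x \<in> Cell L (Suc n) \<Longrightarrow> dm (opp L) x = (if n = 0 then cd L x else dm L x)"
  by (auto simp: opp_def canon_def in_Cell_iff)

lemma cd_opp: "x \<in> Cell L (Suc n) \<Longrightarrow> cd (opp L) x = (if n = 0 then dm L x else cd L x)"
  by (auto simp: opp_def canon_def in_Cell_iff)

lemma idn_opp: "x \<in> Cell L n \<Longrightarrow> idn (opp L) x = idn L x"
  by (auto simp: opp_def canon_def all_cells_def)

lemma idn_opp_pow: "x \<in> Cell L n \<Longrightarrow> (idn (opp L) ^^ k) x = (idn L ^^ k) x"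
proof (induction k)
  case (Suc k)
  then show ?case using idn_opp[OF idn_pow_cell[OF Suc.prems]] by simp
qed simp

lemma globular_opp: "globular (opp L)"
proof
  fix x n assume x: "x \<in> Cell (opp L) (Suc n)"
  then show "dm (opp L) x \<in> Cell (opp L) n" "cd (opp L) x \<in> Cell (opp L) n"
    using dm_cell[of x n] cd_cell[of x n] by (auto simp: dm_opp cd_opp)
next
  fix x n assume "x \<in> Cell (opp L) (Suc (Suc n))"
  then have x: "x \<in> Cell L (Suc (Suc n))" by simp
  show "dm (opp L) (cd (opp L) x) = dm (opp L) (dm (opp L) x)"
    "cd (opp L) (dm (opp L) x) = cd (opp L) (cd (opp L) x)"
    using dm_cell[OF x] cd_cell[OF x] dm_cd[OF x] cd_dm[OF x] by (simp_all add: dm_opp[OF x] cd_opp[OF x] dm_opp cd_opp)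
qed (auto simp: idn_opp idn_cell dm_opp[OF idn_cell] cd_opp[OF idn_cell] dm_idn cd_idn dest: grading)

text \<open>Passing to the opposite affects only the step from degree 1 to degree 0, so an iterated source changes
  only if it ends in degree 0.\<close>

lemma dm_opp_pow:
  "x \<in> Cell L n \<Longrightarrow> k \<le> n \<Longrightarrow> (dm (opp L) ^^ k) x = (if k = n then (cd L ^^ k) x else (dm L ^^ k) x)"
proof (induction k)
  case (Suc k)
  obtain m where n: "n = Suc m + k" using Suc.prems(2) by (metis add.commute add_Suc_right le_Suc_ex add_Suc_shift)
  have c: "(dm L ^^ k) x \<in> Cell L (Suc m)" using Suc.prems(1) dm_pow_cell[of x "Suc m" k] by (simp add: n)
  have "(dm (opp L) ^^ Suc k) x = dm (opp L) ((dm L ^^ k) x)"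
    using Suc by (simp add: n)
  then show ?case using cd_dm_pow[of k n 1 x] Suc.prems dm_opp[OF c] by (auto simp: n)
qed simp

lemma cd_opp_pow:
  "x \<in> Cell L n \<Longrightarrow> k \<le> n \<Longrightarrow> (cd (opp L) ^^ k) x = (if k = n then (dm L ^^ k) x else (cd L ^^ k) x)"
proof (induction k)
  case (Suc k)
  obtain m where n: "n = Suc m + k" using Suc.prems(2) by (metis add.commute add_Suc_right le_Suc_ex add_Suc_shift)
  have c: "(cd L ^^ k) x \<in> Cell L (Suc m)" using Suc.prems(1) cd_pow_cell[of x "Suc m" k] by (simp add: n)
  have "(cd (opp L) ^^ Suc k) x = cd (opp L) ((cd L ^^ k) x)"
    using Suc by (simp add: n)
  then show ?case using dm_cd_pow[of k n 1 x] Suc.prems cd_opp[OF c] by (auto simp: n)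
qed simp

lemma composable_opp_iff:
  "composable (opp L) k n f g \<longleftrightarrow> (if k = n then composable L k n g f else composable L k n f g)"
  by (auto simp: composable_def dm_opp_pow cd_opp_pow)

lemma cmp_opp:
  assumes "composable (opp L) k n f g"
  shows "cmp (opp L) k f g = (if k = n then cmp L k g f else cmp L k f g)"
proof -
  let ?X = "\<lparr> Cell = Cell L,
       dm = (\<lambda>x. if x \<in> Cell L 1 then cd L x else dm L x),
       cd = (\<lambda>x. if x \<in> Cell L 1 then dm L x else cd L x),
       idn = idn L,
       cmp = (\<lambda>n f g. if f \<in> Cell L n then cmp L n g f else cmp L n f g) \<rparr>"
  have d: "(dm ?X ^^ k) x = (dm (opp L) ^^ k) x \<and> (cd ?X ^^ k) x = (cd (opp L) ^^ k) x"
    if "x \<in> Cell L n" "k \<le> n" for x k n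
    using that
  proof (induction k)
    case (Suc k)
    obtain m where n: "n = Suc m + k" using Suc.prems(2) by (metis add.commute add_Suc_right le_Suc_ex add_Suc_shift)
    interpret O: globular "opp L" by (rule globular_opp)
    have "(dm (opp L) ^^ k) x \<in> Cell L (Suc m)" "(cd (opp L) ^^ k) x \<in> Cell L (Suc m)"
      using O.dm_pow_cell[of x "Suc m" k] O.cd_pow_cell[of x "Suc m" k] Suc.prems by (auto simp: n)
    then show ?case using Suc by (auto simp: dm_opp cd_opp in_Cell_iff)
  qed simp
  have "composable ?X k n f g" using assms d by (auto simp: composable_def)
  moreover have "f \<in> Cell L n" using assms by (auto simp: composable_def)
  ultimately show ?thesis unfolding opp_def canon_def by (auto simp: in_Cell_iff)
qed

end

text \<open>Taking the opposite reverses \<open>\<circ>\<^sub>k\<close> only on cells of degree \<open>k\<close>. In the interchange of \<open>\<circ>\<^sub>j\<close> with a lower \<open>\<circ>\<^sub>k\<close>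
  only \<open>\<circ>\<^sub>j\<close> can be reversed, and the law is symmetric under that.\<close>

lemma (in strict_omega) strict_omega_opp: "strict_omega (opp L)"
proof -
  interpret O: globular "opp L" by (rule globular_opp)
  have cell: "cmp (opp L) k f g \<in> Cell L n" if "composable (opp L) k n f g" for k n f g
    using that cmp_cell by (auto simp: cmp_opp composable_opp_iff split: if_splits)
  show ?thesis
  proof
    fix k n f g assume c: "composable (opp L) k n f g"
    then show "cmp (opp L) k f g \<in> Cell (opp L) n" by (simp add: cell)
    have fg: "f \<in> Cell L n" "g \<in> Cell L n" using c by (auto simp: composable_def)
    show "idn (opp L) (cmp (opp L) k f g) = cmp (opp L) (Suc k) (idn (opp L) f) (idn (opp L) g)"
      using cmp_opp[OF O.composable_idn[OF c]] idn_opp[OF cell[OF c]] cmp_opp[OF c] idn_opp[OF fg(1)] idn_opp[OF fg(2)]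
        c[unfolded composable_opp_iff] by (auto simp: idn_cmp)
  next
    fix n f g assume c: "composable (opp L) 1 n f g"
    obtain m where n: "n = Suc m" using c by (cases n) (auto simp: composable_def)
    have fg: "f \<in> Cell L (Suc m)" "g \<in> Cell L (Suc m)" using c n by (auto simp: composable_def)
    show "dm (opp L) (cmp (opp L) 1 f g) = dm (opp L) g" "cd (opp L) (cmp (opp L) 1 f g) = cd (opp L) f"
      using dm_opp[OF cell[OF c[unfolded n]]] dm_opp[OF fg(2)] cd_opp[OF cell[OF c[unfolded n]]] cd_opp[OF fg(1)] cmp_opp[OF c]
        c[unfolded composable_opp_iff] dm_cmp_1[of n f g] cd_cmp_1[of n f g] dm_cmp_1[of n g f] cd_cmp_1[of n g f]
      by (auto simp: n split: if_splits)
  next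
    fix k n f g assume c: "composable (opp L) (Suc k) n f g" and k: "1 \<le> k"
    obtain m where n: "n = Suc m" "m \<noteq> 0" using c k by (cases n) (auto simp: composable_def)
    have fg: "f \<in> Cell L (Suc m)" "g \<in> Cell L (Suc m)" using c n by (auto simp: composable_def)
    note d = O.composable_dm[OF c k]
    show "dm (opp L) (cmp (opp L) (Suc k) f g) = cmp (opp L) k (dm (opp L) f) (dm (opp L) g)"
      "cd (opp L) (cmp (opp L) (Suc k) f g) = cmp (opp L) k (cd (opp L) f) (cd (opp L) g)"
      using cmp_opp[OF d(1)] cmp_opp[OF d(2)] dm_opp[OF cell[OF c[unfolded n]]] cd_opp[OF cell[OF c[unfolded n]]]
        dm_opp[OF fg(1)] dm_opp[OF fg(2)] cd_opp[OF fg(1)] cd_opp[OF fg(2)] cmp_opp[OF c]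
        c[unfolded composable_opp_iff] n k dm_cmp_Suc[of k n f g] cd_cmp_Suc[of k n f g] dm_cmp_Suc[of k n g f] cd_cmp_Suc[of k n g f]
      by (auto split: if_splits)
  next
    fix j n f g f' g' k
    assume c: "composable (opp L) j n f g" "composable (opp L) j n f' g'" "composable (opp L) k n f f'"
      "composable (opp L) k n g g'" "k < j"
    have k: "k \<noteq> n" "j \<le> n" using c by (auto simp: composable_def)
    note cc = c(1-4)[unfolded composable_opp_iff]
    have 1: "composable (opp L) j n (cmp L k f f') (cmp L k g g')" "composable (opp L) k n (cmp (opp L) j f g) (cmp (opp L) j f' g')"
      unfolding composable_opp_iff cmp_opp[OF c(1)] cmp_opp[OF c(2)]
      using cc k c(5) composable_interchange[of j n f g f' g' k] composable_interchange[of j n g f g' f' k]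
      by (auto split: if_splits)
    show "cmp (opp L) j (cmp (opp L) k f f') (cmp (opp L) k g g') = cmp (opp L) k (cmp (opp L) j f g) (cmp (opp L) j f' g')"
      using cc k c(5) cmp_opp[OF c(1)] cmp_opp[OF c(2)] cmp_opp[OF c(3)] cmp_opp[OF c(4)] cmp_opp[OF 1(1)] cmp_opp[OF 1(2)]
        interchange[of j n f g f' g' k] interchange[of j n g f g' f' k]
      by (auto split: if_splits)
  next
    fix k n f g h assume c: "composable (opp L) k n f g" "composable (opp L) k n g h"
    note cc = c[unfolded composable_opp_iff]
    have 1: "composable (opp L) k n (cmp (opp L) k f g) h" "composable (opp L) k n f (cmp (opp L) k g h)"
      unfolding composable_opp_iff cmp_opp[OF c(1)] cmp_opp[OF c(2)]
      using cc composable_assoc[of k n f g h] composable_assoc[of k n h g f] by (auto split: if_splits)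
    show "cmp (opp L) k (cmp (opp L) k f g) h = cmp (opp L) k f (cmp (opp L) k g h)"
      using cc cmp_opp[OF c(1)] cmp_opp[OF c(2)] cmp_opp[OF 1(1)] cmp_opp[OF 1(2)] assoc[of k n f g h] assoc[of k n h g f]
      by (auto split: if_splits)
  next
    fix f n k assume f: "f \<in> Cell (opp L) n" "1 \<le> k" "k \<le> n"
    note u = O.composable_unit[OF f]
    have fL: "f \<in> Cell L n" using f by simp
    obtain m where n: "n = m + k" using f(3) by (metis le_add_diff_inverse2)
    have c: "(cd (opp L) ^^ k) f \<in> Cell L m" "(dm (opp L) ^^ k) f \<in> Cell L m"
      using O.cd_pow_cell[of f m k] O.dm_pow_cell[of f m k] f by (auto simp: n)
    show "cmp (opp L) k ((idn (opp L) ^^ k) ((cd (opp L) ^^ k) f)) f = f"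
      using unit_left[OF fL f(2,3)] unit_right[OF fL f(2,3)]
        cmp_opp[OF u(1)] idn_opp_pow[OF c(1)] cd_opp_pow[OF fL f(3)] by (auto split: if_splits)
    show "cmp (opp L) k f ((idn (opp L) ^^ k) ((dm (opp L) ^^ k) f)) = f"
      using unit_left[OF fL f(2,3)] unit_right[OF fL f(2,3)]
        cmp_opp[OF u(2)] idn_opp_pow[OF c(2)] dm_opp_pow[OF fL f(3)] by (auto split: if_splits)
  qed
qed

context globular begin

lemma hom_cells_opp:
  assumes a: "a \<in> Cell L 0" and b: "b \<in> Cell L 0"
  shows "hom_cells (opp L) n b a = hom_cells L n a b"
proof -
  interpret O: globular "opp L" by (rule globular_opp)
  have b': "b \<in> Cell (opp L) 0" using b by simp
  show ?thesis
    using dm_opp_pow[of _ "Suc n" "Suc n"] cd_opp_pow[of _ "Suc n" "Suc n"]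
    by (auto simp: hom_cells_iff[OF a] O.hom_cells_iff[OF b'] simp del: funpow.simps)
qed

text \<open>The operations of a hom-category never touch the boundary in degree 0, where the opposite differs.
  This equality turns \<open>L(-,b)\<close> into a covariant hom-functor of the opposite category.\<close>

lemma hom_opp:
  assumes a: "a \<in> Cell L 0" and b: "b \<in> Cell L 0"
  shows "hom (opp L) b a = hom L a b"
proof -
  interpret O: globular "opp L" by (rule globular_opp)
  have b': "b \<in> Cell (opp L) 0" using b by simp
  note hc = hom_cells_opp[OF a b]
  have c: "f \<in> Cell L (Suc n)" if "f \<in> hom_cells L n a b" for f n using hom_cells_Cell[OF a that] .
  have dd: "(dm (hom (opp L) b a) ^^ k) f = (dm (hom L a b) ^^ k) f"
    "(cd (hom (opp L) b a) ^^ k) f = (cd (hom L a b) ^^ k) f" if "f \<in> hom_cells L n a b" "k \<le> n" for k n f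
    using that O.dm_hom_pow[of f n b a k] O.cd_hom_pow[of f n b a k] dm_opp_pow[OF c] cd_opp_pow[OF c]
    by (auto simp: hc dm_hom_pow cd_hom_pow)
  have comp: "composable (hom (opp L) b a) k n f g = composable (hom L a b) k n f g" for k n f g
    unfolding composable_def Cell_hom hc using dd by auto
  have cm: "cmp (hom (opp L) b a) k f g = cmp (hom L a b) k f g" for k f g
  proof (cases "\<exists>n. composable (hom L a b) k n f g")
    case True
    then obtain n where n: "composable (hom L a b) k n f g" by blast
    then have O: "composable (hom (opp L) b a) k n f g" using comp by simp
    have kn: "k \<le> n" using n by (simp add: composable_def)
    have oc: "composable (opp L) k (Suc n) f g" using O.composable_of_hom[OF b' O] .
    show ?thesis using O.cmp_hom[OF O] cmp_hom[OF n] cmp_opp[OF oc] kn by simp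
  next
    case False
    have "cmp M k f g = undefined" if "canon M = M" "\<And>n. \<not> composable M k n f g" for M :: "'a cells"
    proof -
      have "cmp (canon M) k f g = undefined" using that(2) by (simp add: canon_def)
      then show ?thesis using that(1) by simp
    qed
    then show ?thesis using False comp canon_hom O.canon_hom by metis
  qed
  have R: "dm M = restrict (dm M) (\<Union>n. Cell M (Suc n))" "cd M = restrict (cd M) (\<Union>n. Cell M (Suc n))"
      "idn M = restrict (idn M) (\<Union>n. Cell M n)" if "canon M = M" for M :: "'a cells"
  proof -
    have "dm (canon M) = dm M" "cd (canon M) = cd M" "idn (canon M) = idn M" using that by simp_all
    then show "dm M = restrict (dm M) (\<Union>n. Cell M (Suc n))" "cd M = restrict (cd M) (\<Union>n. Cell M (Suc n))"
      "idn M = restrict (idn M) (\<Union>n. Cell M n)" by (simp_all add: canon_def all_cells_def)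
  qed
  note RL = R[OF canon_hom[of a b], unfolded Cell_hom] and RO = R[OF O.canon_hom[of b a], unfolded Cell_hom hc]
  have "dm (hom (opp L) b a) = dm (hom L a b)"
    by (subst RL(1), subst RO(1), rule restrict_ext) (use dd[of _ _ 1] in auto)
  moreover have "cd (hom (opp L) b a) = cd (hom L a b)"
    by (subst RL(2), subst RO(2), rule restrict_ext) (use dd[of _ _ 1] in auto)
  moreover have "idn (hom (opp L) b a) = idn (hom L a b)"
    by (subst RL(3), subst RO(3), rule restrict_ext)
      (use idn_hom[of _ "opp L" _ b a] idn_hom[of _ L _ a b] idn_opp[OF c] in \<open>auto simp: hc\<close>)
  ultimately have ext: "dm (hom (opp L) b a) = dm (hom L a b)" "cd (hom (opp L) b a) = cd (hom L a b)"
    "idn (hom (opp L) b a) = idn (hom L a b)" by blast+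
  show ?thesis using ext cm hc by (intro cells.equality) (auto simp: fun_eq_iff)
qed

lemma mu_opp:
  assumes "a \<in> Cell L 0" "f \<in> hom_cells L n b c" "g \<in> hom_cells L n a b"
  shows "mu (opp L) n g f = mu L n f g"
proof -
  have "composable (opp L) (Suc n) (Suc n) g f"
    using composable_mu[OF assms] by (simp add: composable_opp_iff)
  then show ?thesis by (simp add: mu_def cmp_opp)
qed

end

section \<open>Hom-functors of a strict category\<close>

definition strict_functor :: "'a cells \<Rightarrow> 'b cells \<Rightarrow> ('a \<Rightarrow> 'b) \<Rightarrow> bool" where
  "strict_functor M N F \<longleftrightarrow>
     (\<forall>n. \<forall>x \<in> Cell M n. F x \<in> Cell N n \<and> F (idn M x) = idn N (F x)) \<and>
     (\<forall>n. \<forall>x \<in> Cell M (Suc n). F (dm M x) = dm N (F x) \<and> F (cd M x) = cd N (F x)) \<and>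
     (\<forall>k n x y. composable M k n x y \<longrightarrow> F (cmp M k x y) = cmp N k (F x) (F y))"

lemma strict_functor_inf_functor:
  assumes "strict_functor M N F" "strict_omega M" "strict_omega N"
  shows "inf_functor M N F"
proof -
  interpret M: strict_omega M by fact
  interpret N: strict_omega N by fact
  show ?thesis using assms(1) N.eqv_refl N.idn_cell M.cmp_cell
    unfolding strict_functor_def inf_functor_def by metis
qed

lemma cat_idn_pos: "cat_deg \<alpha> \<noteq> 0 \<Longrightarrow>
  cat_idn \<alpha> = CatMod \<alpha> \<alpha> (\<lambda>a \<in> Cell (dom_cat \<alpha>) 0. idn (cod_cat \<alpha>) (cat_map \<alpha> a))"
  by (cases \<alpha>) auto

context strict_omega begin

text \<open>This is why composing with a fixed cell \<open>x\<close> preserves \<open>\<circ>\<^sub>k\<close>: in \<open>x * (y \<circ>\<^sub>k z)\<close> the iterated identity of \<open>x\<close> may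
  be split as its own \<open>\<circ>\<^sub>k\<close>-square before interchanging.\<close>

lemma cmp_idn_pow_self:
  assumes "b \<in> Cell L 0" "x \<in> hom_cells L q b c" "1 \<le> k" "k \<le> n"
  shows "cmp L k ((idn L ^^ n) x) ((idn L ^^ n) x) = (idn L ^^ n) x"
    and "composable (hom L b c) k (q + n) ((idn L ^^ n) x) ((idn L ^^ n) x)"
proof -
  have e: "(idn L ^^ n) x \<in> hom_cells L (q + n) b c" using hom_cells_idn_pow[OF assms(2)] .
  have x: "x \<in> Cell L (Suc q)" using hom_cells_Cell assms(1,2) .
  have n: "k + (n - k) = n" using assms by simp
  have dc: "(dm L ^^ k) ((idn L ^^ n) x) = (idn L ^^ (n - k)) x" "(cd L ^^ k) ((idn L ^^ n) x) = (idn L ^^ (n - k)) x"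
    using dm_idn_pow_less[OF x, of k "n - k"] cd_idn_pow_less[OF x, of k "n - k"] unfolding n .
  show "composable (hom L b c) k (q + n) ((idn L ^^ n) x) ((idn L ^^ n) x)"
    unfolding composable_hom_iff using assms e dc by simp
  have "cmp L k ((idn L ^^ k) ((cd L ^^ k) ((idn L ^^ n) x))) ((idn L ^^ n) x) = (idn L ^^ n) x"
    using assms hom_cells_Cell[OF assms(1) e] by (intro unit_left[of _ "Suc (q + n)"]) auto
  then show "cmp L k ((idn L ^^ n) x) ((idn L ^^ n) x) = (idn L ^^ n) x"
    unfolding dc using fun_cong[OF funpow_add[of k "n - k" "idn L"], of x] n by simp
qed

lemma deg_hom: "a \<in> Cell L 0 \<Longrightarrow> x \<in> hom_cells L q a b \<Longrightarrow> deg (hom L a b) x = q"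
  using globular.deg_eq[OF globular_hom] by simp

lemma hom_from_at_1:
  assumes "\<alpha> \<in> hom_cells L 0 b c" "a \<in> Cell L 0" "b \<in> Cell L 0"
  shows "hom_from_at L a (Suc 0) \<alpha> = CatFun (hom L a b) (hom L a c)
     (\<lambda>x \<in> all_cells (hom L a b). mu L (deg (hom L a b) x) ((idn L ^^ deg (hom L a b) x) \<alpha>) x)"
  using assms by (auto simp: hom_cells_iff hcomp_def fun_eq_iff)

lemma hom_from_at_Suc_Suc:
  assumes "\<alpha> \<in> hom_cells L (Suc n) b c" "a \<in> Cell L 0" "b \<in> Cell L 0"
  shows "hom_from_at L a (Suc (Suc n)) \<alpha> = CatMod (hom_from_at L a (Suc n) (dm L \<alpha>)) (hom_from_at L a (Suc n) (cd L \<alpha>))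
     (\<lambda>x \<in> hom_cells L 0 a b. mu L (Suc n) \<alpha> ((idn L ^^ Suc n) x))"
proof -
  have "(dm L ^^ (n + 2)) \<alpha> = b" using assms by (simp add: hom_cells_iff)
  then show ?thesis unfolding hom_from_at.simps by (simp add: hcomp_def restrict_def fun_eq_iff)
qed

lemma hom_from_at_dom_cod:
  "\<alpha> \<in> hom_cells L n b c \<Longrightarrow> b \<in> Cell L 0 \<Longrightarrow>
    dom_cat (hom_from_at L a (Suc n) \<alpha>) = hom L a b \<and> cod_cat (hom_from_at L a (Suc n) \<alpha>) = hom L a c"
  by (induction n arbitrary: \<alpha>) (auto simp: hom_cells_iff[of _ \<alpha> 0] hom_cells_dm hom_cells_iff[of _ _ 0])

lemma cat_deg_hom_from_at [simp]: "cat_deg (hom_from_at L a n \<alpha>) = n"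
  by (induction L a n \<alpha> rule: hom_from_at.induct) auto

lemma cat_dm_hom_from_at: "cat_dm (hom_from_at L a (Suc n) \<alpha>) = hom_from_at L a n (dm L \<alpha>)"
  by (cases n) auto

lemma cat_cd_hom_from_at: "cat_cd (hom_from_at L a (Suc n) \<alpha>) = hom_from_at L a n (cd L \<alpha>)"
  by (cases n) auto

lemma cat_dm_pow_hom_from_at: "(cat_dm ^^ k) (hom_from_at L a (n + k) \<alpha>) = hom_from_at L a n ((dm L ^^ k) \<alpha>)"
  by (induction k arbitrary: \<alpha>) (auto simp: funpow_swap1 cat_dm_hom_from_at simp del: hom_from_at.simps)

lemma cat_cd_pow_hom_from_at: "(cat_cd ^^ k) (hom_from_at L a (n + k) \<alpha>) = hom_from_at L a n ((cd L ^^ k) \<alpha>)"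
  by (induction k arbitrary: \<alpha>) (auto simp: funpow_swap1 cat_cd_hom_from_at simp del: hom_from_at.simps)

lemma hom_from_at_map_cells:
  assumes "\<alpha> \<in> hom_cells L 0 b c" "a \<in> Cell L 0" "b \<in> Cell L 0" "x \<in> hom_cells L q a b"
  shows "cat_map (hom_from_at L a (Suc 0) \<alpha>) x = mu L q ((idn L ^^ q) \<alpha>) x"
  unfolding hom_from_at_1[OF assms(1-3)] using assms(4) deg_hom[OF assms(2,4)]
  by (auto simp: all_cells_def)

lemma hom_from_at_map_objects:
  assumes "\<alpha> \<in> hom_cells L n b c" "a \<in> Cell L 0" "b \<in> Cell L 0" "x \<in> hom_cells L 0 a b"
  shows "cat_map (hom_from_at L a (Suc n) \<alpha>) x = mu L n \<alpha> ((idn L ^^ n) x)"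
proof (cases n)
  case 0
  then show ?thesis using hom_from_at_map_cells[of \<alpha> b c a x 0] assms by simp
next
  case (Suc m)
  then show ?thesis using assms hom_from_at_Suc_Suc[of \<alpha> m b c a] by simp
qed

lemma idn_pow_hom_cells: "x \<in> hom_cells L 0 a b \<Longrightarrow> (idn L ^^ n) x \<in> hom_cells L n a b"
  using hom_cells_idn_pow[of x 0 a b n] by simp

text \<open>Functoriality for horizontal composites. The component at \<open>x\<close> of the composite modification is the
  \<open>\<circ>\<^sub>n\<close>-composite of two whiskered cells, which \<open>whisker_interchange\<close> turns into \<open>\<alpha> * (\<beta> * x)\<close>.\<close>

lemma hom_from_at_mu:
  assumes a: "a \<in> Cell L 0" and b: "b \<in> Cell L 0"
    and "\<alpha> \<in> hom_cells L n c d" "\<beta> \<in> hom_cells L n b c"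
  shows "hom_from_at L a (Suc n) (mu L n \<alpha> \<beta>) =
    cat_cmp (Suc n) (hom_from_at L a (Suc n) \<alpha>) (hom_from_at L a (Suc n) \<beta>)"
  using assms(3,4)
proof (induction n arbitrary: \<alpha> \<beta>)
  case 0
  have c: "c \<in> Cell L 0" using hom_cells_target b 0(2) .
  have m: "mu L 0 \<alpha> \<beta> \<in> hom_cells L 0 b d" using mu_cell b 0 .
  have "mu L q ((idn L ^^ q) (mu L 0 \<alpha> \<beta>)) x =
     cat_map (hom_from_at L a (Suc 0) \<alpha>) (mu L q ((idn L ^^ q) \<beta>) x)" if x: "x \<in> hom_cells L q a b" for x q
  proof -
    have e: "(idn L ^^ q) \<alpha> \<in> hom_cells L q c d" "(idn L ^^ q) \<beta> \<in> hom_cells L q b c"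
      using 0 by (auto intro: idn_pow_hom_cells)
    have y: "mu L q ((idn L ^^ q) \<beta>) x \<in> hom_cells L q a c" using mu_cell a e(2) x .
    show ?thesis unfolding hom_from_at_map_cells[OF 0(1) a c y]
      using mu_assoc[OF a e x] idn_pow_mu[OF b 0, of q] by simp
  qed
  then show ?case unfolding hom_from_at_1[OF 0(1) a c] hom_from_at_1[OF 0(2) a b] hom_from_at_1[OF m a b]
    by (auto simp: all_cells_def fun_eq_iff deg_hom[OF a])
next
  case (Suc n)
  let ?N = "Suc n"
  have c: "c \<in> Cell L 0" using hom_cells_target b Suc.prems(2) .
  have m: "mu L ?N \<alpha> \<beta> \<in> hom_cells L ?N b d" using mu_cell b Suc.prems .
  have dc: "(cd L ^^ ?N) \<beta> \<in> hom_cells L 0 b c" "(dm L ^^ ?N) \<alpha> \<in> hom_cells L 0 c d"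
    using hom_cells_cd_pow[of \<beta> 0 ?N] hom_cells_dm_pow[of \<alpha> 0 ?N] Suc.prems by simp_all
  have comp: "mu L ?N (mu L ?N \<alpha> \<beta>) ((idn L ^^ ?N) x) =
    cmp (hom L a d) ?N (cat_map (hom_from_at L a (Suc ?N) \<alpha>) (cat_map (hom_from_at L a (Suc 0) ((cd L ^^ ?N) \<beta>)) x))
      (cat_map (hom_from_at L a (Suc 0) ((dm L ^^ ?N) \<alpha>)) (mu L ?N \<beta> ((idn L ^^ ?N) x)))" if x: "x \<in> hom_cells L 0 a b" for x
  proof -
    have xe: "(idn L ^^ ?N) x \<in> hom_cells L ?N a b" using x by (rule idn_pow_hom_cells)
    have xc: "x \<in> Cell L 1" using hom_cells_Cell[OF a x] by simp
    \<comment> \<open>The two factors of the component are the whiskerings of \<open>\<alpha>\<close> and \<open>g\<close> by each other's boundary.\<close>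
    define g where "g = mu L ?N \<beta> ((idn L ^^ ?N) x)"
    have g: "g \<in> hom_cells L ?N a c" unfolding g_def using mu_cell a Suc.prems(2) xe .
    have cg: "(cd L ^^ ?N) g = mu L 0 ((cd L ^^ ?N) \<beta>) x"
      using cd_pow_mu[of a \<beta> 0 ?N b c "(idn L ^^ ?N) x"] a Suc.prems xe cd_pow_idn_pow[OF xc, of ?N] unfolding g_def by simp
    have cx: "mu L 0 ((cd L ^^ ?N) \<beta>) x \<in> hom_cells L 0 a c" using mu_cell a dc(1) x .
    have 1: "cat_map (hom_from_at L a (Suc ?N) \<alpha>) (cat_map (hom_from_at L a (Suc 0) ((cd L ^^ ?N) \<beta>)) x)
      = mu L ?N \<alpha> ((idn L ^^ ?N) ((cd L ^^ ?N) g))"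
      unfolding cg using hom_from_at_map_objects[OF Suc.prems(1) a c cx] hom_from_at_map_objects[OF dc(1) a b x] by simp
    have 2: "cat_map (hom_from_at L a (Suc 0) ((dm L ^^ ?N) \<alpha>)) g = mu L ?N ((idn L ^^ ?N) ((dm L ^^ ?N) \<alpha>)) g"
      using hom_from_at_map_cells[OF dc(2) a c g] .
    have N: "1 \<le> ?N" by simp
    note w = whisker_interchange(1,2)[OF a Suc.prems(1) g N]
    show ?thesis using w(1) mu_assoc[OF a Suc.prems xe]
      unfolding 1 g_def[symmetric] 2 cmp_hom[OF w(2)] by simp
  qed
  have A: "hom_from_at L a (Suc ?N) \<alpha> = CatMod (hom_from_at L a ?N (dm L \<alpha>)) (hom_from_at L a ?N (cd L \<alpha>))
     (\<lambda>x \<in> hom_cells L 0 a c. mu L ?N \<alpha> ((idn L ^^ ?N) x))"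
    and B: "hom_from_at L a (Suc ?N) \<beta> = CatMod (hom_from_at L a ?N (dm L \<beta>)) (hom_from_at L a ?N (cd L \<beta>))
     (\<lambda>x \<in> hom_cells L 0 a b. mu L ?N \<beta> ((idn L ^^ ?N) x))"
    and M: "hom_from_at L a (Suc ?N) (mu L ?N \<alpha> \<beta>) = CatMod (hom_from_at L a ?N (dm L (mu L ?N \<alpha> \<beta>))) (hom_from_at L a ?N (cd L (mu L ?N \<alpha> \<beta>)))
     (\<lambda>x \<in> hom_cells L 0 a b. mu L ?N (mu L ?N \<alpha> \<beta>) ((idn L ^^ ?N) x))"
    using hom_from_at_Suc_Suc a b c Suc.prems m by blast+
  have P: "(cat_cd ^^ ?N) (hom_from_at L a (Suc ?N) \<beta>) = hom_from_at L a (Suc 0) ((cd L ^^ ?N) \<beta>)"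
    "(cat_dm ^^ ?N) (hom_from_at L a (Suc ?N) \<alpha>) = hom_from_at L a (Suc 0) ((dm L ^^ ?N) \<alpha>)"
    using cat_cd_pow_hom_from_at[of ?N a "Suc 0" \<beta>] cat_dm_pow_hom_from_at[of ?N a "Suc 0" \<alpha>] by simp_all
  have D: "dom_cat (hom_from_at L a ?N (dm L \<beta>)) = hom L a b" "cod_cat (hom_from_at L a ?N (dm L \<alpha>)) = hom L a d"
    using hom_from_at_dom_cod hom_cells_dm Suc.prems b c by blast+
  have "cat_cmp (Suc ?N) (hom_from_at L a (Suc ?N) \<alpha>) (hom_from_at L a (Suc ?N) \<beta>) =
    CatMod (cat_cmp ?N (hom_from_at L a ?N (dm L \<alpha>)) (hom_from_at L a ?N (dm L \<beta>)))
      (cat_cmp ?N (hom_from_at L a ?N (cd L \<alpha>)) (hom_from_at L a ?N (cd L \<beta>)))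
      (\<lambda>x \<in> hom_cells L 0 a b. cmp (hom L a d) ?N (cat_map (hom_from_at L a (Suc ?N) \<alpha>) (cat_map (hom_from_at L a (Suc 0) ((cd L ^^ ?N) \<beta>)) x))
      (cat_map (hom_from_at L a (Suc 0) ((dm L ^^ ?N) \<alpha>)) (mu L ?N \<beta> ((idn L ^^ ?N) x))))"
    unfolding P[symmetric] unfolding A B cat_cmp.simps cat_deg.simps cat_deg_hom_from_at Let_def D cat_map.simps
    by (simp add: fun_eq_iff)
  also have "\<dots> = hom_from_at L a (Suc ?N) (mu L ?N \<alpha> \<beta>)"
    unfolding M using Suc.IH[OF hom_cells_dm[OF Suc.prems(1)] hom_cells_dm[OF Suc.prems(2)]]
      Suc.IH[OF hom_cells_cd[OF Suc.prems(1)] hom_cells_cd[OF Suc.prems(2)]]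
      dm_mu[OF b Suc.prems] cd_mu[OF b Suc.prems] comp
    by (simp add: fun_eq_iff del: hom_from_at.simps cat_cmp.simps funpow.simps)
  finally show ?case by simp
qed

text \<open>Functoriality for the composites inside a hom, which are computed component by component in the
  target: this is interchange with \<open>e\<^sup>nx = e\<^sup>nx \<circ>\<^sub>k e\<^sup>nx\<close>.\<close>

lemma hom_from_at_cmp:
  assumes a: "a \<in> Cell L 0" and b: "b \<in> Cell L 0" and "composable (hom L b c) k n \<alpha> \<beta>"
  shows "hom_from_at L a (Suc n) (cmp L k \<alpha> \<beta>) =
    cat_cmp k (hom_from_at L a (Suc n) \<alpha>) (hom_from_at L a (Suc n) \<beta>)"
  using assms(3)
proof (induction n arbitrary: k \<alpha> \<beta>)
  case 0
  then have False by (auto simp: composable_def)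
  then show ?case ..
next
  case (Suc m)
  let ?n = "Suc m"
  interpret M: strict_omega "hom L b c" using b by (rule strict_omega_hom)
  have p: "\<alpha> \<in> hom_cells L ?n b c" "\<beta> \<in> hom_cells L ?n b c" and k: "1 \<le> k" "k \<le> ?n"
    using Suc.prems by (auto simp: composable_hom_iff)
  have pq: "cmp L k \<alpha> \<beta> \<in> hom_cells L ?n b c" using cmp_hom_cell[OF b Suc.prems] .
  note cL = composable_of_hom[OF b Suc.prems]
  have comp: "mu L ?n (cmp L k \<alpha> \<beta>) ((idn L ^^ ?n) x) =
      cmp (hom L a c) k (mu L ?n \<alpha> ((idn L ^^ ?n) x)) (mu L ?n \<beta> ((idn L ^^ ?n) x))"
    if x: "x \<in> hom_cells L 0 a b" for x
  proof -
    note e = cmp_idn_pow_self[OF a x k]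
    note i = mu_interchange[OF a b Suc.prems e(2)[simplified add_0]]
    show ?thesis using i(1) e(1) cmp_hom[OF i(2)] by simp
  qed
  note A = hom_from_at_Suc_Suc[OF p(1) a b] and B = hom_from_at_Suc_Suc[OF p(2) a b]
    and M = hom_from_at_Suc_Suc[OF pq a b]
  have D: "dom_cat (hom_from_at L a ?n (dm L \<beta>)) = hom L a b" "cod_cat (hom_from_at L a ?n (dm L \<alpha>)) = hom L a c"
    using hom_from_at_dom_cod hom_cells_dm p b by blast+
  have S: "hom_from_at L a ?n (dm L (cmp L k \<alpha> \<beta>)) = (if k = 1 then hom_from_at L a ?n (dm L \<beta>)
      else cat_cmp (k - 1) (hom_from_at L a ?n (dm L \<alpha>)) (hom_from_at L a ?n (dm L \<beta>)))"
    "hom_from_at L a ?n (cd L (cmp L k \<alpha> \<beta>)) = (if k = 1 then hom_from_at L a ?n (cd L \<alpha>)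
      else cat_cmp (k - 1) (hom_from_at L a ?n (cd L \<alpha>)) (hom_from_at L a ?n (cd L \<beta>)))"
  proof (atomize (full), cases "k = 1")
    case True
    then show "hom_from_at L a ?n (dm L (cmp L k \<alpha> \<beta>)) = (if k = 1 then hom_from_at L a ?n (dm L \<beta>)
      else cat_cmp (k - 1) (hom_from_at L a ?n (dm L \<alpha>)) (hom_from_at L a ?n (dm L \<beta>))) \<and>
      hom_from_at L a ?n (cd L (cmp L k \<alpha> \<beta>)) = (if k = 1 then hom_from_at L a ?n (cd L \<alpha>)
      else cat_cmp (k - 1) (hom_from_at L a ?n (cd L \<alpha>)) (hom_from_at L a ?n (cd L \<beta>)))"
      using dm_cmp_1 cd_cmp_1 cL by simp
  next
    case False
    then obtain j where j: "k = Suc j" "1 \<le> j" using k by (cases k) auto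
    have "composable (hom L b c) j m (dm L \<alpha>) (dm L \<beta>)" "composable (hom L b c) j m (cd L \<alpha>) (cd L \<beta>)"
      using M.composable_dm[of j ?n \<alpha> \<beta>] Suc.prems j p by (simp_all add: dm_hom cd_hom)
    then show "hom_from_at L a ?n (dm L (cmp L k \<alpha> \<beta>)) = (if k = 1 then hom_from_at L a ?n (dm L \<beta>)
      else cat_cmp (k - 1) (hom_from_at L a ?n (dm L \<alpha>)) (hom_from_at L a ?n (dm L \<beta>))) \<and>
      hom_from_at L a ?n (cd L (cmp L k \<alpha> \<beta>)) = (if k = 1 then hom_from_at L a ?n (cd L \<alpha>)
      else cat_cmp (k - 1) (hom_from_at L a ?n (cd L \<alpha>)) (hom_from_at L a ?n (cd L \<beta>)))"
      using Suc.IH dm_cmp_Suc[of j "Suc ?n" \<alpha> \<beta>] cd_cmp_Suc[of j "Suc ?n" \<alpha> \<beta>] cL j by simp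
  qed
  have "k < Suc (Suc m)" using k by simp
  then show ?case unfolding A B M cat_cmp.simps S D cat_deg.simps cat_deg_hom_from_at
    using comp by (simp add: fun_eq_iff del: hom_from_at.simps cat_cmp.simps funpow.simps)
qed

lemma hom_from_at_idn:
  assumes a: "a \<in> Cell L 0" and b: "b \<in> Cell L 0" and x: "\<alpha> \<in> hom_cells L n b c"
  shows "hom_from_at L a (Suc (Suc n)) (idn L \<alpha>) = cat_idn (hom_from_at L a (Suc n) \<alpha>)"
proof -
  have ac: "\<alpha> \<in> Cell L (Suc n)" using hom_cells_Cell[OF b x] .
  have "mu L (Suc n) (idn L \<alpha>) ((idn L ^^ Suc n) y) = idn (hom L a c) (cat_map (hom_from_at L a (Suc n) \<alpha>) y)"
    if y: "y \<in> hom_cells L 0 a b" for y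
  proof -
    note ye = idn_pow_hom_cells[OF y, of n]
    show ?thesis
      using idn_hom[OF mu_cell[OF a x ye]] idn_cmp[OF composable_mu[OF a x ye]]
      unfolding hom_from_at_map_objects[OF x a b y] by (simp add: mu_def)
  qed
  then show ?thesis unfolding hom_from_at_Suc_Suc[OF hom_cells_idn[OF x] a b]
    using hom_from_at_dom_cod[OF x b, of a] dm_idn[OF ac] cd_idn[OF ac]
    by (simp add: cat_idn_pos fun_eq_iff del: hom_from_at.simps funpow.simps)
qed

lemma hom_from_at_idn_object:
  assumes a: "a \<in> Cell L 0" and b: "b \<in> Cell L 0"
  shows "hom_from_at L a (Suc 0) (idn L b) = cat_idn (hom_from_at L a 0 b)"
proof -
  have i: "idn L b \<in> hom_cells L 0 b b" using b by (simp add: hom_cells_iff idn_cell dm_idn cd_idn)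
  have "mu L q ((idn L ^^ q) (idn L b)) x = x" if "x \<in> hom_cells L q a b" for x q
    using mu_unit_left[OF a that] by (simp add: funpow_swap1)
  then show ?thesis unfolding hom_from_at_1[OF i a b]
    by (auto simp: fun_eq_iff all_cells_def deg_hom[OF a])
qed

lemma strict_functor_hom_from_at:
  assumes a: "a \<in> Cell L 0" and b: "b \<in> Cell L 0" and x: "\<alpha> \<in> hom_cells L 0 b c"
  shows "strict_functor (hom L a b) (hom L a c) (cat_map (hom_from_at L a (Suc 0) \<alpha>))"
proof -
  let ?F = "cat_map (hom_from_at L a (Suc 0) \<alpha>)"
  note F = hom_from_at_map_cells[OF x a b]
  note e = idn_pow_hom_cells[OF x]
  have ac: "\<alpha> \<in> Cell L (Suc 0)" using hom_cells_Cell[OF b x] .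
  have cell: "?F y \<in> hom_cells L n a c" if "y \<in> hom_cells L n a b" for y n
    unfolding F[OF that] using mu_cell[OF a e that] .
  show ?thesis unfolding strict_functor_def Cell_hom
  proof (intro conjI allI ballI impI)
    fix n y assume y: "y \<in> hom_cells L n a b"
    show "?F y \<in> hom_cells L n a c" using cell[OF y] .
    show "?F (idn (hom L a b) y) = idn (hom L a c) (?F y)"
      using idn_hom[OF mu_cell[OF a e y]] idn_cmp[OF composable_mu[OF a e y]]
      unfolding idn_hom[OF y] F[OF y] F[OF hom_cells_idn[OF y]] by (simp add: mu_def)
  next
    fix n y assume y: "y \<in> hom_cells L (Suc n) a b"
    have ea: "(idn L ^^ n) \<alpha> \<in> Cell L (Suc 0 + n)" using idn_pow_cell[OF ac] .
    show "?F (dm (hom L a b) y) = dm (hom L a c) (?F y)"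
      using dm_hom[OF mu_cell[OF a e y]] dm_mu[OF a e y] dm_idn[OF ea]
      unfolding dm_hom[OF y] F[OF y] F[OF hom_cells_dm[OF y]] by simp
    show "?F (cd (hom L a b) y) = cd (hom L a c) (?F y)"
      using cd_hom[OF mu_cell[OF a e y]] cd_mu[OF a e y] cd_idn[OF ea]
      unfolding cd_hom[OF y] F[OF y] F[OF hom_cells_cd[OF y]] by simp
  next
    fix k n y z assume c: "composable (hom L a b) k n y z"
    have yz: "y \<in> hom_cells L n a b" "z \<in> hom_cells L n a b" and k: "1 \<le> k" "k \<le> n"
      using c by (auto simp: composable_hom_iff)
    note s = cmp_idn_pow_self[OF b x k]
    note i = mu_interchange[OF a b s(2)[simplified add_0] c]
    show "?F (cmp (hom L a b) k y z) = cmp (hom L a c) k (?F y) (?F z)"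
      unfolding cmp_hom[OF c] F[OF yz(1)] F[OF yz(2)] F[OF cmp_hom_cell[OF a c]] cmp_hom[OF i(2)]
      using i(1) s(1) by simp
  qed
qed

text \<open>The modification attached to \<open>\<alpha>\<close> is natural because both sides of the naturality condition at \<open>f\<close> are equal
  to \<open>\<alpha> * f\<close>, by the two halves of \<open>whisker_interchange\<close>.\<close>

lemma hom_from_at_in_cat_Cell:
  assumes a: "a \<in> Cell L 0" and I: "\<And>b. b \<in> Cell L 0 \<Longrightarrow> inf_category (hom L a b)" and "\<alpha> \<in> Cell L n"
  shows "hom_from_at L a n \<alpha> \<in> cat_Cell n"
proof (cases n)
  case 0
  then show ?thesis using I assms(3) by simp
next
  case (Suc m)
  have in_hom: "\<exists>b c. b \<in> Cell L 0 \<and> c \<in> Cell L 0 \<and> \<alpha> \<in> hom_cells L n b c" if "\<alpha> \<in> Cell L (Suc n)" for \<alpha> n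
    using that hom_cells_iff[OF dm_pow_cell[of \<alpha> 0 "Suc n"], of \<alpha> n] cd_pow_cell[of \<alpha> 0 "Suc n"] dm_pow_cell[of \<alpha> 0 "Suc n"]
    by (auto simp del: funpow.simps)
  have "hom_from_at L a (Suc m) \<alpha> \<in> cat_Cell (Suc m)" if "\<alpha> \<in> Cell L (Suc m)" for m
    using that
  proof (induction m arbitrary: \<alpha>)
    case 0
    obtain b c where bc: "b \<in> Cell L 0" "c \<in> Cell L 0" and x: "\<alpha> \<in> hom_cells L 0 b c" using in_hom[OF 0] by blast
    have sf: "strict_functor (hom L a b) (hom L a c) (cat_map (hom_from_at L a (Suc 0) \<alpha>))"
      using strict_functor_hom_from_at[OF a bc(1) x] .
    have "inf_functor (hom L a b) (hom L a c) (cat_map (hom_from_at L a (Suc 0) \<alpha>))"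
      using strict_functor_inf_functor[OF sf strict_omega_hom strict_omega_hom] a by blast
    then show ?case using I bc unfolding hom_from_at_1[OF x a bc(1)] by simp
  next
    case (Suc m)
    let ?N = "Suc m"
    obtain b c where b: "b \<in> Cell L 0" and c: "c \<in> Cell L 0" and x: "\<alpha> \<in> hom_cells L ?N b c" using in_hom[OF Suc.prems] by blast
    interpret C: strict_omega "hom L a c" using a by (rule strict_omega_hom)
    let ?s = "hom_from_at L a ?N (dm L \<alpha>)" and ?t = "hom_from_at L a ?N (cd L \<alpha>)"
    let ?h = "\<lambda>x \<in> hom_cells L 0 a b. mu L ?N \<alpha> ((idn L ^^ ?N) x)"
    note D = hom_from_at_dom_cod[OF hom_cells_dm[OF x] b, of a]
    have st: "?s \<in> cat_Cell ?N" "?t \<in> cat_Cell ?N" using Suc.IH dm_cell cd_cell Suc.prems by blast+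
    have par: "cat_dm ?s = cat_dm ?t" "cat_cd ?s = cat_cd ?t"
      using dm_cd[OF Suc.prems] cd_dm[OF Suc.prems] by (simp_all add: cat_dm_hom_from_at cat_cd_hom_from_at del: hom_from_at.simps)
    have P: "(cat_dm ^^ m) ?s = hom_from_at L a (Suc 0) ((dm L ^^ ?N) \<alpha>)" "(cat_cd ^^ m) ?t = hom_from_at L a (Suc 0) ((cd L ^^ ?N) \<alpha>)"
      using cat_dm_pow_hom_from_at[of m a "Suc 0" "dm L \<alpha>"] cat_cd_pow_hom_from_at[of m a "Suc 0" "cd L \<alpha>"]
      by (simp_all add: funpow_swap1 del: hom_from_at.simps)
    have d: "(dm L ^^ ?N) \<alpha> \<in> hom_cells L 0 b c" "(cd L ^^ ?N) \<alpha> \<in> hom_cells L 0 b c"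
      using hom_cells_dm_pow[of \<alpha> 0 ?N] hom_cells_cd_pow[of \<alpha> 0 ?N] x by simp_all
    note F = hom_from_at_map_cells[OF d(1) a b] and G = hom_from_at_map_cells[OF d(2) a b]
    have "modification m (hom L a b) (hom L a c) (cat_map ((cat_dm ^^ m) ?s)) (cat_map ((cat_cd ^^ m) ?t)) (cat_map ?s) (cat_map ?t) ?h"
      unfolding modification_def Cell_hom P
    proof (intro conjI ballI allI)
      fix y assume y: "y \<in> hom_cells L 0 a b"
      have yc: "y \<in> Cell L 1" using hom_cells_Cell[OF a y] by simp
      note ye = idn_pow_hom_cells[OF y]
      have h: "?h y = mu L ?N \<alpha> ((idn L ^^ ?N) y)" using y by simp
      have hy: "?h y \<in> hom_cells L ?N a c" unfolding h using mu_cell[OF a x ye] .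
      have yy: "dm L ((idn L ^^ ?N) y) = (idn L ^^ m) y" "cd L ((idn L ^^ ?N) y) = (idn L ^^ m) y"
        using dm_idn[OF idn_pow_cell[OF yc]] cd_idn[OF idn_pow_cell[OF yc]] by simp_all
      show "dm (hom L a c) (?h y) = cat_map ?s y" "cd (hom L a c) (?h y) = cat_map ?t y"
        unfolding dm_hom[OF hy] cd_hom[OF hy] hom_from_at_map_objects[OF hom_cells_dm[OF x] a b y]
          hom_from_at_map_objects[OF hom_cells_cd[OF x] a b y]
        unfolding h dm_mu[OF a x ye] cd_mu[OF a x ye] yy by simp_all
      have z: "(dm L ^^ ?N) ((idn L ^^ ?N) y) = y" "(cd L ^^ ?N) ((idn L ^^ ?N) y) = y"
        using dm_pow_idn_pow[OF yc] cd_pow_idn_pow[OF yc] by blast+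
      have dd: "(dm L ^^ ?N) (?h y) = cat_map (hom_from_at L a (Suc 0) ((dm L ^^ ?N) \<alpha>)) y"
        "(cd L ^^ ?N) (?h y) = cat_map (hom_from_at L a (Suc 0) ((cd L ^^ ?N) \<alpha>)) y"
        unfolding F[OF y] G[OF y] h
        using dm_pow_mu[of a \<alpha> 0 ?N b c "(idn L ^^ ?N) y"] cd_pow_mu[of a \<alpha> 0 ?N b c "(idn L ^^ ?N) y"] a x ye z
        by (simp_all del: funpow.simps)
      have FG: "cat_map (hom_from_at L a (Suc 0) ((dm L ^^ ?N) \<alpha>)) y \<in> hom_cells L 0 a c"
        "cat_map (hom_from_at L a (Suc 0) ((cd L ^^ ?N) \<alpha>)) y \<in> hom_cells L 0 a c"
        unfolding dd[symmetric] using hom_cells_dm_pow[of "?h y" 0 ?N] hom_cells_cd_pow[of "?h y" 0 ?N] hy by simp_all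
      show "?h y \<in> hom_cells (hom L a c) m (cat_map (hom_from_at L a (Suc 0) ((dm L ^^ ?N) \<alpha>)) y)
           (cat_map (hom_from_at L a (Suc 0) ((cd L ^^ ?N) \<alpha>)) y)"
        unfolding C.hom_cells_iff[OF FG(1)[folded Cell_hom]] Cell_hom
        using hy dd dm_hom_pow[OF hy, of ?N] cd_hom_pow[OF hy, of ?N] by (simp del: funpow.simps hom_from_at.simps)
    next
      fix y z k f assume y: "y \<in> hom_cells L 0 a b" and z: "z \<in> hom_cells L 0 a b"
        and f: "f \<in> hom_cells (hom L a b) (m + k) y z"
      let ?K = "Suc (m + k)"
      have fL: "f \<in> hom_cells L (m + k) y z" using f hom_cells_hom[OF a y z] by simp
      have f1: "f \<in> hom_cells L ?K a b"
        using f globular.hom_cells_iff[OF globular_hom[OF a], of y b f] y by simp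
      have y1: "(dm L ^^ ?K) f = y" and z1: "(cd L ^^ ?K) f = z"
        using fL by (auto simp: hom_cells_def)
      let ?A = "(idn L ^^ k) \<alpha>"
      have A: "?A \<in> hom_cells L ?K b c" using hom_cells_idn_pow[OF x, of k] by simp
      have xc: "\<alpha> \<in> Cell L (Suc ?N)" using hom_cells_Cell[OF b x] .
      have dA: "(dm L ^^ ?K) ?A = (dm L ^^ ?N) \<alpha>" "(cd L ^^ ?K) ?A = (cd L ^^ ?N) \<alpha>"
        using dm_pow_idn_pow[OF xc, of k] cd_pow_idn_pow[OF xc, of k]
          fun_cong[OF funpow_add[of ?N k "dm L"], of ?A] fun_cong[OF funpow_add[of ?N k "cd L"], of ?A] by (simp_all del: funpow.simps)
      note w = whisker_interchange[OF a A f1, unfolded dA y1 z1, simplified]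
      have h: "(idn (hom L a c) ^^ k) (?h v) = mu L ?K ?A ((idn L ^^ ?K) v)" if v: "v \<in> hom_cells L 0 a b" for v
      proof -
        note ve = idn_pow_hom_cells[OF v, of ?N]
        have "?h v = mu L ?N \<alpha> ((idn L ^^ ?N) v)" using v by simp
        moreover have "(idn (hom L a c) ^^ k) (mu L ?N \<alpha> ((idn L ^^ ?N) v)) = (idn L ^^ k) (mu L ?N \<alpha> ((idn L ^^ ?N) v))"
          using idn_hom_pow[OF mu_cell[OF a x ve]] .
        moreover have "(idn L ^^ k) ((idn L ^^ ?N) v) = (idn L ^^ ?K) v"
          using fun_cong[OF funpow_add[of k ?N "idn L"], of v] by (simp add: add.commute)
        ultimately show ?thesis using idn_pow_mu[OF a x ve, of k] by simp
      qed
      have 1: "mu (hom L a c) (m + k) ((idn (hom L a c) ^^ k) (?h z)) (cat_map (hom_from_at L a (Suc 0) ((dm L ^^ ?N) \<alpha>)) f) = mu L ?K ?A f"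
        unfolding h[OF z] F[OF f1] using w(1) cmp_hom[OF w(2)] by (simp add: mu_def[of "hom L a c"])
      have 2: "mu (hom L a c) (m + k) (cat_map (hom_from_at L a (Suc 0) ((cd L ^^ ?N) \<alpha>)) f) ((idn (hom L a c) ^^ k) (?h y)) = mu L ?K ?A f"
        unfolding h[OF y] G[OF f1] using w(3) cmp_hom[OF w(4)] by (simp add: mu_def[of "hom L a c"])
      show "eqv (hom L a c) (mu (hom L a c) (m + k) ((idn (hom L a c) ^^ k) (?h z)) (cat_map (hom_from_at L a (Suc 0) ((dm L ^^ ?N) \<alpha>)) f))
         (mu (hom L a c) (m + k) (cat_map (hom_from_at L a (Suc 0) ((cd L ^^ ?N) \<alpha>)) f) ((idn (hom L a c) ^^ k) (?h y)))"
        unfolding 1 2 using C.eqv_refl[of "mu L ?K ?A f" ?K] mu_cell[OF a A f1] by simp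
    qed
    then show ?case unfolding hom_from_at_Suc_Suc[OF x a b] cat_Cell.simps
      using st par D by (auto simp del: hom_from_at.simps)
  qed
  then show ?thesis using assms(3) Suc by simp
qed

end

context strict_omega begin

text \<open>The statements on \<open>L(-,t)\<close> that follow are those on covariant hom-functors, read in the opposite category.\<close>

lemma hom_to_at_opp:
  assumes t: "t \<in> Cell L 0" and "\<alpha> \<in> Cell L n"
  shows "hom_to_at L t n \<alpha> = hom_from_at (opp L) t n \<alpha>"
proof (cases n)
  case 0
  then show ?thesis using assms hom_opp by simp
next
  case (Suc m)
  interpret O: strict_omega "opp L" by (rule strict_omega_opp)
  have "hom_to_at L t (Suc m) \<alpha> = hom_from_at (opp L) t (Suc m) \<alpha>" if "\<alpha> \<in> Cell L (Suc m)" for m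
    using that
  proof (induction m arbitrary: \<alpha>)
    case 0
    have dc: "dm L \<alpha> \<in> Cell L 0" "cd L \<alpha> \<in> Cell L 0" using dm_cell cd_cell 0 by blast+
    have x: "\<alpha> \<in> hom_cells L 0 (dm L \<alpha>) (cd L \<alpha>)" using 0 dc by (simp add: hom_cells_iff)
    have d: "dm (opp L) \<alpha> = cd L \<alpha>" "cd (opp L) \<alpha> = dm L \<alpha>" using dm_opp[OF 0] cd_opp[OF 0] by simp_all
    have "hcomp L q 0 y \<alpha> = hcomp (opp L) 0 q \<alpha> y" if y: "y \<in> hom_cells L q (cd L \<alpha>) t" for y q
      using mu_opp[OF dc(1) y idn_pow_hom_cells[OF x, of q]] idn_opp_pow[OF 0] by (simp add: hcomp_def)
    then show ?case using hom_opp[OF dc(1) t] hom_opp[OF dc(2) t]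
      by (auto simp: d fun_eq_iff all_cells_def deg_hom[OF dc(2)])
  next
    case (Suc m)
    obtain b c where x: "\<alpha> \<in> hom_cells L (Suc m) b c" and b: "b \<in> Cell L 0" and c: "c \<in> Cell L 0"
      using Suc.prems hom_cells_iff[OF dm_pow_cell[of \<alpha> 0 "Suc (Suc m)"], of \<alpha> "Suc m"] dm_pow_cell[of \<alpha> 0 "Suc (Suc m)"]
        cd_pow_cell[of \<alpha> 0 "Suc (Suc m)"] by (auto simp del: funpow.simps)
    have d: "dm (opp L) \<alpha> = dm L \<alpha>" "cd (opp L) \<alpha> = cd L \<alpha>"
      using dm_opp[OF Suc.prems] cd_opp[OF Suc.prems] by simp_all
    have dd: "(dm (opp L) ^^ (m + 2)) \<alpha> = c" "(cd L ^^ (m + 2)) \<alpha> = c"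
      using dm_opp_pow[OF Suc.prems, of "Suc (Suc m)"] x by (simp_all add: hom_cells_iff[OF b] del: funpow.simps)
    have h: "hom_cells (opp L) 0 t c = hom_cells L 0 c t" using hom_cells_opp[OF c t] .
    have "hcomp L 0 (m + 1) y \<alpha> = hcomp (opp L) (m + 1) 0 \<alpha> y" if y: "y \<in> hom_cells L 0 c t" for y
      using mu_opp[OF b idn_pow_hom_cells[OF y, of "Suc m"] x] idn_opp_pow[OF hom_cells_Cell[OF c y]]
      by (simp add: hcomp_def del: funpow.simps)
    then show ?case unfolding hom_to_at.simps hom_from_at.simps d dd h
      using Suc.IH dm_cell[OF Suc.prems] cd_cell[OF Suc.prems] by (auto simp: fun_eq_iff)
  qed
  then show ?thesis using assms Suc by simp
qed

lemma hom_to_at_hom: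
  assumes "t \<in> Cell L 0" "b \<in> Cell L 0" "\<alpha> \<in> hom_cells L n b c"
  shows "hom_to_at L t (Suc n) \<alpha> = hom_from_at (opp L) t (Suc n) \<alpha>"
    and "\<alpha> \<in> hom_cells (opp L) n c b"
  using hom_to_at_opp hom_cells_Cell hom_cells_opp[OF assms(2)] hom_cells_target assms by blast+

lemma hom_to_at_dom_cod:
  assumes "t \<in> Cell L 0" "b \<in> Cell L 0" "\<alpha> \<in> hom_cells L n b c"
  shows "dom_cat (hom_to_at L t (Suc n) \<alpha>) = hom L c t" "cod_cat (hom_to_at L t (Suc n) \<alpha>) = hom L b t"
proof -
  interpret O: strict_omega "opp L" by (rule strict_omega_opp)
  have c: "c \<in> Cell L 0" using hom_cells_target assms(2,3) .
  show "dom_cat (hom_to_at L t (Suc n) \<alpha>) = hom L c t" "cod_cat (hom_to_at L t (Suc n) \<alpha>) = hom L b t"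
    using O.hom_from_at_dom_cod[OF hom_to_at_hom(2)[OF assms], of t] c hom_to_at_hom(1)[OF assms]
     hom_opp[OF c assms(1)] hom_opp[OF assms(2,1)] by simp_all
qed

lemma hom_to_at_map_cells:
  assumes t: "t \<in> Cell L 0" and b: "b \<in> Cell L 0" and x: "\<alpha> \<in> hom_cells L 0 b c" and y: "y \<in> hom_cells L q c t"
  shows "cat_map (hom_to_at L t (Suc 0) \<alpha>) y = mu L q y ((idn L ^^ q) \<alpha>)"
proof -
  interpret O: strict_omega "opp L" by (rule strict_omega_opp)
  have c: "c \<in> Cell L 0" using hom_cells_target b x .
  show ?thesis using O.hom_from_at_map_cells[OF hom_to_at_hom(2)[OF t b x], of t y q] t c y
      hom_to_at_hom(1)[OF t b x] hom_cells_opp[OF c t] mu_opp[OF b y idn_pow_hom_cells[OF x, of q]]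
      idn_opp_pow[OF hom_cells_Cell[OF b x]]
    by (simp del: hom_from_at.simps hom_to_at.simps)
qed

lemma hom_to_at_map_objects:
  assumes t: "t \<in> Cell L 0" and b: "b \<in> Cell L 0" and x: "\<alpha> \<in> hom_cells L n b c" and y: "y \<in> hom_cells L 0 c t"
  shows "cat_map (hom_to_at L t (Suc n) \<alpha>) y = mu L n ((idn L ^^ n) y) \<alpha>"
proof -
  interpret O: strict_omega "opp L" by (rule strict_omega_opp)
  have c: "c \<in> Cell L 0" using hom_cells_target b x .
  show ?thesis using O.hom_from_at_map_objects[OF hom_to_at_hom(2)[OF t b x], of t y] t c y
      hom_to_at_hom(1)[OF t b x] hom_cells_opp[OF c t] mu_opp[OF b idn_pow_hom_cells[OF y, of n] x]
      idn_opp_pow[OF hom_cells_Cell[OF c y]]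
    by simp
qed

lemma hom_to_at_mu:
  assumes t: "t \<in> Cell L 0" and b: "b \<in> Cell L 0" and "\<alpha> \<in> hom_cells L n c d" "\<beta> \<in> hom_cells L n b c"
  shows "hom_to_at L t (Suc n) (mu L n \<alpha> \<beta>) =
    cat_cmp (Suc n) (hom_to_at L t (Suc n) \<beta>) (hom_to_at L t (Suc n) \<alpha>)"
proof -
  interpret O: strict_omega "opp L" by (rule strict_omega_opp)
  have c: "c \<in> Cell L 0" using hom_cells_target b assms(4) .
  have d: "d \<in> Cell L 0" using hom_cells_target c assms(3) .
  show ?thesis
    using O.hom_from_at_mu[of t d \<beta> n c b \<alpha>] t d hom_to_at_hom[OF t c assms(3)] hom_to_at_hom[OF t b assms(4)]
      hom_to_at_hom(1)[OF t b mu_cell[OF b assms(3,4)]] mu_opp[OF b assms(3,4)]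
    by simp
qed

lemma hom_to_at_cmp:
  assumes t: "t \<in> Cell L 0" and b: "b \<in> Cell L 0" and "composable (hom L b c) k n \<alpha> \<beta>"
  shows "hom_to_at L t (Suc n) (cmp L k \<alpha> \<beta>) =
    cat_cmp k (hom_to_at L t (Suc n) \<alpha>) (hom_to_at L t (Suc n) \<beta>)"
proof -
  interpret O: strict_omega "opp L" by (rule strict_omega_opp)
  have p: "\<alpha> \<in> hom_cells L n b c" "\<beta> \<in> hom_cells L n b c" "k \<le> n"
    using assms(3) by (auto simp: composable_hom_iff)
  have c: "c \<in> Cell L 0" using hom_cells_target b p(1) .
  have o: "composable (opp L) k (Suc n) \<alpha> \<beta>" using composable_of_hom[OF b assms(3)] p(3) by (simp add: composable_opp_iff)
  show ?thesis
    using O.hom_from_at_cmp[of t c b k n \<alpha> \<beta>] t c hom_opp[OF b c] assms(3) hom_to_at_hom(1)[OF t b p(1)]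
     hom_to_at_hom(1)[OF t b p(2)] hom_to_at_hom(1)[OF t b cmp_hom_cell[OF b assms(3)]] cmp_opp[OF o] p(3)
    by simp
qed

lemma hom_to_at_idn:
  assumes t: "t \<in> Cell L 0" and b: "b \<in> Cell L 0" and x: "\<alpha> \<in> hom_cells L n b c"
  shows "hom_to_at L t (Suc (Suc n)) (idn L \<alpha>) = cat_idn (hom_to_at L t (Suc n) \<alpha>)"
proof -
  interpret O: strict_omega "opp L" by (rule strict_omega_opp)
  have c: "c \<in> Cell L 0" using hom_cells_target b x .
  show ?thesis
    using O.hom_from_at_idn[of t c \<alpha> n b] t c hom_to_at_hom[OF t b x] hom_to_at_hom(1)[OF t b hom_cells_idn[OF x]]
      idn_opp[OF hom_cells_Cell[OF b x]] by simp
qed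

lemma hom_to_at_idn_pow:
  assumes t: "t \<in> Cell L 0" and b: "b \<in> Cell L 0" and x: "\<alpha> \<in> hom_cells L n b c"
  shows "hom_to_at L t (Suc (n + k)) ((idn L ^^ k) \<alpha>) = (cat_idn ^^ k) (hom_to_at L t (Suc n) \<alpha>)"
  using hom_to_at_idn[OF t b hom_cells_idn_pow[OF x]] by (induction k) simp_all

lemma hom_from_at_idn_pow:
  assumes t: "t \<in> Cell L 0" and b: "b \<in> Cell L 0" and x: "\<alpha> \<in> hom_cells L n b c"
  shows "hom_from_at L t (Suc (n + k)) ((idn L ^^ k) \<alpha>) = (cat_idn ^^ k) (hom_from_at L t (Suc n) \<alpha>)"
  using hom_from_at_idn[OF t b hom_cells_idn_pow[OF x]] by (induction k) simp_all

lemma hom_to_at_idn_object: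
  assumes t: "t \<in> Cell L 0" and b: "b \<in> Cell L 0"
  shows "hom_to_at L t (Suc 0) (idn L b) = cat_idn (hom_to_at L t 0 b)"
proof -
  interpret O: strict_omega "opp L" by (rule strict_omega_opp)
  show ?thesis using O.hom_from_at_idn_object[of t b] t b hom_to_at_opp[OF t b] hom_to_at_opp[OF t idn_cell[OF b]] idn_opp[OF b]
    by (simp del: hom_from_at.simps hom_to_at.simps)
qed

lemma hom_to_at_in_cat_Cell:
  assumes t: "t \<in> Cell L 0" and I: "\<And>b. b \<in> Cell L 0 \<Longrightarrow> inf_category (hom L b t)" and "\<alpha> \<in> Cell L n"
  shows "hom_to_at L t n \<alpha> \<in> cat_Cell n"
proof -
  interpret O: strict_omega "opp L" by (rule strict_omega_opp)
  show ?thesis using O.hom_from_at_in_cat_Cell[of t \<alpha> n] t I hom_opp[OF _ t] hom_to_at_opp[OF t assms(3)] assms(3) by simp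
qed

lemma hom_to_at_Suc_Suc: "hom_to_at L t (Suc (Suc n)) \<alpha> = CatMod (hom_to_at L t (Suc n) (dm L \<alpha>)) (hom_to_at L t (Suc n) (cd L \<alpha>))
   (cat_map (hom_to_at L t (Suc (Suc n)) \<alpha>))"
  by simp

end

section \<open>Whiskering cells by functors\<close>

text \<open>\<open>post Z K \<alpha>\<close> is \<open>\<alpha>\<close> followed by a functor \<open>K\<close> into \<open>Z\<close>, and \<open>pre W K \<alpha>\<close> is a functor \<open>K\<close> out of \<open>W\<close> followed by \<open>\<alpha>\<close>.
  They stand for composites in which an iterated identity of \<open>K\<close> occurs. Acting directly on components,
  they can be computed without following boundaries through the composites. An object is not a
  cell between categories, hence the default value there.\<close>

fun post :: "'x cells \<Rightarrow> ('x \<Rightarrow> 'x) \<Rightarrow> 'x cat_cell \<Rightarrow> 'x cat_cell" where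
  "post Z K (CatFun X Y f) = CatFun X Z (restrict (K \<circ> f) (all_cells X))"
| "post Z K (CatMod s t h) = CatMod (post Z K s) (post Z K t) (restrict (K \<circ> h) (Cell (dom_cat s) 0))"
| "post Z K (CatObj X) = undefined"

fun pre :: "'x cells \<Rightarrow> ('x \<Rightarrow> 'x) \<Rightarrow> 'x cat_cell \<Rightarrow> 'x cat_cell" where
  "pre W K (CatFun X Y f) = CatFun W Y (restrict (f \<circ> K) (all_cells W))"
| "pre W K (CatMod s t h) = CatMod (pre W K s) (pre W K t) (restrict (h \<circ> K) (Cell W 0))"
| "pre W K (CatObj X) = undefined"

lemma cat_Cell_SucE:
  assumes "x \<in> cat_Cell (Suc n)"
  obtains X Y f where "n = 0" "x = CatFun X Y f" "inf_category X" "inf_category Y" "inf_functor X Y f" "f \<in> extensional (all_cells X)"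
  | m s t h where "n = Suc m" "x = CatMod s t h" "s \<in> cat_Cell (Suc m)" "t \<in> cat_Cell (Suc m)"
     "cat_dm s = cat_dm t" "cat_cd s = cat_cd t"
     "modification m (dom_cat s) (cod_cat s)
       (cat_map ((cat_dm ^^ m) s)) (cat_map ((cat_cd ^^ m) t)) (cat_map s) (cat_map t) h"
     "h \<in> extensional (Cell (dom_cat s) 0)"
  using assms by (cases n) auto

lemma cat_deg_Cell: "x \<in> cat_Cell n \<Longrightarrow> cat_deg x = n"
proof (induction n arbitrary: x)
  case (Suc n)
  show ?case by (rule cat_Cell_SucE[OF Suc.prems]) (use Suc.IH in auto)
qed auto

lemma cat_dm_Cell: assumes "x \<in> cat_Cell (Suc n)" shows "cat_dm x \<in> cat_Cell n"
  by (rule cat_Cell_SucE[OF assms]) auto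

lemma cat_cd_Cell: assumes "x \<in> cat_Cell (Suc n)" shows "cat_cd x \<in> cat_Cell n"
  by (rule cat_Cell_SucE[OF assms]) auto

lemma dom_cod_cat_dm:
  assumes "x \<in> cat_Cell (Suc (Suc n))" shows "dom_cat (cat_dm x) = dom_cat x \<and> cod_cat (cat_dm x) = cod_cat x"
  by (rule cat_Cell_SucE[OF assms]) auto

lemma cat_parallel:
  assumes "s \<in> cat_Cell (Suc n)" "t \<in> cat_Cell (Suc n)" "cat_dm s = cat_dm t" "cat_cd s = cat_cd t"
  shows "dom_cat s = dom_cat t" "cod_cat s = cod_cat t"
proof (atomize (full), cases n)
  case 0
  then show "dom_cat s = dom_cat t \<and> cod_cat s = cod_cat t" using assms by auto
next
  case (Suc m)
  then show "dom_cat s = dom_cat t \<and> cod_cat s = cod_cat t"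
    using dom_cod_cat_dm[of s m] dom_cod_cat_dm[of t m] assms by simp
qed

lemma dom_cod_cat_cd:
  assumes "x \<in> cat_Cell (Suc (Suc n))" shows "dom_cat (cat_cd x) = dom_cat x \<and> cod_cat (cat_cd x) = cod_cat x"
proof (rule cat_Cell_SucE[OF assms])
  fix m s t h assume "x = CatMod s t h" "s \<in> cat_Cell (Suc m)" "t \<in> cat_Cell (Suc m)"
     "cat_dm s = cat_dm t" "cat_cd s = cat_cd t"
  then show ?thesis using cat_parallel[of s m t] by simp
qed simp

lemma cat_dm_pow_Cell:
  "x \<in> cat_Cell (Suc (n + k)) \<Longrightarrow> (cat_dm ^^ k) x \<in> cat_Cell (Suc n) \<and> dom_cat ((cat_dm ^^ k) x) = dom_cat x \<and> cod_cat ((cat_dm ^^ k) x) = cod_cat x"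
proof (induction k arbitrary: x)
  case (Suc k)
  then show ?case using Suc.IH[OF cat_dm_Cell[of x "Suc (n + k)"]] dom_cod_cat_dm[of x "n + k"]
    by (simp add: funpow_swap1 del: cat_Cell.simps)
qed simp

lemma cat_cd_pow_Cell:
  "x \<in> cat_Cell (Suc (n + k)) \<Longrightarrow> (cat_cd ^^ k) x \<in> cat_Cell (Suc n) \<and> dom_cat ((cat_cd ^^ k) x) = dom_cat x \<and> cod_cat ((cat_cd ^^ k) x) = cod_cat x"
proof (induction k arbitrary: x)
  case (Suc k)
  then show ?case using Suc.IH[OF cat_cd_Cell[of x "Suc (n + k)"]] dom_cod_cat_cd[of x "n + k"]
    by (simp add: funpow_swap1 del: cat_Cell.simps)
qed simp

lemma cat_Cell_1E:
  assumes "x \<in> cat_Cell (Suc 0)"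
  obtains X Y f where "x = CatFun X Y f" "inf_category X" "inf_category Y" "inf_functor X Y f" "f \<in> extensional (all_cells X)"
  using assms by auto

lemma cat_Cell_boundary:
  assumes "x \<in> cat_Cell (Suc n)"
  shows "(cat_dm ^^ Suc n) x = CatObj (dom_cat x)" "(cat_cd ^^ Suc n) x = CatObj (cod_cat x)"
  using cat_dm_pow_Cell[of x 0 n] cat_cd_pow_Cell[of x 0 n] assms by auto

lemma cat_map_inf_functor:
  assumes "x \<in> cat_Cell (Suc n)"
  shows "inf_functor (dom_cat x) (cod_cat x) (cat_map ((cat_dm ^^ n) x))"
    "inf_functor (dom_cat x) (cod_cat x) (cat_map ((cat_cd ^^ n) x))"
  using cat_dm_pow_Cell[of x 0 n] cat_cd_pow_Cell[of x 0 n] assms by auto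

lemma cat_Cell_inf_category: "x \<in> cat_Cell (Suc n) \<Longrightarrow> inf_category (dom_cat x) \<and> inf_category (cod_cat x)"
  using cat_dm_pow_Cell[of x 0 n] by auto

lemma cat_Cell_Suc_induct [consumes 1, case_names CatFun CatMod]:
  assumes "x \<in> cat_Cell (Suc n)"
    and "\<And>X Y f. \<lbrakk> inf_category X; inf_category Y; inf_functor X Y f; f \<in> extensional (all_cells X) \<rbrakk> \<Longrightarrow> P 0 (CatFun X Y f)"
    and "\<And>m s t h. \<lbrakk> s \<in> cat_Cell (Suc m); t \<in> cat_Cell (Suc m); cat_dm s = cat_dm t; cat_cd s = cat_cd t;
      dom_cat t = dom_cat s; cod_cat t = cod_cat s;
      modification m (dom_cat s) (cod_cat s)
       (cat_map ((cat_dm ^^ m) s)) (cat_map ((cat_cd ^^ m) t)) (cat_map s) (cat_map t) h;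
      h \<in> extensional (Cell (dom_cat s) 0); P m s; P m t; CatMod s t h \<in> cat_Cell (Suc (Suc m)) \<rbrakk> \<Longrightarrow> P (Suc m) (CatMod s t h)"
  shows "P n x"
  using assms(1)
proof (induction n arbitrary: x)
  case 0
  then show ?case using assms(2) by (auto elim: cat_Cell_1E)
next
  case (Suc n)
  show ?case
  proof (rule cat_Cell_SucE[OF Suc.prems])
    fix m s t h assume *: "Suc n = Suc m" "x = CatMod s t h" "s \<in> cat_Cell (Suc m)" "t \<in> cat_Cell (Suc m)"
     "cat_dm s = cat_dm t" "cat_cd s = cat_cd t"
     "modification m (dom_cat s) (cod_cat s)
       (cat_map ((cat_dm ^^ m) s)) (cat_map ((cat_cd ^^ m) t)) (cat_map s) (cat_map t) h"
     "h \<in> extensional (Cell (dom_cat s) 0)"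
    show "P (Suc n) x" unfolding *(1,2)
      using Suc.prems *(1,2) cat_parallel[OF *(3-6)] by (intro assms(3) *(3-8) Suc.IH[unfolded nat.inject[THEN iffD1, OF *(1)]]) simp_all
  qed simp
qed

lemma cat_pre_props:
  assumes "x \<in> cat_Cell (Suc n)"
  shows "dom_cat (pre W K x) = W" "cod_cat (pre W K x) = cod_cat x" "cat_deg (pre W K x) = Suc n"
  using assms by (induction rule: cat_Cell_Suc_induct) auto

lemma cat_post_props:
  assumes "x \<in> cat_Cell (Suc n)"
  shows "dom_cat (post Z K x) = dom_cat x" "cod_cat (post Z K x) = Z" "cat_deg (post Z K x) = Suc n"
  using assms by (induction rule: cat_Cell_Suc_induct) auto

lemma cat_Cell_Suc_Suc_eq:
  assumes "x \<in> cat_Cell (Suc (Suc n))"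
  shows "x = CatMod (cat_dm x) (cat_cd x) (cat_map x)" "cat_dm x \<in> cat_Cell (Suc n)" "cat_cd x \<in> cat_Cell (Suc n)"
    "dom_cat (cat_dm x) = dom_cat x" "cod_cat (cat_dm x) = cod_cat x" "cat_map x \<in> extensional (Cell (dom_cat x) 0)"
    "dom_cat (cat_cd x) = dom_cat x" "cod_cat (cat_cd x) = cod_cat x" "cat_deg (cat_dm x) = Suc n"
proof -
  show "x = CatMod (cat_dm x) (cat_cd x) (cat_map x)" "cat_map x \<in> extensional (Cell (dom_cat x) 0)"
    by (rule cat_Cell_SucE[OF assms]; simp)+
  show "cat_dm x \<in> cat_Cell (Suc n)" "cat_cd x \<in> cat_Cell (Suc n)" using cat_dm_Cell cat_cd_Cell assms by blast+
  then show "cat_deg (cat_dm x) = Suc n" using cat_deg_Cell by blast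
qed (use dom_cod_cat_dm[OF assms] dom_cod_cat_cd[OF assms] in auto)

lemma cat_cd_pow_pre: "x \<in> cat_Cell (Suc (n + k)) \<Longrightarrow> (cat_cd ^^ k) (pre W K x) = pre W K ((cat_cd ^^ k) x)"
proof (induction k arbitrary: x)
  case (Suc k)
  have x: "x \<in> cat_Cell (Suc (Suc (n + k)))" using Suc.prems by simp
  have "cat_cd (pre W K x) = pre W K (cat_cd x)" by (subst cat_Cell_Suc_Suc_eq(1)[OF x]) simp
  then show ?case using Suc.IH[OF cat_cd_Cell[OF x]] by (simp add: funpow_swap1)
qed simp

lemma cat_dm_pow_post: "x \<in> cat_Cell (Suc (n + k)) \<Longrightarrow> (cat_dm ^^ k) (post W K x) = post W K ((cat_dm ^^ k) x)"
proof (induction k arbitrary: x)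
  case (Suc k)
  have x: "x \<in> cat_Cell (Suc (Suc (n + k)))" using Suc.prems by simp
  have "cat_dm (post W K x) = post W K (cat_dm x)" by (subst cat_Cell_Suc_Suc_eq(1)[OF x]) simp
  then show ?case using Suc.IH[OF cat_dm_Cell[OF x]] by (simp add: funpow_swap1)
qed simp

lemma cat_cd_pow_post: "x \<in> cat_Cell (Suc (n + k)) \<Longrightarrow> (cat_cd ^^ k) (post W K x) = post W K ((cat_cd ^^ k) x)"
proof (induction k arbitrary: x)
  case (Suc k)
  have x: "x \<in> cat_Cell (Suc (Suc (n + k)))" using Suc.prems by simp
  have "cat_cd (post W K x) = post W K (cat_cd x)" by (subst cat_Cell_Suc_Suc_eq(1)[OF x]) simp
  then show ?case using Suc.IH[OF cat_cd_Cell[OF x]] by (simp add: funpow_swap1)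
qed simp

lemma cat_map_pre:
  assumes "x \<in> cat_Cell (Suc n)" "a \<in> Cell W 0" shows "cat_map (pre W K x) a = cat_map x (K a)"
  by (rule cat_Cell_SucE[OF assms(1)]) (use assms(2) in \<open>auto simp: all_cells_def\<close>)

lemma cat_map_post:
  assumes "x \<in> cat_Cell (Suc n)" "a \<in> Cell (dom_cat x) 0" shows "cat_map (post Z K x) a = K (cat_map x a)"
  by (rule cat_Cell_SucE[OF assms(1)]) (use assms(2) in \<open>auto simp: all_cells_def\<close>)

text \<open>The two branches in the component map of a composite, separated.\<close>

lemma cat_cmp_horizontal:
  "cat_deg s = Suc m \<Longrightarrow> cat_cmp (Suc (Suc m)) (CatMod s t h) (CatMod s' t' h') =
    CatMod (cat_cmp (Suc m) s s') (cat_cmp (Suc m) t t')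
     (\<lambda>a\<in>Cell (dom_cat s') 0. cmp (cod_cat s) (Suc m) (h (cat_map ((cat_cd ^^ Suc m) (CatMod s' t' h')) a))
        (cat_map ((cat_dm ^^ Suc m) (CatMod s t h)) (h' a)))"
  by (simp add: Let_def fun_eq_iff)

lemma cat_cmp_vertical:
  "k \<le> cat_deg s \<Longrightarrow> cat_cmp k (CatMod s t h) (CatMod s' t' h') =
    CatMod (if k = 1 then s' else cat_cmp (k - 1) s s') (if k = 1 then t else cat_cmp (k - 1) t t')
     (\<lambda>a\<in>Cell (dom_cat s') 0. cmp (cod_cat s) k (h a) (h' a))"
  by (simp add: fun_eq_iff)

definition graded :: "'a cells \<Rightarrow> 'b cells \<Rightarrow> ('a \<Rightarrow> 'b) \<Rightarrow> bool" where
  "graded W X K \<longleftrightarrow> (\<forall>n. \<forall>x \<in> Cell W n. K x \<in> Cell X n)"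

lemma graded_all_cells: "graded W X K \<Longrightarrow> x \<in> all_cells W \<Longrightarrow> K x \<in> all_cells X"
  unfolding graded_def all_cells_def by blast

lemma inf_functor_graded: "inf_functor W X K \<Longrightarrow> graded W X K"
  unfolding inf_functor_def graded_def by blast

text \<open>Whiskering on the right commutes with horizontal composition, because the component of the composite
  at \<open>a\<close> depends on the inner cell only through its values at \<open>a\<close>.\<close>

lemma cat_cmp_pre:
  assumes "\<alpha> \<in> cat_Cell (Suc n)" "\<beta> \<in> cat_Cell (Suc n)" "graded W (dom_cat \<beta>) K"
  shows "cat_cmp (Suc n) \<alpha> (pre W K \<beta>) = pre W K (cat_cmp (Suc n) \<alpha> \<beta>)"
  using assms
proof (induction n arbitrary: \<alpha> \<beta>)
  case 0
  then obtain X Y f Y' Z g where "\<beta> = CatFun X Y f" "\<alpha> = CatFun Y' Z g" by (auto elim!: cat_Cell_1E)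
  then show ?case using graded_all_cells[of W X K] 0(3) by (auto simp: fun_eq_iff)
next
  case (Suc m)
  note a = cat_Cell_Suc_Suc_eq[OF Suc.prems(1)] and b = cat_Cell_Suc_Suc_eq[OF Suc.prems(2)]
  obtain s t h where A: "\<alpha> = CatMod s t h" using a(1) by metis
  obtain s' t' h' where B: "\<beta> = CatMod s' t' h'" using b(1) by metis
  have p: "s \<in> cat_Cell (Suc m)" "t \<in> cat_Cell (Suc m)" "s' \<in> cat_Cell (Suc m)" "t' \<in> cat_Cell (Suc m)"
    "cat_deg s = Suc m" "dom_cat t' = dom_cat s'" "dom_cat s' = dom_cat \<beta>" using a b A B by auto
  have K: "K x \<in> Cell (dom_cat s') 0" if "x \<in> Cell W 0" for x using Suc.prems(3) that p unfolding graded_def by auto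
  have "cat_map ((cat_cd ^^ Suc m) (pre W K \<beta>)) x = cat_map ((cat_cd ^^ Suc m) \<beta>) (K x)" if "x \<in> Cell W 0" for x
    using cat_cd_pow_pre[of \<beta> 0 "Suc m"] cat_cd_pow_Cell[of \<beta> 0 "Suc m"] cat_map_pre[OF _ that, of _ 0 K] Suc.prems(2) by (simp del: funpow.simps cat_Cell.simps)
  then have 1: "cat_map ((cat_cd ^^ Suc m) (CatMod (pre W K s') (pre W K t') (restrict (h' \<circ> K) (Cell W 0)))) x =
      cat_map ((cat_cd ^^ Suc m) (CatMod s' t' h')) (K x)" if "x \<in> Cell W 0" for x
    using that by (simp add: B del: funpow.simps)
  show ?case unfolding A B pre.simps cat_cmp_horizontal[OF p(5)] cat_pre_props[OF p(3)]
    using Suc.IH[OF p(1,3)] Suc.IH[OF p(2,4)] Suc.prems(3) p K 1 by (auto simp: fun_eq_iff simp del: funpow.simps)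
qed

lemma cat_cmp_pre_pre:
  assumes "\<alpha> \<in> cat_Cell (Suc n)" "\<beta> \<in> cat_Cell (Suc n)" "dom_cat \<alpha> = dom_cat \<beta>" "graded W (dom_cat \<beta>) K" "1 \<le> k" "k \<le> n"
  shows "cat_cmp k (pre W K \<alpha>) (pre W K \<beta>) = pre W K (cat_cmp k \<alpha> \<beta>)"
  using assms
proof (induction n arbitrary: k \<alpha> \<beta>)
  case (Suc m)
  note a = cat_Cell_Suc_Suc_eq[OF Suc.prems(1)] and b = cat_Cell_Suc_Suc_eq[OF Suc.prems(2)]
  obtain s t h where A: "\<alpha> = CatMod s t h" using a(1) by metis
  obtain s' t' h' where B: "\<beta> = CatMod s' t' h'" using b(1) by metis
  have p: "s \<in> cat_Cell (Suc m)" "t \<in> cat_Cell (Suc m)" "s' \<in> cat_Cell (Suc m)" "t' \<in> cat_Cell (Suc m)"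
    "cat_deg s = Suc m" "dom_cat t' = dom_cat s'" "dom_cat s' = dom_cat \<beta>" "dom_cat s = dom_cat \<alpha>" "dom_cat t = dom_cat s" using a b A B by auto
  have K: "K x \<in> Cell (dom_cat s') 0" if "x \<in> Cell W 0" for x using Suc.prems(4) that p unfolding graded_def by auto
  have q: "cat_deg (pre W K s) = Suc m" using cat_pre_props[OF p(1)] by simp
  have k: "k \<le> cat_deg s" "k \<le> cat_deg (pre W K s)" using Suc.prems p q by simp_all
  have "k = 1 \<or> 1 \<le> k - 1 \<and> k - 1 \<le> m" using Suc.prems by auto
  then show ?case unfolding A B pre.simps cat_cmp_vertical[OF k(1)] cat_cmp_vertical[OF k(2)]
    using Suc.IH[OF p(1,3), of "k - 1"] Suc.IH[OF p(2,4), of "k - 1"] Suc.prems(3,4) p K cat_pre_props[OF p(3)] cat_pre_props[OF p(1)]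
    by (auto simp: fun_eq_iff)
qed simp

lemma cat_idn_pre:
  assumes "\<alpha> \<in> cat_Cell (Suc n)" "graded W (dom_cat \<alpha>) K"
  shows "cat_idn (pre W K \<alpha>) = pre W K (cat_idn \<alpha>)"
proof -
  have K: "K x \<in> Cell (dom_cat \<alpha>) 0" if "x \<in> Cell W 0" for x using assms(2) that unfolding graded_def by auto
  show ?thesis using cat_pre_props[OF assms(1)] cat_deg_Cell[OF assms(1)] cat_map_pre[OF assms(1), of _ W K] K
    by (auto simp: cat_idn_pos fun_eq_iff)
qed

lemma cat_idn_pow_dom_cod_deg:
  "cat_deg x \<noteq> 0 \<Longrightarrow> dom_cat ((cat_idn ^^ k) x) = dom_cat x \<and> cod_cat ((cat_idn ^^ k) x) = cod_cat x \<and> cat_deg ((cat_idn ^^ k) x) = cat_deg x + k"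
  by (induction k) (auto simp: cat_idn_pos)

lemma pre_post:
  assumes "\<alpha> \<in> cat_Cell (Suc n)" "graded W (dom_cat \<alpha>) K"
  shows "pre W K (post Z H \<alpha>) = post Z H (pre W K \<alpha>)"
  using assms
proof (induction rule: cat_Cell_Suc_induct)
  case (CatFun X Y f)
  then show ?case using graded_all_cells[of W X K] by (auto simp: fun_eq_iff)
next
  case (CatMod m s t h)
  then show ?case using cat_pre_props[OF CatMod(1)] by (auto simp: fun_eq_iff graded_def)
qed

lemma pre_pre:
  assumes "\<alpha> \<in> cat_Cell (Suc n)" "graded W X H"
  shows "pre W H (pre X K \<alpha>) = pre W (K \<circ> H) \<alpha>"
  using assms
proof (induction rule: cat_Cell_Suc_induct)
  case (CatFun X' Y f)
  then show ?case using graded_all_cells[of W X H] by (auto simp: fun_eq_iff)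
next
  case (CatMod m s t h)
  then show ?case by (auto simp: fun_eq_iff graded_def)
qed

lemma pre_cong:
  assumes "\<alpha> \<in> cat_Cell (Suc n)" "\<And>x. x \<in> all_cells W \<Longrightarrow> K x = H x"
  shows "pre W K \<alpha> = pre W H \<alpha>"
  using assms
proof (induction rule: cat_Cell_Suc_induct)
  case (CatMod m s t h)
  moreover have "K x = H x" if "x \<in> Cell W 0" for x using CatMod that by (auto simp: all_cells_def)
  ultimately show ?case by (auto simp: fun_eq_iff)
qed (auto simp: fun_eq_iff)

lemma post_post:
  assumes "\<alpha> \<in> cat_Cell (Suc n)"
  shows "post Z K (post Y H \<alpha>) = post Z (K \<circ> H) \<alpha>"
  using assms
proof (induction rule: cat_Cell_Suc_induct)
  case (CatMod m s t h)
  then show ?case using cat_post_props[OF CatMod(1)] by (auto simp: fun_eq_iff)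
qed (auto simp: fun_eq_iff)

lemma (in inf_category) modification_cells:
  assumes "modification n X L F G p q h" "inf_functor X L F" "a \<in> Cell X 0"
  shows "h a \<in> hom_cells L n (F a) (G a)" "h a \<in> Cell L (Suc n)" "(dm L ^^ Suc n) (h a) = F a" "(cd L ^^ Suc n) (h a) = G a" "F a \<in> Cell L 0" "G a \<in> Cell L 0"
proof -
  interpret globular L by (rule globular)
  have F: "F a \<in> Cell L 0" using assms by (auto simp: inf_functor_def)
  have h: "h a \<in> hom_cells L n (F a) (G a)" using assms by (auto simp: modification_def)
  show "h a \<in> hom_cells L n (F a) (G a)" "h a \<in> Cell L (Suc n)" "(dm L ^^ Suc n) (h a) = F a" "(cd L ^^ Suc n) (h a) = G a" "F a \<in> Cell L 0" "G a \<in> Cell L 0"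
    using h F hom_cells_iff[OF F] hom_cells_target[OF F h] by auto
qed

text \<open>All degrees at once: a component of a functor (\<open>n = 0\<close>) is its value at an object, and the \<open>n\<close>-fold source
  and target of a component of a modification are the values of the functors that it ultimately goes between.\<close>

lemma cat_Cell_component:
  assumes "x \<in> cat_Cell (Suc n)" "a \<in> Cell (dom_cat x) 0"
  shows "cat_map x a \<in> Cell (cod_cat x) n"
    "(cd (cod_cat x) ^^ n) (cat_map x a) = cat_map ((cat_cd ^^ n) x) a"
    "(dm (cod_cat x) ^^ n) (cat_map x a) = cat_map ((cat_dm ^^ n) x) a"
    "cat_map ((cat_cd ^^ n) x) a \<in> Cell (cod_cat x) 0"
    "cat_map ((cat_dm ^^ n) x) a \<in> Cell (cod_cat x) 0"
proof -
  have "cat_map x a \<in> Cell (cod_cat x) n \<and>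
    (cd (cod_cat x) ^^ n) (cat_map x a) = cat_map ((cat_cd ^^ n) x) a \<and>
    (dm (cod_cat x) ^^ n) (cat_map x a) = cat_map ((cat_dm ^^ n) x) a \<and>
    cat_map ((cat_cd ^^ n) x) a \<in> Cell (cod_cat x) 0 \<and>
    cat_map ((cat_dm ^^ n) x) a \<in> Cell (cod_cat x) 0"
  proof (rule cat_Cell_SucE[OF assms(1)])
    fix X Y f assume *: "n = 0" "x = CatFun X Y f" "inf_functor X Y f"
    then have "f a \<in> Cell Y 0" using assms(2) by (auto simp: inf_functor_def)
    then show ?thesis using * by simp
  next
    fix m s t h assume *: "n = Suc m" "x = CatMod s t h" "s \<in> cat_Cell (Suc m)" "t \<in> cat_Cell (Suc m)"
     "cat_dm s = cat_dm t" "cat_cd s = cat_cd t"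
     "modification m (dom_cat s) (cod_cat s)
       (cat_map ((cat_dm ^^ m) s)) (cat_map ((cat_cd ^^ m) t)) (cat_map s) (cat_map t) h"
    interpret inf_category "cod_cat s" using cat_Cell_inf_category[OF *(3)] by simp
    have a: "a \<in> Cell (dom_cat s) 0" using assms(2) * by simp
    have xx: "cod_cat x = cod_cat s" using * by simp
    have pw: "(cat_cd ^^ n) x = (cat_cd ^^ m) t" "(cat_dm ^^ n) x = (cat_dm ^^ m) s" using * by (simp_all add: funpow_swap1)
    show ?thesis unfolding pw xx using modification_cells[OF *(7) cat_map_inf_functor(1)[OF *(3)] a] *(1,2) by (simp del: funpow.simps)
  qed
  then show "cat_map x a \<in> Cell (cod_cat x) n"
    "(cd (cod_cat x) ^^ n) (cat_map x a) = cat_map ((cat_cd ^^ n) x) a"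
    "(dm (cod_cat x) ^^ n) (cat_map x a) = cat_map ((cat_dm ^^ n) x) a"
    "cat_map ((cat_cd ^^ n) x) a \<in> Cell (cod_cat x) 0"
    "cat_map ((cat_dm ^^ n) x) a \<in> Cell (cod_cat x) 0" by blast+
qed

lemma post_cong:
  assumes "\<alpha> \<in> cat_Cell (Suc n)" "\<And>x. x \<in> all_cells (cod_cat \<alpha>) \<Longrightarrow> K x = H x"
  shows "post Z K \<alpha> = post Z H \<alpha>"
  using assms
proof (induction rule: cat_Cell_Suc_induct)
  case (CatFun X Y f)
  then show ?case using graded_all_cells[OF inf_functor_graded[OF CatFun(3)]] by (auto simp: fun_eq_iff)
next
  case (CatMod m s t h)
  have "K (h x) = H (h x)" if "x \<in> Cell (dom_cat s) 0" for x
    using cat_Cell_component(1)[OF CatMod(9), of x] that CatMod(12) by (auto simp: all_cells_def)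
  then show ?case using CatMod by (auto simp: fun_eq_iff)
qed

lemma cat_idn_pow_CatFun:
  "cat_deg ((cat_idn ^^ k) (CatFun X Y f)) = Suc k" "dom_cat ((cat_idn ^^ k) (CatFun X Y f)) = X"
  "cod_cat ((cat_idn ^^ k) (CatFun X Y f)) = Y"
  "(cat_idn ^^ Suc k) (CatFun X Y f) = CatMod ((cat_idn ^^ k) (CatFun X Y f)) ((cat_idn ^^ k) (CatFun X Y f))
     (cat_map ((cat_idn ^^ Suc k) (CatFun X Y f)))"
  "a \<in> Cell X 0 \<Longrightarrow> cat_map ((cat_idn ^^ k) (CatFun X Y f)) a = (idn Y ^^ k) (f a)"
  "(cat_dm ^^ k) ((cat_idn ^^ k) (CatFun X Y f)) = CatFun X Y f"
  "(cat_cd ^^ k) ((cat_idn ^^ k) (CatFun X Y f)) = CatFun X Y f"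
proof -
  have *: "cat_deg ((cat_idn ^^ k) (CatFun X Y f)) = Suc k \<and> dom_cat ((cat_idn ^^ k) (CatFun X Y f)) = X \<and>
  cod_cat ((cat_idn ^^ k) (CatFun X Y f)) = Y" for k using cat_idn_pow_dom_cod_deg[of "CatFun X Y f" k] by simp
  then show 1: "cat_deg ((cat_idn ^^ k) (CatFun X Y f)) = Suc k" "dom_cat ((cat_idn ^^ k) (CatFun X Y f)) = X"
    "cod_cat ((cat_idn ^^ k) (CatFun X Y f)) = Y" by auto
  show "(cat_idn ^^ Suc k) (CatFun X Y f) = CatMod ((cat_idn ^^ k) (CatFun X Y f)) ((cat_idn ^^ k) (CatFun X Y f))
     (cat_map ((cat_idn ^^ Suc k) (CatFun X Y f)))" using 1 by (simp add: cat_idn_pos)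
  show "a \<in> Cell X 0 \<Longrightarrow> cat_map ((cat_idn ^^ k) (CatFun X Y f)) a = (idn Y ^^ k) (f a)"
    using * by (induction k) (auto simp: cat_idn_pos)
  show "(cat_dm ^^ k) ((cat_idn ^^ k) (CatFun X Y f)) = CatFun X Y f" "(cat_cd ^^ k) ((cat_idn ^^ k) (CatFun X Y f)) = CatFun X Y f"
    using * by (induction k) (auto simp: cat_idn_pos funpow_swap1[of cat_dm] funpow_swap1[of cat_cd])
qed

lemma (in globular) inf_functor_pow:
  assumes "inf_functor L M K" "x \<in> Cell L (n + k)"
  shows "K ((dm L ^^ k) x) = (dm M ^^ k) (K x)" "K ((cd L ^^ k) x) = (cd M ^^ k) (K x)"
proof -
  have "K ((dm L ^^ k) x) = (dm M ^^ k) (K x) \<and> K ((cd L ^^ k) x) = (cd M ^^ k) (K x)"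
    using assms(2)
  proof (induction k arbitrary: n)
    case (Suc k)
    have x: "x \<in> Cell L (Suc n + k)" using Suc.prems by simp
    then show ?case using Suc.IH[OF x] dm_pow_cell[OF x] cd_pow_cell[OF x] assms(1) by (simp add: inf_functor_def)
  qed simp
  then show "K ((dm L ^^ k) x) = (dm M ^^ k) (K x)" "K ((cd L ^^ k) x) = (cd M ^^ k) (K x)" by blast+
qed

text \<open>The component at \<open>a\<close> of the composite is \<open>e\<^sup>nc\<^sup>n(K (h a)) \<circ>\<^sub>n K (h a)\<close>, hence \<open>K (h a)\<close> by the strict unit law of \<open>Z\<close>.
  So composing with \<open>K\<close> is exact even if \<open>K\<close> preserves identities and composites only up to equivalence.\<close>

lemma cat_cmp_idn_pow_left:
  assumes "\<alpha> \<in> cat_Cell (Suc n)" "cod_cat \<alpha> = Y" "strict_omega Z" "inf_functor Y Z K"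
  shows "cat_cmp (Suc n) ((cat_idn ^^ n) (CatFun Y Z K)) \<alpha> = post Z K \<alpha>"
  using assms(1,2)
proof (induction rule: cat_Cell_Suc_induct)
  case (CatFun X Y' f)
  then show ?case by simp
next
  case (CatMod m s t h)
  interpret Z: strict_omega Z by fact
  let ?e = "\<lambda>k. (cat_idn ^^ k) (CatFun Y Z K)"
  let ?x = "CatMod s t h"
  have cY: "cod_cat s = Y" "cod_cat t = Y" using CatMod by simp_all
  interpret Y: inf_category Y using cat_Cell_inf_category[OF CatMod(1)] cY by simp
  interpret Y: globular Y by (rule Y.globular)
  have "cmp Z (Suc m) (cat_map (?e (Suc m)) (cat_map ((cat_cd ^^ Suc m) ?x) a)) (K (h a)) = K (h a)"
    if "a \<in> Cell (dom_cat s) 0" for a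
  proof -
    have a: "a \<in> Cell (dom_cat ?x) 0" using that by simp
    note c = cat_Cell_component[OF CatMod(9) a]
    have h: "h a \<in> Cell Y (0 + Suc m)" using c(1) cY by simp
    have g: "cat_map ((cat_cd ^^ Suc m) ?x) a \<in> Cell Y 0" using c(4) cY by (simp del: funpow.simps)
    have "(cd Z ^^ Suc m) (K (h a)) = K (cat_map ((cat_cd ^^ Suc m) ?x) a)"
      using Y.inf_functor_pow(2)[OF assms(4) h] c(2) cY by (simp del: funpow.simps)
    moreover have "K (h a) \<in> Cell Z (Suc m)" using assms(4) h by (simp add: inf_functor_def)
    ultimately show ?thesis using Z.unit_left[of "K (h a)" "Suc m" "Suc m"] cat_idn_pow_CatFun(5)[OF g, of "Suc m" Z K]
      by (simp del: funpow.simps)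
  qed
  moreover have "(cat_dm ^^ Suc m) (CatMod (?e m) (?e m) (cat_map (?e (Suc m)))) = CatFun Y Z K"
    by (subst cat_idn_pow_CatFun(4)[symmetric]) (rule cat_idn_pow_CatFun(6))
  ultimately show ?case
    apply (subst cat_idn_pow_CatFun(4))
    unfolding cat_cmp_horizontal[OF cat_idn_pow_CatFun(1)]
    using CatMod(10,11) cY by (auto simp: fun_eq_iff cat_idn_pow_CatFun(2,3) simp del: funpow.simps)
qed

text \<open>On this side the functor under the modification is applied to an iterated identity, so it has to
  preserve identities strictly; \<open>L(a,-)\<close> does, whereas \<open>K\<close> only has to preserve degrees.\<close>

lemma (in strict_omega) cat_cmp_idn_pow_right:
  assumes a: "a \<in> Cell L 0" and b: "b \<in> Cell L 0" and "\<alpha> \<in> hom_cells L n b c"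
    and K: "graded W (hom L a b) K"
  shows "cat_cmp (Suc n) (hom_from_at L a (Suc n) \<alpha>) ((cat_idn ^^ n) (CatFun W (hom L a b) K)) =
    pre W K (hom_from_at L a (Suc n) \<alpha>)"
  using assms(3)
proof (induction n arbitrary: \<alpha>)
  case 0
  then show ?case by simp
next
  case (Suc m)
  let ?N = "Suc m"
  let ?e = "\<lambda>k. (cat_idn ^^ k) (CatFun W (hom L a b) K)"
  note F = hom_from_at_Suc_Suc[OF Suc.prems a b]
  have d0: "(dm L ^^ ?N) \<alpha> \<in> hom_cells L 0 b c" using hom_cells_dm_pow[of \<alpha> 0 ?N] Suc.prems by simp
  have "cmp (hom L a c) ?N (cat_map (hom_from_at L a (Suc ?N) \<alpha>) (K w)) (cat_map (hom_from_at L a (Suc 0) ((dm L ^^ ?N) \<alpha>)) ((idn (hom L a b) ^^ ?N) (K w)))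
    = cat_map (hom_from_at L a (Suc ?N) \<alpha>) (K w)" if w: "w \<in> Cell W 0" for w
  proof -
    have k: "K w \<in> hom_cells L 0 a b" using K w by (auto simp: graded_def)
    have kc: "K w \<in> Cell L (Suc 0)" using hom_cells_Cell[OF a k] .
    note ke = idn_pow_hom_cells[OF k, of ?N]
    note i = idn_hom_pow[OF k, of ?N]
    have N: "1 \<le> ?N" by simp
    note w = whisker_interchange(1,2)[OF a Suc.prems ke N, unfolded cd_pow_idn_pow[OF kc]]
    show ?thesis unfolding i hom_from_at_map_objects[OF Suc.prems a b k] hom_from_at_map_cells[OF d0 a b ke]
      using w(1) cmp_hom[OF w(2)] by simp
  qed
  moreover have "(cat_cd ^^ ?N) (CatMod (?e m) (?e m) (cat_map (?e ?N))) = CatFun W (hom L a b) K"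
    by (subst cat_idn_pow_CatFun(4)[symmetric]) (rule cat_idn_pow_CatFun(7))
  moreover have "(cat_dm ^^ ?N) (hom_from_at L a (Suc ?N) \<alpha>) = hom_from_at L a (Suc 0) ((dm L ^^ ?N) \<alpha>)"
    using cat_dm_pow_hom_from_at[of ?N a "Suc 0" \<alpha>] by simp
  ultimately have "(\<lambda>w\<in>Cell W 0. cmp (hom L a c) ?N (cat_map (hom_from_at L a (Suc ?N) \<alpha>) (cat_map ((cat_cd ^^ ?N) (CatMod (?e m) (?e m) (cat_map (?e ?N)))) w))
     (cat_map ((cat_dm ^^ ?N) (hom_from_at L a (Suc ?N) \<alpha>)) (cat_map (?e ?N) w))) =
    restrict (cat_map (hom_from_at L a (Suc ?N) \<alpha>) \<circ> K) (Cell W 0)"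
    by (auto simp: fun_eq_iff cat_idn_pow_CatFun(5) simp del: funpow.simps hom_from_at.simps)
  moreover have "cod_cat (hom_from_at L a ?N (dm L \<alpha>)) = hom L a c" using hom_from_at_dom_cod[OF hom_cells_dm[OF Suc.prems] b] by simp
  ultimately show ?case
    apply (subst cat_idn_pow_CatFun(4))
    using Suc.IH[OF hom_cells_dm[OF Suc.prems]] Suc.IH[OF hom_cells_cd[OF Suc.prems]]
    unfolding F cat_cmp_horizontal[OF cat_deg_hom_from_at] pre.simps cat_map.simps cat_idn_pow_CatFun(2)
    by (simp del: funpow.simps hom_from_at.simps)
qed

lemma (in strict_omega) cat_cmp_idn_pow_right_to:
  assumes t: "t \<in> Cell L 0" and b: "b \<in> Cell L 0" and x: "\<alpha> \<in> hom_cells L n b c"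
    and K: "graded W (hom L c t) K"
  shows "cat_cmp (Suc n) (hom_to_at L t (Suc n) \<alpha>) ((cat_idn ^^ n) (CatFun W (hom L c t) K)) =
    pre W K (hom_to_at L t (Suc n) \<alpha>)"
proof -
  interpret O: strict_omega "opp L" by (rule strict_omega_opp)
  have c: "c \<in> Cell L 0" using hom_cells_target b x .
  show ?thesis using O.cat_cmp_idn_pow_right[of t c \<alpha> n b W K] t c hom_to_at_hom[OF t b x] hom_opp[OF c t] K
    by (simp del: hom_from_at.simps hom_to_at.simps)
qed

section \<open>Strict functors, modifications and equivalence\<close>

lemma inf_functorD:
  assumes "inf_functor L M F"
  shows "x \<in> Cell L n \<Longrightarrow> F x \<in> Cell M n"
    and "x \<in> Cell L (Suc n) \<Longrightarrow> F (dm L x) = dm M (F x)"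
    and "x \<in> Cell L (Suc n) \<Longrightarrow> F (cd L x) = cd M (F x)"
    and "x \<in> Cell L n \<Longrightarrow> eqv M (F (idn L x)) (idn M (F x))"
    and "composable L k n x y \<Longrightarrow> eqv M (F (cmp L k x y)) (cmp M k (F x) (F y))"
  using assms unfolding inf_functor_def by blast+

lemma (in globular) hom_cells_map:
  assumes "inf_functor L M F" "f \<in> hom_cells L n a b"
  shows "F f \<in> hom_cells M n (F a) (F b)"
proof -
  obtain m where m: "a \<in> Cell L m" "b \<in> Cell L m" "f \<in> Cell L (m + Suc n)" "(dm L ^^ Suc n) f = a" "(cd L ^^ Suc n) f = b"
    using assms(2) unfolding hom_cells_def by auto
  have "F a \<in> Cell M m" "F b \<in> Cell M m" "F f \<in> Cell M (m + Suc n)" "(dm M ^^ Suc n) (F f) = F a" "(cd M ^^ Suc n) (F f) = F b"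
    using inf_functor_pow[OF assms(1) m(3)] inf_functorD(1)[OF assms(1) m(1)] inf_functorD(1)[OF assms(1) m(2)]
      inf_functorD(1)[OF assms(1) m(3)] m(4,5) by simp_all
  then show ?thesis unfolding hom_cells_def by (auto simp del: funpow.simps)
qed

lemma (in globular) composable_map:
  assumes "inf_functor L M F" "composable L k n f g"
  shows "composable M k n (F f) (F g)"
proof -
  have k: "f \<in> Cell L n" "g \<in> Cell L n" "1 \<le> k" "k \<le> n" "(dm L ^^ k) f = (cd L ^^ k) g"
    using assms(2) by (auto simp: composable_def)
  have "f \<in> Cell L ((n - k) + k)" "g \<in> Cell L ((n - k) + k)" using k by simp_all
  then have "(dm M ^^ k) (F f) = (cd M ^^ k) (F g)" using inf_functor_pow[OF assms(1)] k(5) by metis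
  then show ?thesis using k assms(1) by (simp add: composable_def inf_functor_def)
qed

text \<open>The image of an equivalence consists of the images of its witnesses.\<close>

lemma (in strict_omega) strict_functor_eqv:
  assumes F: "strict_functor L M F" and M: "strict_omega M" and "eqv L x y"
  shows "eqv M (F x) (F y)"
  using assms(3)
proof (coinduction arbitrary: x y)
  case eqv
  have F': "inf_functor L M F" using strict_functor_inf_functor[OF F strict_omega_axioms M] .
  from eqv obtain n f g where *: "x \<in> Cell L n" "y \<in> Cell L n" "f \<in> hom_cells L 0 x y" "g \<in> hom_cells L 0 y x"
    "eqv L (idn L x) (cmp L 1 g f)" "eqv L (cmp L 1 f g) (idn L y)" by (auto elim: eqv.cases)
  have c: "composable L 1 (Suc n) g f" "composable L 1 (Suc n) f g"
    using hom_cells_composable[OF *(4,3,2)] hom_cells_composable[OF *(3,4,1)] by simp_all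
  have e: "F (idn L x) = idn M (F x)" "F (idn L y) = idn M (F y)" "F (cmp L 1 g f) = cmp M 1 (F g) (F f)"
    "F (cmp L 1 f g) = cmp M 1 (F f) (F g)" "F x \<in> Cell M n" "F y \<in> Cell M n"
    using F * c unfolding strict_functor_def by blast+
  show ?case
    apply (rule exI[of _ "F x"], rule exI[of _ n], rule exI[of _ "F y"], rule exI[of _ "F f"], rule exI[of _ "F g"])
    using e hom_cells_map[OF F' *(3)] hom_cells_map[OF F' *(4)] *(5,6) by metis
qed

lemma (in globular) inf_functor_cong:
  assumes "inf_functor L M F" "\<And>x. x \<in> all_cells L \<Longrightarrow> F x = G x"
    and "\<And>k n f g. composable L k n f g \<Longrightarrow> cmp L k f g \<in> Cell L n"
  shows "inf_functor L M G"
proof -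
  have e: "x \<in> Cell L n \<Longrightarrow> F x = G x" for x n using assms(2) by (auto simp: all_cells_def)
  show ?thesis unfolding inf_functor_def
  proof (intro conjI allI ballI impI)
    fix k n x y assume c: "composable L k n x y"
    then have "x \<in> Cell L n" "y \<in> Cell L n" by (auto simp: composable_def)
    then show "eqv M (G (cmp L k x y)) (cmp M k (G x) (G y))"
      using inf_functorD(5)[OF assms(1) c] e[OF assms(3)[OF c]] e[of x n] e[of y n] by simp
  next
    fix n x assume x: "x \<in> Cell L n"
    show "G x \<in> Cell M n" "eqv M (G (idn L x)) (idn M (G x))"
      using inf_functorD(1,4)[OF assms(1) x] e[OF x] e[OF idn_cell[OF x]] by simp_all
  next
    fix n x assume x: "x \<in> Cell L (Suc n)"
    then show "G (dm L x) = dm M (G x)" "G (cd L x) = cd M (G x)"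
      using inf_functorD(2,3)[OF assms(1) x] e[OF x] e[OF dm_cell[OF x]] e[OF cd_cell[OF x]] by simp_all
  qed
qed

text \<open>A strict functor maps the two sides of the naturality condition of \<open>\<alpha>\<close> to those of the whiskered cell, and it
  preserves equivalences.\<close>

lemma post_in_cat_Cell:
  assumes "\<alpha> \<in> cat_Cell (Suc n)" "cod_cat \<alpha> = Y" "strict_functor Y Z K" "strict_omega Y" "strict_omega Z" "inf_category Z"
  shows "post Z K \<alpha> \<in> cat_Cell (Suc n)"
  using assms(1,2)
proof (induction rule: cat_Cell_Suc_induct)
  case (CatFun X Y' f)
  interpret X: inf_category X by fact
  interpret XG: globular X by (rule X.globular)
  interpret Y: strict_omega Y by fact
  have fY: "inf_functor X Y f" using CatFun by simp
  have K: "inf_functor Y Z K" using strict_functor_inf_functor[OF assms(3-5)] .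
  note E = Y.strict_functor_eqv[OF assms(3,5)]
  have "inf_functor X Z (K \<circ> f)"
    unfolding inf_functor_def
  proof (intro conjI allI ballI impI)
    fix n x assume x: "x \<in> Cell X n"
    show "(K \<circ> f) x \<in> Cell Z n" using x fY K by (simp add: inf_functor_def)
    have "eqv Z (K (f (idn X x))) (K (idn Y (f x)))" using E fY x unfolding inf_functor_def by blast
    moreover have "K (idn Y (f x)) = idn Z (K (f x))" using assms(3) fY x unfolding strict_functor_def inf_functor_def by blast
    ultimately show "eqv Z ((K \<circ> f) (idn X x)) (idn Z ((K \<circ> f) x))" by simp
  next
    fix n x assume x: "x \<in> Cell X (Suc n)"
    then have "f x \<in> Cell Y (Suc n)" using fY by (simp add: inf_functor_def)
    then show "(K \<circ> f) (dm X x) = dm Z ((K \<circ> f) x)" "(K \<circ> f) (cd X x) = cd Z ((K \<circ> f) x)"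
      using inf_functorD(2,3)[OF fY x] inf_functorD(2,3)[OF K, of "f x"] by simp_all
  next
    fix k n x y assume c: "composable X k n x y"
    have "eqv Z (K (f (cmp X k x y))) (K (cmp Y k (f x) (f y)))" using E fY c unfolding inf_functor_def by blast
    moreover have "K (cmp Y k (f x) (f y)) = cmp Z k (K (f x)) (K (f y))"
      using assms(3) XG.composable_map[OF fY c] unfolding strict_functor_def by blast
    ultimately show "eqv Z ((K \<circ> f) (cmp X k x y)) (cmp Z k ((K \<circ> f) x) ((K \<circ> f) y))" by simp
  qed
  then have "inf_functor X Z (restrict (K \<circ> f) (all_cells X))"
    by (rule XG.inf_functor_cong) (simp_all add: X.cmp_cell)
  then show ?case using CatFun assms(6) by simp
next
  case (CatMod m s t h)
  let ?X = "dom_cat s"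
  have Y: "cod_cat s = Y" "cod_cat t = Y" using CatMod by simp_all
  interpret Y: strict_omega Y by fact
  interpret X: inf_category ?X using cat_Cell_inf_category[OF CatMod(1)] by simp
  interpret XG: globular ?X by (rule X.globular)
  have K: "inf_functor Y Z K" using strict_functor_inf_functor[OF assms(3-5)] .
  have st: "post Z K s \<in> cat_Cell (Suc m)" "post Z K t \<in> cat_Cell (Suc m)" using CatMod Y by auto
  have par: "cat_dm (post Z K s) = cat_dm (post Z K t) \<and> cat_cd (post Z K s) = cat_cd (post Z K t)"
  proof (cases m)
    case 0
    then obtain X1 Y1 f1 X2 Y2 f2 where "s = CatFun X1 Y1 f1" "t = CatFun X2 Y2 f2"
      using CatMod(1,2) by (auto elim!: cat_Cell_1E)
    then show ?thesis using CatMod(3) by simp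
  next
    case (Suc j)
    obtain s1 s2 s3 t1 t2 t3 where "s = CatMod s1 s2 s3" "t = CatMod t1 t2 t3"
      using cat_Cell_Suc_Suc_eq(1)[of s j] cat_Cell_Suc_Suc_eq(1)[of t j] CatMod(1,2) Suc by metis
    then show ?thesis using CatMod(3,4) by simp
  qed
  let ?F = "cat_map ((cat_dm ^^ m) s)" and ?G = "cat_map ((cat_cd ^^ m) t)"
  have F: "inf_functor ?X Y ?F" using cat_map_inf_functor(1)[OF CatMod(1)] Y by simp
  have G: "inf_functor ?X Y ?G" using cat_map_inf_functor(2)[OF CatMod(2)] Y CatMod(5) by simp
  obtain F' where F': "(cat_dm ^^ m) s = CatFun ?X Y F'"
    using cat_dm_pow_Cell[of s 0 m] CatMod(1) Y by auto
  obtain G' where G': "(cat_cd ^^ m) t = CatFun ?X Y G'"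
    using cat_cd_pow_Cell[of t 0 m] CatMod(2,5) Y by auto
  have FF: "cat_map ((cat_dm ^^ m) (post Z K s)) x = K (?F x)" "cat_map ((cat_cd ^^ m) (post Z K t)) x = K (?G x)"
    if "x \<in> all_cells ?X" for x
    using cat_dm_pow_post[of s 0 m Z K] cat_cd_pow_post[of t 0 m Z K] CatMod(1,2) F' G' that by simp_all
  have al: "x \<in> Cell ?X n \<Longrightarrow> x \<in> all_cells ?X" for x n by (auto simp: all_cells_def)
  note M = CatMod(7)[unfolded modification_def Y]
  have "modification m ?X Z (cat_map ((cat_dm ^^ m) (post Z K s))) (cat_map ((cat_cd ^^ m) (post Z K t)))
      (cat_map (post Z K s)) (cat_map (post Z K t)) (restrict (K \<circ> h) (Cell ?X 0))"
    unfolding modification_def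
  proof (intro conjI ballI allI)
    fix a assume a: "a \<in> Cell ?X 0"
    have ha: "h a \<in> hom_cells Y m (?F a) (?G a)" "dm Y (h a) = cat_map s a" "cd Y (h a) = cat_map t a" using M a by auto
    have FY: "?F a \<in> Cell Y 0" using F a by (auto simp: inf_functor_def)
    have hY: "h a \<in> Cell Y (Suc m)" using Y.hom_cells_Cell[OF FY ha(1)] .
    show "restrict (K \<circ> h) (Cell ?X 0) a \<in> hom_cells Z m (cat_map ((cat_dm ^^ m) (post Z K s)) a) (cat_map ((cat_cd ^^ m) (post Z K t)) a)"
      using Y.hom_cells_map[OF K ha(1)] FF[OF al[OF a]] a by simp
    show "dm Z (restrict (K \<circ> h) (Cell ?X 0) a) = cat_map (post Z K s) a"
      using cat_map_post[OF CatMod(1) a] inf_functorD(2)[OF K hY] ha a by simp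
    show "cd Z (restrict (K \<circ> h) (Cell ?X 0) a) = cat_map (post Z K t) a"
      using cat_map_post[OF CatMod(2), of a] CatMod(5) inf_functorD(3)[OF K hY] ha a by simp
  next
    fix a b k f assume a: "a \<in> Cell ?X 0" and b: "b \<in> Cell ?X 0" and f: "f \<in> hom_cells ?X (m + k) a b"
    have FY: "?F a \<in> Cell Y 0" "?F b \<in> Cell Y 0" "?G a \<in> Cell Y 0" using F G a b by (auto simp: inf_functor_def)
    have ha: "h a \<in> hom_cells Y m (?F a) (?G a)" "h b \<in> hom_cells Y m (?F b) (?G b)" using M a b by auto
    have fc: "f \<in> Cell ?X (Suc (m + k))" using XG.hom_cells_Cell[OF a f] .
    have Kid: "K ((idn Y ^^ k) x) = (idn Z ^^ k) (K x)" if "x \<in> Cell Y n" for x n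
    proof (induction k)
      case (Suc k)
      have "K (idn Y ((idn Y ^^ k) x)) = idn Z (K ((idn Y ^^ k) x))"
        using Y.idn_pow_cell[OF that, of k] assms(3) unfolding strict_functor_def by blast
      then show ?case using Suc by simp
    qed simp
    have "eqv Y (mu Y (m + k) ((idn Y ^^ k) (h b)) (?F f)) (mu Y (m + k) (?G f) ((idn Y ^^ k) (h a)))"
      using M a b f by blast
    then have E: "eqv Z (K (mu Y (m + k) ((idn Y ^^ k) (h b)) (?F f))) (K (mu Y (m + k) (?G f) ((idn Y ^^ k) (h a))))"
      by (rule Y.strict_functor_eqv[OF assms(3,5)])
    note c = Y.composable_mu[OF FY(1) Y.hom_cells_idn_pow[OF ha(2), of k] XG.hom_cells_map[OF F f]]
      Y.composable_mu[OF FY(1) XG.hom_cells_map[OF G f] Y.hom_cells_idn_pow[OF ha(1), of k]]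
    have "K (mu Y (m + k) ((idn Y ^^ k) (h b)) (?F f)) = mu Z (m + k) ((idn Z ^^ k) (K (h b))) (K (?F f))"
      "K (mu Y (m + k) (?G f) ((idn Y ^^ k) (h a))) = mu Z (m + k) (K (?G f)) ((idn Z ^^ k) (K (h a)))"
      using c assms(3) Kid[OF Y.hom_cells_Cell[OF FY(1) ha(1)]] Kid[OF Y.hom_cells_Cell[OF FY(2) ha(2)]]
      by (simp_all add: mu_def strict_functor_def)
    then show "eqv Z (mu Z (m + k) ((idn Z ^^ k) (restrict (K \<circ> h) (Cell ?X 0) b)) (cat_map ((cat_dm ^^ m) (post Z K s)) f))
       (mu Z (m + k) (cat_map ((cat_cd ^^ m) (post Z K t)) f) ((idn Z ^^ k) (restrict (K \<circ> h) (Cell ?X 0) a)))"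
      using E FF[OF al[OF fc]] a b by simp
  qed
  then show ?case using st par cat_post_props[OF CatMod(1), of Z K] by simp
qed

text \<open>Naturality of \<open>e\<alpha>\<close> at cells of degree \<open>n + k + 1\<close> is that of \<open>\<alpha>\<close> with \<open>k + 1\<close> in place of \<open>k\<close>. For a functor \<open>\<alpha>\<close> both
  sides reduce to the value of \<open>\<alpha>\<close> by the unit laws.\<close>

lemma cat_idn_in_cat_Cell:
  assumes x: "x \<in> cat_Cell (Suc n)" and "strict_omega (cod_cat x)"
  shows "cat_idn x \<in> cat_Cell (Suc (Suc n))"
proof -
  let ?X = "dom_cat x" and ?Y = "cod_cat x"
  let ?F = "cat_map ((cat_dm ^^ n) x)" and ?G = "cat_map ((cat_cd ^^ n) x)"
  let ?h = "\<lambda>a\<in>Cell ?X 0. idn ?Y (cat_map x a)"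
  interpret Y: strict_omega ?Y by fact
  interpret X: inf_category ?X using cat_Cell_inf_category[OF x] by simp
  interpret XG: globular ?X by (rule X.globular)
  note F = cat_map_inf_functor[OF x]
  have "modification n ?X ?Y ?F ?G (cat_map x) (cat_map x) ?h"
    unfolding modification_def
  proof (intro conjI ballI allI)
    fix a assume a: "a \<in> Cell ?X 0"
    note c = cat_Cell_component[OF x a]
    show "dm ?Y (?h a) = cat_map x a" "cd ?Y (?h a) = cat_map x a"
      using a Y.dm_idn[OF c(1)] Y.cd_idn[OF c(1)] by simp_all
    show "?h a \<in> hom_cells ?Y n (?F a) (?G a)"
      unfolding Y.hom_cells_iff[OF c(5)] funpow_Suc_right o_apply
      using a Y.dm_idn[OF c(1)] Y.cd_idn[OF c(1)] Y.idn_cell[OF c(1)] c by simp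
  next
    fix a b k f assume a: "a \<in> Cell ?X 0" and b: "b \<in> Cell ?X 0" and f: "f \<in> hom_cells ?X (n + k) a b"
    have FY: "?F a \<in> Cell ?Y 0" using F a by (auto simp: inf_functor_def)
    show "eqv ?Y (mu ?Y (n + k) ((idn ?Y ^^ k) (?h b)) (?F f)) (mu ?Y (n + k) (?G f) ((idn ?Y ^^ k) (?h a)))"
    proof (cases n)
      case 0
      have Ff: "?F f \<in> hom_cells ?Y k (?F a) (?F b)" using XG.hom_cells_map[OF F(1) f] 0 by simp
      have "?G f = ?F f" "?h a = idn ?Y (?F a)" "?h b = idn ?Y (?F b)" using a b 0 by simp_all
      then show ?thesis using Y.mu_unit_left[OF FY Ff] Y.mu_unit_right[OF FY Ff] Y.eqv_refl[OF Y.hom_cells_Cell[OF FY Ff]] 0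
        by (simp add: funpow_swap1)
    next
      case (Suc m)
      obtain s t h where *: "x = CatMod s t h" "modification m (dom_cat s) (cod_cat s)
       (cat_map ((cat_dm ^^ m) s)) (cat_map ((cat_cd ^^ m) t)) (cat_map s) (cat_map t) h"
        by (rule cat_Cell_SucE[OF x]) (use Suc that in auto)
      have f': "f \<in> hom_cells ?X (m + Suc k) a b" using f Suc by simp
      have "eqv ?Y (mu ?Y (m + Suc k) ((idn ?Y ^^ Suc k) (h b)) (cat_map ((cat_dm ^^ m) s) f))
         (mu ?Y (m + Suc k) (cat_map ((cat_cd ^^ m) t) f) ((idn ?Y ^^ Suc k) (h a)))"
        using *(2) a b f' unfolding modification_def *(1) dom_cat.simps cod_cat.simps by blast
      then show ?thesis using a b * Suc by (simp add: funpow_swap1)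
    qed
  qed
  then show ?thesis using x cat_deg_Cell[OF x] by (simp add: cat_idn_pos)
qed

section \<open>The infinity-category of infinity-categories and its subcategories\<close>

lemma Cell_CAT [simp]: "Cell CAT n = cat_Cell n"
  by (simp add: CAT_def canon_def)

lemma CAT_ops:
  "x \<in> cat_Cell (Suc n) \<Longrightarrow> dm CAT x = cat_dm x"
  "x \<in> cat_Cell (Suc n) \<Longrightarrow> cd CAT x = cat_cd x"
  "x \<in> cat_Cell n \<Longrightarrow> idn CAT x = cat_idn x"
  by (auto simp: CAT_def canon_def all_cells_def simp del: cat_Cell.simps)

lemma dm_CAT_pow: "x \<in> cat_Cell n \<Longrightarrow> k \<le> n \<Longrightarrow> (dm CAT ^^ k) x = (cat_dm ^^ k) x"
proof (induction k arbitrary: x n)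
  case (Suc k)
  then obtain m where n: "n = Suc m" by (cases n) auto
  then show ?case using Suc.IH[of "cat_dm x" m] Suc.prems cat_dm_Cell[of x m] CAT_ops(1)[of x m]
    by (simp add: funpow_swap1 del: cat_Cell.simps)
qed simp

lemma cd_CAT_pow: "x \<in> cat_Cell n \<Longrightarrow> k \<le> n \<Longrightarrow> (cd CAT ^^ k) x = (cat_cd ^^ k) x"
proof (induction k arbitrary: x n)
  case (Suc k)
  then obtain m where n: "n = Suc m" by (cases n) auto
  then show ?case using Suc.IH[of "cat_cd x" m] Suc.prems cat_cd_Cell[of x m] CAT_ops(2)[of x m]
    by (simp add: funpow_swap1 del: cat_Cell.simps)
qed simp

lemma composable_CAT_iff:
  "composable CAT k n f g \<longleftrightarrow> 1 \<le> k \<and> k \<le> n \<and> f \<in> cat_Cell n \<and> g \<in> cat_Cell n \<and> (cat_dm ^^ k) f = (cat_cd ^^ k) g"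
  using dm_CAT_pow cd_CAT_pow unfolding composable_def Cell_CAT by metis

lemma cmp_CAT: "composable CAT k n f g \<Longrightarrow> cmp CAT k f g = cat_cmp k f g"
proof -
  assume c: "composable CAT k n f g"
  let ?R = "\<lparr> Cell = cat_Cell, dm = cat_dm, cd = cat_cd, idn = cat_idn, cmp = cat_cmp \<rparr> :: 'a cat_cell cells"
  have "composable ?R k n f g" using c unfolding composable_CAT_iff by (simp add: composable_def)
  then show ?thesis unfolding CAT_def canon_def by auto
qed

text \<open>The identity modification of \<open>x\<close> has components in a strict category, so \<open>ex \<circ>\<^sub>1 ex = ex\<close> there, and the
  coinduction continues with \<open>ex\<close>, which has the same target category.\<close>

lemma eqv_CAT_refl:
  assumes "x \<in> cat_Cell (Suc n)" "strict_omega (cod_cat x)"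
  shows "eqv CAT x x"
  using assms
proof (coinduction arbitrary: x n)
  case eqv
  let ?i = "cat_idn x"
  have i: "?i \<in> cat_Cell (Suc (Suc n))" using cat_idn_in_cat_Cell eqv .
  have d: "cat_deg x \<noteq> 0" using cat_deg_Cell[OF eqv(1)] by simp
  have ci: "cod_cat ?i = cod_cat x" "cat_dm ?i = x" "cat_cd ?i = x" using d by (simp_all add: cat_idn_pos)
  have c: "composable CAT 1 (Suc (Suc n)) ?i ?i" using i ci unfolding composable_CAT_iff by simp
  interpret Y: strict_omega "cod_cat x" by fact
  have "cmp (cod_cat x) 1 (idn (cod_cat x) (cat_map x a)) (idn (cod_cat x) (cat_map x a)) = idn (cod_cat x) (cat_map x a)"
    if "a \<in> Cell (dom_cat x) 0" for a
    using Y.unit_left[OF Y.idn_cell[OF cat_Cell_component(1)[OF eqv(1) that]], of 1]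
      Y.cd_idn[OF cat_Cell_component(1)[OF eqv(1) that]] by simp
  then have u: "cat_cmp 1 ?i ?i = ?i"
    using d by (simp add: cat_idn_pos fun_eq_iff)
  have h: "?i \<in> hom_cells CAT 0 x x"
    unfolding hom_cells_def using i eqv(1) ci CAT_ops(1,2)[OF i] by (auto simp del: cat_Cell.simps intro!: exI[of _ "Suc n"])
  show ?case
    apply (rule exI[of _ x], rule exI[of _ "Suc n"], rule exI[of _ x], rule exI[of _ ?i], rule exI[of _ ?i])
    using h eqv i ci u cmp_CAT[OF c] CAT_ops(3)[OF eqv(1)] by (auto simp del: cat_Cell.simps)
qed

lemma mu_CAT:
  assumes "x \<in> cat_Cell (Suc n)" "y \<in> cat_Cell (Suc n)" "dom_cat x = cod_cat y"
  shows "mu CAT n x y = cat_cmp (Suc n) x y"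
proof -
  have "composable CAT (Suc n) (Suc n) x y" unfolding composable_CAT_iff
    using assms cat_Cell_boundary(1)[OF assms(1)] cat_Cell_boundary(2)[OF assms(2)] by simp
  then show ?thesis using cmp_CAT by (simp add: mu_def)
qed

lemma idn_CAT_pow:
  assumes "x \<in> cat_Cell (Suc n)" "strict_omega (cod_cat x)"
  shows "(idn CAT ^^ k) x = (cat_idn ^^ k) x \<and> (cat_idn ^^ k) x \<in> cat_Cell (Suc (n + k))"
proof (induction k)
  case (Suc k)
  then show ?case using CAT_ops(3)[of "(cat_idn ^^ k) x" "Suc (n + k)"] cat_idn_in_cat_Cell[of "(cat_idn ^^ k) x" "n + k"]
     cat_idn_pow_dom_cod_deg[of x k] cat_deg_Cell[OF assms(1)] assms(2) by (simp del: cat_Cell.simps)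
qed (use assms in simp)

locale cat_subcategory =
  fixes B :: "'x cat_cell cells"
  assumes sub: "subcategory B CAT"
begin

lemma Cell_B: "x \<in> Cell B n \<Longrightarrow> x \<in> cat_Cell n"
  using sub unfolding subcategory_def by auto

lemma dm_B: "x \<in> Cell B (Suc n) \<Longrightarrow> dm B x = cat_dm x" "x \<in> Cell B (Suc n) \<Longrightarrow> cat_dm x \<in> Cell B n"
  and cd_B: "x \<in> Cell B (Suc n) \<Longrightarrow> cd B x = cat_cd x" "x \<in> Cell B (Suc n) \<Longrightarrow> cat_cd x \<in> Cell B n"
  and idn_B: "y \<in> Cell B n \<Longrightarrow> idn B y = cat_idn y" "y \<in> Cell B n \<Longrightarrow> cat_idn y \<in> Cell B (Suc n)"
proof -
  let ?C = "CAT\<lparr>Cell := Cell B\<rparr> :: 'x cat_cell cells"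
  have B: "dm B = dm (canon ?C)" "cd B = cd (canon ?C)" "idn B = idn (canon ?C)"
    using sub unfolding subcategory_def by metis+
  have c: "x \<in> Cell B (Suc n) \<Longrightarrow> dm CAT x \<in> Cell B n \<and> cd CAT x \<in> Cell B n" "y \<in> Cell B n \<Longrightarrow> idn CAT y \<in> Cell B (Suc n)"
    using sub unfolding subcategory_def by auto
  show "x \<in> Cell B (Suc n) \<Longrightarrow> dm B x = cat_dm x" "x \<in> Cell B (Suc n) \<Longrightarrow> cat_dm x \<in> Cell B n"
    "x \<in> Cell B (Suc n) \<Longrightarrow> cd B x = cat_cd x" "x \<in> Cell B (Suc n) \<Longrightarrow> cat_cd x \<in> Cell B n"
    "y \<in> Cell B n \<Longrightarrow> idn B y = cat_idn y" "y \<in> Cell B n \<Longrightarrow> cat_idn y \<in> Cell B (Suc n)"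
    using c CAT_ops(1,2)[of x n] CAT_ops(3)[of y n] Cell_B[of x "Suc n"] Cell_B[of y n]
    unfolding B by (auto simp: canon_def all_cells_def simp del: cat_Cell.simps)
qed

lemma dm_B_pow: "x \<in> Cell B n \<Longrightarrow> k \<le> n \<Longrightarrow> (dm B ^^ k) x = (cat_dm ^^ k) x"
proof (induction k arbitrary: x n)
  case (Suc k)
  then obtain m where n: "n = Suc m" by (cases n) auto
  then show ?case using Suc.IH[of "cat_dm x" m] Suc.prems dm_B[of x m] by (simp add: funpow_swap1)
qed simp

lemma cd_B_pow: "x \<in> Cell B n \<Longrightarrow> k \<le> n \<Longrightarrow> (cd B ^^ k) x = (cat_cd ^^ k) x"
proof (induction k arbitrary: x n)
  case (Suc k)
  then obtain m where n: "n = Suc m" by (cases n) auto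
  then show ?case using Suc.IH[of "cat_cd x" m] Suc.prems cd_B[of x m] by (simp add: funpow_swap1)
qed simp

lemma idn_B_pow: "x \<in> Cell B n \<Longrightarrow> (idn B ^^ k) x = (cat_idn ^^ k) x \<and> (cat_idn ^^ k) x \<in> Cell B (n + k)"
  using idn_B by (induction k) auto

lemma boundary_B: "x \<in> Cell B (Suc n) \<Longrightarrow> CatObj (dom_cat x) \<in> Cell B 0 \<and> CatObj (cod_cat x) \<in> Cell B 0"
proof -
  have d: "y \<in> Cell B (m + k) \<Longrightarrow> (cat_dm ^^ k) y \<in> Cell B m \<and> (cat_cd ^^ k) y \<in> Cell B m" for y k m
    using dm_B(2) cd_B(2) by (induction k arbitrary: m) (auto simp: add_Suc_right[symmetric] simp del: add_Suc_right)
  assume x: "x \<in> Cell B (Suc n)"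
  show ?thesis using cat_Cell_boundary[OF Cell_B[OF x]] d[of x 0 "Suc n"] x by (simp del: funpow.simps)
qed

lemma hom_cells_B_iff: "f \<in> hom_cells B n (CatObj X) (CatObj Y) \<longleftrightarrow> f \<in> Cell B (Suc n) \<and> dom_cat f = X \<and> cod_cat f = Y"
proof
  assume "f \<in> hom_cells B n (CatObj X) (CatObj Y)"
  then obtain m where m: "CatObj X \<in> Cell B m" "f \<in> Cell B (m + n + 1)"
     "(dm B ^^ (n + 1)) f = CatObj X" "(cd B ^^ (n + 1)) f = CatObj Y" unfolding hom_cells_def by auto
  have "m = 0" using cat_deg_Cell[OF Cell_B[OF m(1)]] by simp
  then have f: "f \<in> Cell B (Suc n)" using m by simp
  then show "f \<in> Cell B (Suc n) \<and> dom_cat f = X \<and> cod_cat f = Y"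
    using m(3,4) cat_Cell_boundary[OF Cell_B[OF f]] dm_B_pow[OF f, of "Suc n"] cd_B_pow[OF f, of "Suc n"] by (simp del: funpow.simps)
next
  assume "f \<in> Cell B (Suc n) \<and> dom_cat f = X \<and> cod_cat f = Y"
  then have f: "f \<in> Cell B (Suc n)" and XY: "dom_cat f = X" "cod_cat f = Y" by auto
  show "f \<in> hom_cells B n (CatObj X) (CatObj Y)" unfolding hom_cells_def
    using f boundary_B[OF f] XY cat_Cell_boundary[OF Cell_B[OF f]] dm_B_pow[OF f, of "Suc n"] cd_B_pow[OF f, of "Suc n"]
    by (auto simp del: funpow.simps intro!: exI[of _ 0])
qed

lemma mu_B:
  assumes x: "x \<in> Cell B (Suc n)" and y: "y \<in> Cell B (Suc n)" and "dom_cat x = cod_cat y"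
  shows "mu B n x y = cat_cmp (Suc n) x y" "cat_cmp (Suc n) x y \<in> Cell B (Suc n)"
proof -
  have c: "composable CAT (Suc n) (Suc n) x y" unfolding composable_CAT_iff
    using assms(3) cat_Cell_boundary(1)[OF Cell_B[OF x]] cat_Cell_boundary(2)[OF Cell_B[OF y]] Cell_B x y by (simp del: funpow.simps)
  then show "cat_cmp (Suc n) x y \<in> Cell B (Suc n)" using sub x y cmp_CAT[OF c] unfolding subcategory_def by metis
  let ?C = "CAT\<lparr>Cell := Cell B\<rparr> :: 'x cat_cell cells"
  have "composable ?C (Suc n) (Suc n) x y" using c x y by (simp add: composable_def)
  moreover have "cmp B = cmp (canon ?C)" using sub unfolding subcategory_def by metis
  ultimately show "mu B n x y = cat_cmp (Suc n) x y" using cmp_CAT[OF c] by (auto simp: mu_def canon_def)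
qed

end

section \<open>Lifting the contravariant hom-functor\<close>

lemma (in globular) composable_map_graded:
  assumes "graded L M F" "\<And>n x. x \<in> Cell L (Suc n) \<Longrightarrow> F (dm L x) = dm M (F x) \<and> F (cd L x) = cd M (F x)"
    and "composable L k n f g"
  shows "composable M k n (F f) (F g)"
proof -
  have p: "F ((dm L ^^ k) x) = (dm M ^^ k) (F x) \<and> F ((cd L ^^ k) x) = (cd M ^^ k) (F x)" if "x \<in> Cell L (n + k)" for x k n
    using that
  proof (induction k arbitrary: n)
    case (Suc k)
    have x: "x \<in> Cell L (Suc n + k)" using Suc.prems by simp
    then show ?case using Suc.IH[OF x] dm_pow_cell[OF x] cd_pow_cell[OF x] assms(2) by simp
  qed simp
  have k: "f \<in> Cell L n" "g \<in> Cell L n" "1 \<le> k" "k \<le> n" "(dm L ^^ k) f = (cd L ^^ k) g"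
    using assms(3) by (auto simp: composable_def)
  have "f \<in> Cell L ((n - k) + k)" "g \<in> Cell L ((n - k) + k)" using k by simp_all
  then have "(dm M ^^ k) (F f) = (cd M ^^ k) (F g)" using p k(5) by metis
  then show ?thesis using k assms(1) by (simp add: composable_def graded_def)
qed

lemma (in globular) cell_in_hom:
  assumes "x \<in> Cell L (Suc n)"
  obtains a b where "a \<in> Cell L 0" "b \<in> Cell L 0" "x \<in> hom_cells L n a b"
proof -
  have "(dm L ^^ Suc n) x \<in> Cell L 0" "(cd L ^^ Suc n) x \<in> Cell L 0"
    using dm_pow_cell[of x 0 "Suc n"] cd_pow_cell[of x 0 "Suc n"] assms by simp_all
  then show thesis using that assms hom_cells_iff by blast
qed

lemma composable_in_homE:
  assumes "globular L" "composable L k (Suc n) f g" "k \<le> n"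
  obtains a b where "a \<in> Cell L 0" "b \<in> Cell L 0" "composable (hom L a b) k n f g"
proof -
  interpret globular L by fact
  have f: "f \<in> Cell L (Suc n)" using assms(2) by (simp add: composable_def)
  have "(dm L ^^ Suc n) f \<in> Cell L 0" "(cd L ^^ Suc n) f \<in> Cell L 0"
    using dm_pow_cell[of f 0 "Suc n"] cd_pow_cell[of f 0 "Suc n"] f by simp_all
  moreover have "composable (hom L ((dm L ^^ Suc n) f) ((cd L ^^ Suc n) f)) k n f g"
    using composable_hom[OF assms(2) composable_unit(2)[OF f, of "Suc n"] assms(3)] by simp
  ultimately show thesis using that by blast
qed

text \<open>One half of the situation: the faithful functor \<open>V = L'(B0,-)\<close> and the liftings along it. The data are
  unpacked into cells of explicit degree. \<open>th\<close> is the map on cells underlying \<open>\<theta>\<close>, \<open>eps A\<close> the one underlying the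
  lifted evaluation cone of \<open>A\<close>, and composing with \<open>\<theta>\<close> appears as \<open>post\<close>. The other half is the same locale
  with the two categories exchanged.\<close>

locale half_lifting = cat_subcategory B + L: strict_inf_category L + L': strict_inf_category L'
  for B :: "'x cat_cell cells" and L :: "'x cells" and A0 At :: 'x and L' :: "'x cells" and B0 Bt :: 'x +
  fixes th :: "'x \<Rightarrow> 'x" and G0 :: "'x \<Rightarrow> 'x" and eps :: "'x \<Rightarrow> 'x \<Rightarrow> 'x"
  assumes objects: "A0 \<in> Cell L 0" "At \<in> Cell L 0" "B0 \<in> Cell L' 0" "Bt \<in> Cell L' 0"
    and faithful: "\<lbrakk> X \<in> Cell L' 0; Y \<in> Cell L' 0; \<Phi> \<in> hom_cells L' n X Y; \<Psi> \<in> hom_cells L' n X Y;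
      hom_from_at L' B0 (Suc n) \<Phi> = hom_from_at L' B0 (Suc n) \<Psi> \<rbrakk> \<Longrightarrow> \<Phi> = \<Psi>"
    and V_B: "\<beta> \<in> Cell L' n \<Longrightarrow> hom_from_at L' B0 n \<beta> \<in> Cell B n"
    and H_B: "\<alpha> \<in> Cell L n \<Longrightarrow> hom_to_at L At n \<alpha> \<in> Cell B n"
    and th_B: "CatFun (hom L A0 At) (hom L' B0 Bt) th \<in> Cell B 1"
    and lift_object: "A \<in> Cell L 0 \<Longrightarrow> G0 A \<in> Cell L' 0" "A \<in> Cell L 0 \<Longrightarrow> hom L' B0 (G0 A) = hom L A At"
    and lift_cell: "\<lbrakk> A \<in> Cell L 0; X \<in> Cell L' 0; f \<in> Cell B (Suc n); dom_cat f = hom L' B0 X; cod_cat f = hom L A At;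
      \<And>x. x \<in> hom_cells L n A0 A \<Longrightarrow> \<exists>\<Psi> \<in> hom_cells L' n X Bt. hom_from_at L' B0 (Suc n) \<Psi> =
        post (hom L' B0 Bt) th (cat_cmp (Suc n) (hom_to_at L At (Suc n) x) f) \<rbrakk>
      \<Longrightarrow> \<exists>\<Psi> \<in> hom_cells L' n X (G0 A). hom_from_at L' B0 (Suc n) \<Psi> = f"
    and eps_B: "A \<in> Cell L 0 \<Longrightarrow> CatFun (hom L A0 A) (hom L' (G0 A) Bt) (eps A) \<in> Cell B 1"
    and V_eps: "\<lbrakk> A \<in> Cell L 0; x \<in> hom_cells L n A0 A \<rbrakk> \<Longrightarrow>
      hom_from_at L' B0 (Suc n) (eps A x) = post (hom L' B0 Bt) th (hom_to_at L At (Suc n) x)"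
begin

sublocale L: strict_omega L by (rule L.strict_omega)
sublocale L': strict_omega L' by (rule L'.strict_omega)

text \<open>Values of \<open>V\<close> and \<open>L(-,At)\<close> on cells of hom-degree \<open>n\<close>, whose degree is \<open>n + 1\<close>.\<close>

abbreviation "V n \<equiv> hom_from_at L' B0 (Suc n)"
abbreviation "H n \<equiv> hom_to_at L At (Suc n)"

lemma eps_functor: "A \<in> Cell L 0 \<Longrightarrow> inf_functor (hom L A0 A) (hom L' (G0 A) Bt) (eps A)"
  using Cell_B[OF eps_B] by simp

lemma eps_cell: "A \<in> Cell L 0 \<Longrightarrow> x \<in> hom_cells L n A0 A \<Longrightarrow> eps A x \<in> hom_cells L' n (G0 A) Bt"
  using inf_functorD(1)[OF eps_functor, of A x n] by simp

lemma V_Cell: "X \<in> Cell L' 0 \<Longrightarrow> \<beta> \<in> hom_cells L' n X Y \<Longrightarrow> V n \<beta> \<in> cat_Cell (Suc n)"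
  using Cell_B[OF V_B] L'.hom_cells_Cell by blast

lemma H_Cell: "A \<in> Cell L 0 \<Longrightarrow> \<alpha> \<in> hom_cells L n A A' \<Longrightarrow> H n \<alpha> \<in> cat_Cell (Suc n)"
  using Cell_B[OF H_B] L.hom_cells_Cell by blast

text \<open>The evaluation at \<open>x\<close> after \<open>L(\<alpha>,At)\<close> is the evaluation at \<open>\<alpha> \<circ> x\<close>, for which \<open>eps\<close> provides a lift.\<close>

lemma G_exists:
  assumes A: "A \<in> Cell L 0" and \<alpha>: "\<alpha> \<in> hom_cells L n A A'"
  shows "\<exists>\<Psi> \<in> hom_cells L' n (G0 A') (G0 A). V n \<Psi> = H n \<alpha>"
proof -
  have A': "A' \<in> Cell L 0" using L.hom_cells_target A \<alpha> .
  note d = L.hom_to_at_dom_cod[OF objects(2) A \<alpha>]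
  show ?thesis
  proof (rule lift_cell[OF A lift_object(1)[OF A'] H_B[OF L.hom_cells_Cell[OF A \<alpha>]]])
    show "dom_cat (H n \<alpha>) = hom L' B0 (G0 A')" "cod_cat (H n \<alpha>) = hom L A At"
      using d lift_object(2)[OF A'] by simp_all
    fix x assume x: "x \<in> hom_cells L n A0 A"
    have m: "mu L n \<alpha> x \<in> hom_cells L n A0 A'" using L.mu_cell objects(1) \<alpha> x .
    show "\<exists>\<Psi> \<in> hom_cells L' n (G0 A') Bt. V n \<Psi> = post (hom L' B0 Bt) th (cat_cmp (Suc n) (H n x) (H n \<alpha>))"
      using eps_cell[OF A' m] V_eps[OF A' m] L.hom_to_at_mu[OF objects(2,1) \<alpha> x] by auto
  qed
qed

text \<open>The degree and the objects of \<open>\<alpha>\<close> are determined by \<open>\<alpha>\<close>, so the description is unique once \<open>V\<close> is faithful.\<close>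

definition G :: "'x \<Rightarrow> 'x" where
  "G \<alpha> = (if \<alpha> \<in> Cell L 0 then G0 \<alpha> else
     THE \<Psi>. \<exists>n A A'. A \<in> Cell L 0 \<and> \<alpha> \<in> hom_cells L n A A' \<and> \<Psi> \<in> hom_cells L' n (G0 A') (G0 A) \<and> V n \<Psi> = H n \<alpha>)"

lemma G_object: "A \<in> Cell L 0 \<Longrightarrow> G A = G0 A"
  by (simp add: G_def)

lemma hom_cells_unique_objects:
  assumes "A \<in> Cell L 0" "\<alpha> \<in> hom_cells L n A A'" "C \<in> Cell L 0" "\<alpha> \<in> hom_cells L m C C'"
  shows "m = n \<and> C = A \<and> C' = A'"
proof -
  have "Suc m = Suc n" using L.grading L.hom_cells_Cell assms by metis
  then show ?thesis using assms(2,4) L.hom_cells_iff[OF assms(1)] L.hom_cells_iff[OF assms(3)] by auto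
qed

text \<open>All laws of \<open>G\<close> follow from this: the candidate has the right boundary, and the right image under \<open>V\<close>
  because \<open>V\<close> and \<open>L(-,At)\<close> satisfy the law strictly.\<close>

lemma G_eqI:
  assumes A: "A \<in> Cell L 0" and \<alpha>: "\<alpha> \<in> hom_cells L n A A'"
    and "\<Psi> \<in> hom_cells L' n (G0 A') (G0 A)" "V n \<Psi> = H n \<alpha>"
  shows "G \<alpha> = \<Psi>"
proof -
  have A': "A' \<in> Cell L 0" using L.hom_cells_target A \<alpha> .
  have "\<alpha> \<notin> Cell L 0" using L.grading[of \<alpha> 0 "Suc n"] L.hom_cells_Cell[OF A \<alpha>] by auto
  moreover have "(THE \<Psi>. \<exists>n A A'. A \<in> Cell L 0 \<and> \<alpha> \<in> hom_cells L n A A' \<and> \<Psi> \<in> hom_cells L' n (G0 A') (G0 A) \<and> V n \<Psi> = H n \<alpha>) = \<Psi>"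
  proof (rule the_equality)
    show "\<exists>n A A'. A \<in> Cell L 0 \<and> \<alpha> \<in> hom_cells L n A A' \<and> \<Psi> \<in> hom_cells L' n (G0 A') (G0 A) \<and> V n \<Psi> = H n \<alpha>"
      using assms by blast
    fix \<Omega> assume "\<exists>n A A'. A \<in> Cell L 0 \<and> \<alpha> \<in> hom_cells L n A A' \<and> \<Omega> \<in> hom_cells L' n (G0 A') (G0 A) \<and> V n \<Omega> = H n \<alpha>"
    then obtain m C C' where *: "C \<in> Cell L 0" "\<alpha> \<in> hom_cells L m C C'" "\<Omega> \<in> hom_cells L' m (G0 C') (G0 C)" "V m \<Omega> = H m \<alpha>" by blast
    then have "m = n \<and> C = A \<and> C' = A'" using hom_cells_unique_objects[OF A \<alpha>] by blast
    then show "\<Omega> = \<Psi>" using * assms(3,4) faithful[OF lift_object(1)[OF A'] lift_object(1)[OF A], of \<Omega> n \<Psi>] by simp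
  qed
  ultimately show ?thesis by (simp add: G_def)
qed

lemma G_cell:
  assumes A: "A \<in> Cell L 0" and \<alpha>: "\<alpha> \<in> hom_cells L n A A'"
  shows "G \<alpha> \<in> hom_cells L' n (G0 A') (G0 A)" and V_G: "V n (G \<alpha>) = H n \<alpha>"
  using G_exists[OF assms] G_eqI[OF assms] by auto

lemma G_dm:
  assumes A: "A \<in> Cell L 0" and \<alpha>: "\<alpha> \<in> hom_cells L (Suc n) A A'"
  shows "G (dm L \<alpha>) = dm L' (G \<alpha>)"
  using L'.cat_dm_hom_from_at[of B0 "Suc n" "G \<alpha>"] V_G[OF assms]
  by (intro G_eqI[OF A L.hom_cells_dm[OF \<alpha>]]) (auto intro: L'.hom_cells_dm G_cell[OF assms] simp del: hom_from_at.simps)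

lemma G_cd:
  assumes A: "A \<in> Cell L 0" and \<alpha>: "\<alpha> \<in> hom_cells L (Suc n) A A'"
  shows "G (cd L \<alpha>) = cd L' (G \<alpha>)"
  using L'.cat_cd_hom_from_at[of B0 "Suc n" "G \<alpha>"] V_G[OF assms]
  by (intro G_eqI[OF A L.hom_cells_cd[OF \<alpha>]]) (auto intro: L'.hom_cells_cd G_cell[OF assms] simp del: hom_from_at.simps)

lemma G_idn:
  assumes A: "A \<in> Cell L 0" and \<alpha>: "\<alpha> \<in> hom_cells L n A A'"
  shows "G (idn L \<alpha>) = idn L' (G \<alpha>)"
proof (rule G_eqI[OF A L.hom_cells_idn[OF \<alpha>]])
  have A': "A' \<in> Cell L 0" using L.hom_cells_target A \<alpha> .
  show "idn L' (G \<alpha>) \<in> hom_cells L' (Suc n) (G0 A') (G0 A)" using L'.hom_cells_idn G_cell[OF assms] by blast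
  show "V (Suc n) (idn L' (G \<alpha>)) = H (Suc n) (idn L \<alpha>)"
    using L'.hom_from_at_idn[OF objects(3) lift_object(1)[OF A'] G_cell(1)[OF assms]] V_G[OF assms]
      L.hom_to_at_idn[OF objects(2) A \<alpha>] by (simp del: hom_from_at.simps hom_to_at.simps)
qed

lemma G_idn_object:
  assumes A: "A \<in> Cell L 0"
  shows "G (idn L A) = idn L' (G0 A)"
proof (rule G_eqI[OF A, of _ 0 A])
  note X = lift_object(1)[OF A]
  show "idn L A \<in> hom_cells L 0 A A" using A by (simp add: L.hom_cells_iff L.idn_cell L.dm_idn L.cd_idn)
  show "idn L' (G0 A) \<in> hom_cells L' 0 (G0 A) (G0 A)" using X by (simp add: L'.hom_cells_iff L'.idn_cell L'.dm_idn L'.cd_idn)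
  show "V 0 (idn L' (G0 A)) = H 0 (idn L A)"
    using L'.hom_from_at_idn_object[OF objects(3) X] L.hom_to_at_idn_object[OF objects(2) A] lift_object(2)[OF A]
    by (simp del: hom_from_at.simps(2) hom_to_at.simps(2))
qed

lemma G_idn_pow:
  assumes A: "A \<in> Cell L 0" and \<alpha>: "\<alpha> \<in> hom_cells L n A A'"
  shows "G ((idn L ^^ k) \<alpha>) = (idn L' ^^ k) (G \<alpha>)"
  using G_idn[OF A L.hom_cells_idn_pow[OF \<alpha>]] by (induction k) simp_all

lemma G_mu:
  assumes A: "A \<in> Cell L 0" and \<alpha>: "\<alpha> \<in> hom_cells L n A' A''" and \<beta>: "\<beta> \<in> hom_cells L n A A'"
  shows "G (mu L n \<alpha> \<beta>) = mu L' n (G \<beta>) (G \<alpha>)"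
proof (rule G_eqI[OF A L.mu_cell[OF A \<alpha> \<beta>]])
  have A': "A' \<in> Cell L 0" using L.hom_cells_target A \<beta> .
  have A'': "A'' \<in> Cell L 0" using L.hom_cells_target A' \<alpha> .
  show "mu L' n (G \<beta>) (G \<alpha>) \<in> hom_cells L' n (G0 A'') (G0 A)"
    using L'.mu_cell[OF lift_object(1)[OF A''] G_cell(1)[OF A \<beta>] G_cell(1)[OF A' \<alpha>]] .
  show "V n (mu L' n (G \<beta>) (G \<alpha>)) = H n (mu L n \<alpha> \<beta>)"
    using L'.hom_from_at_mu[OF objects(3) lift_object(1)[OF A''] G_cell(1)[OF A \<beta>] G_cell(1)[OF A' \<alpha>]]
      L.hom_to_at_mu[OF objects(2) A \<alpha> \<beta>] V_G[OF A \<beta>] V_G[OF A' \<alpha>] by simp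
qed

lemma G_cmp:
  assumes A: "A \<in> Cell L 0" and c: "composable (hom L A A') k n \<alpha> \<beta>"
  shows "G (cmp L k \<alpha> \<beta>) = cmp L' k (G \<alpha>) (G \<beta>)"
proof (rule G_eqI[OF A L.cmp_hom_cell[OF A c]])
  have p: "\<alpha> \<in> hom_cells L n A A'" "\<beta> \<in> hom_cells L n A A'" using c by (auto simp: composable_def)
  have A': "A' \<in> Cell L 0" using L.hom_cells_target A p(1) .
  interpret M: globular "hom L A A'" using L.globular_hom[OF A] .
  have c': "composable (hom L' (G0 A') (G0 A)) k n (G \<alpha>) (G \<beta>)"
  proof (rule M.composable_map_graded[OF _ _ c])
    show "graded (hom L A A') (hom L' (G0 A') (G0 A)) G" using G_cell(1)[OF A] by (simp add: graded_def)
    fix n x assume "x \<in> Cell (hom L A A') (Suc n)"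
    then have x: "x \<in> hom_cells L (Suc n) A A'" by simp
    show "G (dm (hom L A A') x) = dm (hom L' (G0 A') (G0 A)) (G x) \<and> G (cd (hom L A A') x) = cd (hom L' (G0 A') (G0 A)) (G x)"
      using dm_hom[OF x] cd_hom[OF x] dm_hom[OF G_cell(1)[OF A x]] cd_hom[OF G_cell(1)[OF A x]] G_dm[OF A x] G_cd[OF A x] by simp
  qed
  show "cmp L' k (G \<alpha>) (G \<beta>) \<in> hom_cells L' n (G0 A') (G0 A)"
    using L'.cmp_hom_cell[OF lift_object(1)[OF A'] c'] .
  show "V n (cmp L' k (G \<alpha>) (G \<beta>)) = H n (cmp L k \<alpha> \<beta>)"
    using L'.hom_from_at_cmp[OF objects(3) lift_object(1)[OF A'] c'] L.hom_to_at_cmp[OF objects(2) A c]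
      V_G[OF A p(1)] V_G[OF A p(2)] by simp
qed

lemma strict_functor_G: "strict_functor (opp L) L' G"
  unfolding strict_functor_def L.Cell_opp
proof (intro conjI allI ballI impI)
  have cell: "G x \<in> Cell L' n" if x: "x \<in> Cell L n" for x n
  proof (cases n)
    case 0
    then show ?thesis using x lift_object(1) G_object by simp
  next
    case (Suc m)
    obtain A A' where *: "A \<in> Cell L 0" "A' \<in> Cell L 0" "x \<in> hom_cells L m A A'" using L.cell_in_hom x Suc by blast
    show ?thesis using L'.hom_cells_Cell[OF lift_object(1)[OF *(2)] G_cell(1)[OF *(1,3)]] Suc by simp
  qed
  fix n x
  show "G x \<in> Cell L' n" if "x \<in> Cell L n" using cell[OF that] .
  show "G (idn (opp L) x) = idn L' (G x)" if x: "x \<in> Cell L n"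
  proof -
    have "G (idn L x) = idn L' (G x)"
    proof (cases n)
      case 0
      then show ?thesis using G_idn_object G_object x by simp
    next
      case (Suc m)
      then show ?thesis using G_idn L.cell_in_hom x by metis
    qed
    then show ?thesis using L.idn_opp[OF x] by simp
  qed
  show "G (dm (opp L) x) = dm L' (G x)" "G (cd (opp L) x) = cd L' (G x)" if x: "x \<in> Cell L (Suc n)"
  proof -
    obtain A A' where *: "A \<in> Cell L 0" "A' \<in> Cell L 0" "x \<in> hom_cells L n A A'" using L.cell_in_hom x by blast
    have "G (dm (opp L) x) = dm L' (G x) \<and> G (cd (opp L) x) = cd L' (G x)"
    proof (cases n)
      case 0
      have "dm L x = A" "cd L x = A'" "dm L' (G x) = G0 A'" "cd L' (G x) = G0 A"
        using * 0 G_cell(1)[OF *(1,3)] lift_object(1)[OF *(2)] by (simp_all add: L.hom_cells_iff L'.hom_cells_iff)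
      then show ?thesis using L.dm_opp[OF x] L.cd_opp[OF x] 0 G_object * by simp
    next
      case (Suc m)
      then show ?thesis using L.dm_opp[OF x] L.cd_opp[OF x] G_dm[OF *(1), of x m A'] G_cd[OF *(1), of x m A'] * by simp
    qed
    then show "G (dm (opp L) x) = dm L' (G x)" "G (cd (opp L) x) = cd L' (G x)" by blast+
  qed
next
  fix k n x y assume c: "composable (opp L) k n x y"
  obtain m where n: "n = Suc m" using c by (cases n) (auto simp: composable_def)
  show "G (cmp (opp L) k x y) = cmp L' k (G x) (G y)"
  proof (cases "k = n")
    case True
    have yx: "composable L (Suc m) (Suc m) y x" using c True n by (simp add: L.composable_opp_iff)
    have "y \<in> Cell L (Suc m)" using yx by (simp add: composable_def)
    then obtain A' A'' where y: "A' \<in> Cell L 0" "y \<in> hom_cells L m A' A''" using L.cell_in_hom by blast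
    have "x \<in> Cell L (Suc m)" using yx by (simp add: composable_def)
    then obtain A A1 where x: "A \<in> Cell L 0" "x \<in> hom_cells L m A A1" using L.cell_in_hom by blast
    have "A1 = A'" using yx x y L.hom_cells_iff unfolding composable_def by metis
    then have "G (cmp L (Suc m) y x) = cmp L' (Suc m) (G x) (G y)" using G_mu[OF x(1) y(2), of x] x by (simp add: mu_def)
    then show ?thesis using L.cmp_opp[OF c] True n by simp
  next
    case False
    have xy: "composable L k (Suc m) x y" using c n False by (simp add: L.composable_opp_iff)
    moreover have "k \<le> m" using xy False n unfolding composable_def by simp
    ultimately have xy: "composable L k (Suc m) x y" "k \<le> m" .
    obtain A A' where "A \<in> Cell L 0" "composable (hom L A A') k m x y"
      using composable_in_homE[OF L.globular_axioms xy] by blast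
    then show ?thesis using G_cmp L.cmp_opp[OF c] False by simp
  qed
qed

lemma V_G_all: "\<alpha> \<in> Cell L n \<Longrightarrow> hom_from_at L' B0 n (G \<alpha>) = hom_to_at L At n \<alpha>"
proof (cases n)
  case 0
  moreover assume "\<alpha> \<in> Cell L n"
  ultimately show ?thesis using G_object lift_object(2) by simp
next
  case (Suc m)
  moreover assume "\<alpha> \<in> Cell L n"
  ultimately show ?thesis using V_G L.cell_in_hom by metis
qed

end

section \<open>Transposition\<close>

text \<open>Both halves together. The prefix \<open>D\<close> marks the dual one, in which \<open>eta Y\<close> is the lifted evaluation cone of
  \<open>Y\<close>; the functor \<open>F\<close> is \<open>D.G\<close>.\<close>

locale duality =
  half_lifting B L A0 At L' B0 Bt th G0 eps +
  D: half_lifting B L' B0 Bt L A0 At th' F0 eta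
  for B :: "'x cat_cell cells" and L A0 At L' B0 Bt th G0 eps th' F0 eta +
  assumes th_inverse: "w \<in> all_cells (hom L A0 At) \<Longrightarrow> th' (th w) = w"
    "w \<in> all_cells (hom L' B0 Bt) \<Longrightarrow> th (th' w) = w"
begin

text \<open>Statements about transposing from \<open>L\<close> to \<open>L'\<close> thereby give the same ones for the opposite direction.\<close>

lemma swap: "duality B L' B0 Bt L A0 At th' F0 eta th G0 eps"
  using th_inverse by (intro duality.intro half_lifting_axioms D.half_lifting_axioms duality_axioms.intro) auto

lemma hom_cells_lift:
  assumes "Y \<in> Cell L' 0" shows "hom_cells L n A0 (F0 Y) = hom_cells L' n Y Bt"
  using arg_cong[OF D.lift_object(2)[OF assms], of "\<lambda>M. Cell M n"] by simp

text \<open>The cell \<open>y \<mapsto> \<eta>(y) \<circ> \<Phi>\<close> of \<open>B\<close> that underlies the transpose of \<open>\<Phi>\<close>.\<close>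

abbreviation transpose_cell where
  "transpose_cell Y n \<Phi> \<equiv> pre (hom L' B0 Y) (eta Y) (H n \<Phi>)"

lemma eta_graded: "Y \<in> Cell L' 0 \<Longrightarrow> graded (hom L' B0 Y) (hom L (F0 Y) At) (eta Y)"
  using inf_functor_graded[OF D.eps_functor] .

text \<open>Composing with \<open>\<eta>(y)\<close> is the lift of the evaluation at \<open>y\<close>, that is, of composition with \<open>y\<close> followed by \<open>\<theta>'\<close>; and
  \<open>\<theta>\<close> undoes \<open>\<theta>'\<close>. Components are needed where \<open>y\<close> is an object of its hom and \<open>z\<close> is arbitrary, and, in the next
  lemma, the other way round.\<close>

lemma eta_evaluates:
  assumes Y: "Y \<in> Cell L' 0" and z: "z \<in> hom_cells L' n Y Bt" and y: "y \<in> hom_cells L' 0 B0 Y"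
  shows "th (mu L n ((idn L ^^ n) (eta Y y)) z) = mu L' n z ((idn L' ^^ n) y)"
proof -
  have z': "z \<in> hom_cells L n A0 (F0 Y)" using z hom_cells_lift[OF Y] by simp
  note F = D.lift_object(1)[OF Y]
  note e = D.eps_cell[OF Y y]
  have m: "mu L' n z ((idn L' ^^ n) y) \<in> hom_cells L' n B0 Bt"
    using L'.mu_cell[OF objects(3) z L'.idn_pow_hom_cells[OF y]] .
  have "mu L n ((idn L ^^ n) (eta Y y)) z = cat_map (hom_from_at L A0 (Suc 0) (eta Y y)) z"
    using L.hom_from_at_map_cells[OF e objects(1) F z'] by simp
  also have "\<dots> = th' (cat_map (D.H 0 y) z)"
    unfolding D.V_eps[OF Y y] using D.H_Cell[OF objects(3) y] L'.hom_to_at_dom_cod[OF objects(4,3) y] z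
    by (auto elim!: cat_Cell_1E simp: all_cells_def simp del: hom_to_at.simps)
  also have "cat_map (D.H 0 y) z = mu L' n z ((idn L' ^^ n) y)"
    using L'.hom_to_at_map_cells[OF objects(4,3) y z] .
  finally show ?thesis using th_inverse(2) m by (auto simp: all_cells_def)
qed

lemma eta_evaluates_object:
  assumes Y: "Y \<in> Cell L' 0" and z: "z \<in> hom_cells L' 0 Y Bt" and y: "y \<in> hom_cells L' p B0 Y"
  shows "th (mu L p (eta Y y) ((idn L ^^ p) z)) = mu L' p ((idn L' ^^ p) z) y"
proof -
  have z': "z \<in> hom_cells L 0 A0 (F0 Y)" using z hom_cells_lift[OF Y] by simp
  note F = D.lift_object(1)[OF Y]
  note e = D.eps_cell[OF Y y]
  have m: "mu L' p ((idn L' ^^ p) z) y \<in> hom_cells L' p B0 Bt"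
    using L'.mu_cell[OF objects(3) L'.idn_pow_hom_cells[OF z] y] .
  have "mu L p (eta Y y) ((idn L ^^ p) z) = cat_map (hom_from_at L A0 (Suc p) (eta Y y)) z"
    using L.hom_from_at_map_objects[OF e objects(1) F z'] by simp
  also have "\<dots> = th' (cat_map (D.H p y) z)"
    unfolding D.V_eps[OF Y y] using cat_map_post[OF D.H_Cell[OF objects(3) y], of z] L'.hom_to_at_dom_cod[OF objects(4,3) y] z
    by (simp del: hom_to_at.simps)
  also have "cat_map (D.H p y) z = mu L' p ((idn L' ^^ p) z) y"
    using L'.hom_to_at_map_objects[OF objects(4,3) y z] .
  finally show ?thesis using th_inverse(2) m by (auto simp: all_cells_def)
qed

text \<open>The identity \<open>\<theta>(\<eta>(y) \<circ> z) = z \<circ> y\<close> as one between cells of \<open>B\<close>. The cell \<open>z\<close> is read on the left in \<open>L(A0,F Y)\<close> and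
  on the right in \<open>L'(Y,Bt)\<close>; these two hom-categories are equal because \<open>F\<close> lifts the object \<open>L'(Y,Bt)\<close>.\<close>

lemma evaluation_identity:
  assumes Y: "Y \<in> Cell L' 0" and "z \<in> hom_cells L' n Y Bt"
  shows "post (hom L' B0 Bt) th (transpose_cell Y n z) = V n z"
  using assms(2)
proof (induction n arbitrary: z)
  case 0
  have z': "z \<in> hom_cells L 0 A0 (F0 Y)" using 0 hom_cells_lift[OF Y] by simp
  note F = D.lift_object(1)[OF Y]
  obtain f where f: "H 0 z = CatFun (hom L (F0 Y) At) (hom L A0 At) f"
    using H_Cell[OF objects(1) z'] L.hom_to_at_dom_cod[OF objects(2,1) z'] by (auto elim!: cat_Cell_1E)
  have "th (f (eta Y y)) = mu L' p ((idn L' ^^ p) z) y" if y: "y \<in> hom_cells L' p B0 Y" for y p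
    using eta_evaluates_object[OF Y 0 y] L.hom_to_at_map_cells[OF objects(2,1) z' D.eps_cell[OF Y y]] f by (simp del: hom_to_at.simps)
  then show ?case unfolding f L'.hom_from_at_1[OF 0 objects(3) Y]
    by (auto simp: fun_eq_iff all_cells_def L'.deg_hom[OF objects(3)])
next
  case (Suc n)
  let ?N = "Suc n"
  have z': "z \<in> hom_cells L ?N A0 (F0 Y)" using Suc.prems hom_cells_lift[OF Y] by simp
  note F = D.lift_object(1)[OF Y]
  have dc: "dm L z = dm L' z" "cd L z = cd L' z"
    using dm_hom[OF Suc.prems] dm_hom[OF z'] cd_hom[OF Suc.prems] cd_hom[OF z'] D.lift_object(2)[OF Y] by simp_all
  have h: "H ?N z = CatMod (H n (dm L' z)) (H n (cd L' z)) (cat_map (H ?N z))"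
    using L.hom_to_at_Suc_Suc dc by simp
  have "th (cat_map (H ?N z) (eta Y y)) = mu L' ?N z ((idn L' ^^ ?N) y)" if y: "y \<in> hom_cells L' 0 B0 Y" for y
    using L.hom_to_at_map_objects[OF objects(2,1) z' D.eps_cell[OF Y y]] eta_evaluates[OF Y Suc.prems y] by simp
  moreover have "dom_cat (transpose_cell Y n (dm L' z)) = hom L' B0 Y"
    using cat_pre_props(1)[OF H_Cell[OF objects(1) L.hom_cells_dm[OF z']]] dc by simp
  ultimately show ?case
    apply (subst h)
    unfolding L'.hom_from_at_Suc_Suc[OF Suc.prems objects(3) Y]
    using Suc.IH[OF L'.hom_cells_dm[OF Suc.prems]] Suc.IH[OF L'.hom_cells_cd[OF Suc.prems]]
    by (simp add: fun_eq_iff del: hom_to_at.simps hom_from_at.simps funpow.simps)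
qed

text \<open>The evaluation at \<open>x\<close> after \<open>y \<mapsto> \<eta>(y) \<circ> \<Phi>\<close> is \<open>y \<mapsto> \<eta>(y) \<circ> (\<Phi> \<circ> x)\<close>, whose image under \<open>\<theta>\<close> is \<open>V (\<Phi> \<circ> x)\<close> by the
  preceding identity.\<close>

lemma transpose_exists:
  assumes A: "A \<in> Cell L 0" and Y: "Y \<in> Cell L' 0" and \<Phi>: "\<Phi> \<in> hom_cells L n A (F0 Y)"
  shows "\<exists>\<Psi> \<in> hom_cells L' n Y (G0 A). V n \<Psi> = transpose_cell Y n \<Phi>"
proof -
  note F = D.lift_object(1)[OF Y]
  note d = L.hom_to_at_dom_cod[OF objects(2) A \<Phi>]
  have e: "(cat_idn ^^ n) (CatFun (hom L' B0 Y) (hom L (F0 Y) At) (eta Y)) \<in> Cell B (Suc n)"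
    using idn_B_pow[OF D.eps_B[OF Y], of n] by simp
  have eq: "cat_cmp (Suc n) (H n \<Phi>) ((cat_idn ^^ n) (CatFun (hom L' B0 Y) (hom L (F0 Y) At) (eta Y))) = transpose_cell Y n \<Phi>"
    using L.cat_cmp_idn_pow_right_to[OF objects(2) A \<Phi> eta_graded[OF Y]] .
  have dd: "dom_cat (H n \<Phi>) = cod_cat ((cat_idn ^^ n) (CatFun (hom L' B0 Y) (hom L (F0 Y) At) (eta Y)))"
    using d cat_idn_pow_CatFun(3) by metis
  have f: "transpose_cell Y n \<Phi> \<in> Cell B (Suc n)"
    using mu_B(2)[OF H_B[OF L.hom_cells_Cell[OF A \<Phi>]] e dd] unfolding eq .
  note h = H_Cell[OF A \<Phi>]
  show ?thesis
  proof (rule lift_cell[OF A Y f])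
    show "dom_cat (transpose_cell Y n \<Phi>) = hom L' B0 Y" "cod_cat (transpose_cell Y n \<Phi>) = hom L A At"
      using cat_pre_props[OF h] d by simp_all
    fix x assume x: "x \<in> hom_cells L n A0 A"
    have m: "mu L n \<Phi> x \<in> hom_cells L' n Y Bt" using L.mu_cell[OF objects(1) \<Phi> x] hom_cells_lift[OF Y] by simp
    have "cat_cmp (Suc n) (H n x) (transpose_cell Y n \<Phi>) = transpose_cell Y n (mu L n \<Phi> x)"
      using cat_cmp_pre[OF H_Cell[OF objects(1) x] h] eta_graded[OF Y] d L.hom_to_at_mu[OF objects(2,1) \<Phi> x] by simp
    then show "\<exists>\<Psi>\<in>hom_cells L' n Y Bt. V n \<Psi> = post (hom L' B0 Bt) th (cat_cmp (Suc n) (H n x) (transpose_cell Y n \<Phi>))"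
      using evaluation_identity[OF Y m] m by auto
  qed
qed

definition \<Theta> :: "'x \<Rightarrow> 'x \<Rightarrow> 'x \<Rightarrow> 'x" where
  "\<Theta> A Y \<Phi> = (THE \<Psi>. \<exists>n. \<Phi> \<in> hom_cells L n A (F0 Y) \<and> \<Psi> \<in> hom_cells L' n Y (G0 A) \<and> V n \<Psi> = transpose_cell Y n \<Phi>)"

lemma \<Theta>_eqI:
  assumes A: "A \<in> Cell L 0" and Y: "Y \<in> Cell L' 0" and \<Phi>: "\<Phi> \<in> hom_cells L n A (F0 Y)"
    and "\<Psi> \<in> hom_cells L' n Y (G0 A)" "V n \<Psi> = transpose_cell Y n \<Phi>"
  shows "\<Theta> A Y \<Phi> = \<Psi>"
  unfolding \<Theta>_def
proof (rule the_equality)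
  show "\<exists>n. \<Phi> \<in> hom_cells L n A (F0 Y) \<and> \<Psi> \<in> hom_cells L' n Y (G0 A) \<and> V n \<Psi> = transpose_cell Y n \<Phi>"
    using assms by blast
  fix \<Omega> assume "\<exists>n. \<Phi> \<in> hom_cells L n A (F0 Y) \<and> \<Omega> \<in> hom_cells L' n Y (G0 A) \<and> V n \<Omega> = transpose_cell Y n \<Phi>"
  then obtain m where *: "\<Phi> \<in> hom_cells L m A (F0 Y)" "\<Omega> \<in> hom_cells L' m Y (G0 A)" "V m \<Omega> = transpose_cell Y m \<Phi>" by blast
  then have "m = n" using L.hom_cells_unique \<Phi> by blast
  then show "\<Omega> = \<Psi>" using * assms(4,5) faithful[OF Y lift_object(1)[OF A], of \<Omega> n \<Psi>] by simp
qed

lemma \<Theta>_cell: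
  assumes A: "A \<in> Cell L 0" and Y: "Y \<in> Cell L' 0" and \<Phi>: "\<Phi> \<in> hom_cells L n A (F0 Y)"
  shows "\<Theta> A Y \<Phi> \<in> hom_cells L' n Y (G0 A)" and V_\<Theta>: "V n (\<Theta> A Y \<Phi>) = transpose_cell Y n \<Phi>"
  using transpose_exists[OF assms] \<Theta>_eqI[OF assms] by auto

lemma strict_functor_\<Theta>:
  assumes A: "A \<in> Cell L 0" and Y: "Y \<in> Cell L' 0"
  shows "strict_functor (hom L A (F0 Y)) (hom L' Y (G0 A)) (\<Theta> A Y)"
proof -
  let ?M = "hom L A (F0 Y)" and ?N = "hom L' Y (G0 A)"
  interpret M: strict_omega ?M using L.strict_omega_hom[OF A] .
  note cell = \<Theta>_cell(1)[OF A Y] and V = V_\<Theta>[OF A Y]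
  note F = D.lift_object(1)[OF Y] and G = lift_object(1)[OF A]
  have dmap: "\<Theta> A Y (dm ?M x) = dm ?N (\<Theta> A Y x) \<and> \<Theta> A Y (cd ?M x) = cd ?N (\<Theta> A Y x)" if "x \<in> Cell ?M (Suc n)" for n x
  proof -
    have x: "x \<in> hom_cells L (Suc n) A (F0 Y)" using that by simp
    have h: "H (Suc n) x = CatMod (H n (dm L x)) (H n (cd L x)) (cat_map (H (Suc n) x))" by simp
    have d: "cat_dm (transpose_cell Y (Suc n) x) = transpose_cell Y n (dm L x)"
      "cat_cd (transpose_cell Y (Suc n) x) = transpose_cell Y n (cd L x)" by (subst h; simp del: hom_to_at.simps)+
    have "V n (dm L' (\<Theta> A Y x)) = transpose_cell Y n (dm L x)" "V n (cd L' (\<Theta> A Y x)) = transpose_cell Y n (cd L x)"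
      using L'.cat_dm_hom_from_at[of B0 "Suc n" "\<Theta> A Y x"] L'.cat_cd_hom_from_at[of B0 "Suc n" "\<Theta> A Y x"] V[OF x] d by simp_all
    then have "\<Theta> A Y (dm L x) = dm L' (\<Theta> A Y x)" "\<Theta> A Y (cd L x) = cd L' (\<Theta> A Y x)"
      using \<Theta>_eqI[OF A Y L.hom_cells_dm[OF x] L'.hom_cells_dm[OF cell[OF x]]]
       \<Theta>_eqI[OF A Y L.hom_cells_cd[OF x] L'.hom_cells_cd[OF cell[OF x]]] by blast+
    then show ?thesis using dm_hom[OF x] cd_hom[OF x] dm_hom[OF cell[OF x]] cd_hom[OF cell[OF x]] by simp
  qed
  have gr: "graded ?M ?N (\<Theta> A Y)" using cell by (simp add: graded_def)
  show ?thesis unfolding strict_functor_def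
  proof (intro conjI allI ballI impI)
    fix n x assume "x \<in> Cell ?M n"
    then have x: "x \<in> hom_cells L n A (F0 Y)" by simp
    show "\<Theta> A Y x \<in> Cell ?N n" using cell[OF x] by simp
    have "V (Suc n) (idn L' (\<Theta> A Y x)) = cat_idn (transpose_cell Y n x)"
      using L'.hom_from_at_idn[OF objects(3) Y cell[OF x]] V[OF x] by simp
    also have "\<dots> = transpose_cell Y (Suc n) (idn L x)"
      using cat_idn_pre[OF H_Cell[OF A x]] eta_graded[OF Y] L.hom_to_at_dom_cod[OF objects(2) A x] L.hom_to_at_idn[OF objects(2) A x] by simp
    finally have "\<Theta> A Y (idn L x) = idn L' (\<Theta> A Y x)"
      using \<Theta>_eqI[OF A Y L.hom_cells_idn[OF x] L'.hom_cells_idn[OF cell[OF x]]] by blast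
    then show "\<Theta> A Y (idn ?M x) = idn ?N (\<Theta> A Y x)" using idn_hom[OF x] idn_hom[OF cell[OF x]] by simp
  next
    fix k n x y assume c: "composable ?M k n x y"
    have x: "x \<in> hom_cells L n A (F0 Y)" "y \<in> hom_cells L n A (F0 Y)" and k: "1 \<le> k" "k \<le> n"
      using c by (auto simp: composable_def)
    have c': "composable ?N k n (\<Theta> A Y x) (\<Theta> A Y y)"
      by (rule M.composable_map_graded[OF gr _ c]) (rule dmap)
    have "V n (cmp L' k (\<Theta> A Y x) (\<Theta> A Y y)) = cat_cmp k (transpose_cell Y n x) (transpose_cell Y n y)"
      using L'.hom_from_at_cmp[OF objects(3) Y c'] V[OF x(1)] V[OF x(2)] by simp
    also have "\<dots> = transpose_cell Y n (cmp L k x y)"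
      using cat_cmp_pre_pre[OF H_Cell[OF A x(1)] H_Cell[OF A x(2)] _ _ k] eta_graded[OF Y]
        L.hom_to_at_dom_cod[OF objects(2) A x(1)] L.hom_to_at_dom_cod[OF objects(2) A x(2)] L.hom_to_at_cmp[OF objects(2) A c] by simp
    finally have "\<Theta> A Y (cmp L k x y) = cmp L' k (\<Theta> A Y x) (\<Theta> A Y y)"
      using \<Theta>_eqI[OF A Y L.cmp_hom_cell[OF A c] L'.cmp_hom_cell[OF Y c']] by blast
    then show "\<Theta> A Y (cmp ?M k x y) = cmp ?N k (\<Theta> A Y x) (\<Theta> A Y y)" using L.cmp_hom[OF c] L'.cmp_hom[OF c'] by simp
  qed (use dmap in blast)+
qed

lemma \<Theta>_idn_pow:
  assumes A: "A \<in> Cell L 0" and Y: "Y \<in> Cell L' 0" and \<Phi>: "\<Phi> \<in> hom_cells L n A (F0 Y)"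
  shows "\<Theta> A Y ((idn L ^^ k) \<Phi>) = (idn L' ^^ k) (\<Theta> A Y \<Phi>)"
proof (induction k)
  case (Suc k)
  let ?x = "(idn L ^^ k) \<Phi>"
  have x: "?x \<in> hom_cells L (n + k) A (F0 Y)" using L.hom_cells_idn_pow[OF \<Phi>] .
  have "\<Theta> A Y (idn (hom L A (F0 Y)) ?x) = idn (hom L' Y (G0 A)) (\<Theta> A Y ?x)"
    using strict_functor_\<Theta>[OF A Y] x unfolding strict_functor_def Cell_hom by blast
  then show ?case using idn_hom[OF x] idn_hom[OF \<Theta>_cell(1)[OF A Y x]] Suc by simp
qed simp

text \<open>On underlying cells both sides are \<open>y \<mapsto> \<eta>(y) \<circ> \<Phi> \<circ> f\<close>.\<close>

lemma \<Theta>_natural_in_A: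
  assumes A: "A \<in> Cell L 0" and Y: "Y \<in> Cell L' 0" and f: "f \<in> hom_cells L n A A'" and \<Phi>: "\<Phi> \<in> hom_cells L n A' (F0 Y)"
  shows "\<Theta> A Y (mu L n \<Phi> f) = mu L' n (G f) (\<Theta> A' Y \<Phi>)"
proof (rule \<Theta>_eqI[OF A Y L.mu_cell[OF A \<Phi> f]])
  have A': "A' \<in> Cell L 0" using L.hom_cells_target A f .
  note c = \<Theta>_cell(1)[OF A' Y \<Phi>] and g = G_cell(1)[OF A f]
  show "mu L' n (G f) (\<Theta> A' Y \<Phi>) \<in> hom_cells L' n Y (G0 A)" using L'.mu_cell[OF Y g c] .
  show "V n (mu L' n (G f) (\<Theta> A' Y \<Phi>)) = transpose_cell Y n (mu L n \<Phi> f)"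
    using L'.hom_from_at_mu[OF objects(3) Y g c] V_G[OF A f] V_\<Theta>[OF A' Y \<Phi>] L.hom_to_at_mu[OF objects(2) A \<Phi> f]
      cat_cmp_pre[OF H_Cell[OF A f] H_Cell[OF A' \<Phi>], of "hom L' B0 Y" "eta Y"] eta_graded[OF Y] L.hom_to_at_dom_cod[OF objects(2) A' \<Phi>] by simp
qed

lemma faithful_hom:
  assumes Y: "Y \<in> Cell L' 0" "x \<in> hom_cells L' n Y Bt" "y \<in> hom_cells L' n Y Bt" "V n x = V n y"
  shows "x = y"
  using faithful[OF Y(1) objects(4)] assms by blast

text \<open>For \<open>\<Phi>\<close> of hom-degree 0 the components of \<open>U \<Phi>\<close> are taken at cells \<open>x\<close> of all degrees. After applying \<open>V\<close>, the
  right hand side is the functor \<open>V \<Psi>\<close> followed by \<open>V (\<epsilon>(x))\<close>. The latter is a value of the hom-functor \<open>V\<close>, so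
  whiskering on its right is available although it has the form \<open>\<theta> * L(x,At)\<close> with a weak functor \<open>\<theta>\<close>.\<close>

lemma transpose_component_cells:
  assumes A: "A \<in> Cell L 0" and Y: "Y \<in> Cell L' 0" and \<Phi>: "\<Phi> \<in> hom_cells L 0 A (F0 Y)" and \<Psi>: "\<Psi> \<in> hom_cells L' 0 Y (G0 A)"
    and V: "V 0 \<Psi> = transpose_cell Y 0 \<Phi>" and x: "x \<in> hom_cells L p A0 A"
  shows "mu L p ((idn L ^^ p) \<Phi>) x = mu L' p (eps A x) ((idn L' ^^ p) \<Psi>)"
proof -
  let ?W = "hom L' B0 Y" and ?X = "hom L (F0 Y) At" and ?Y = "hom L A At"
  note F = D.lift_object(1)[OF Y] and G = lift_object(1)[OF A]
  note e = eps_cell[OF A x] and i = L.idn_pow_hom_cells[OF \<Phi>, of p] and i' = L'.idn_pow_hom_cells[OF \<Psi>, of p]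
  have m: "mu L p ((idn L ^^ p) \<Phi>) x \<in> hom_cells L' p Y Bt" using L.mu_cell[OF objects(1) i x] hom_cells_lift[OF Y] by simp
  note hx = H_Cell[OF objects(1) x] and hxd = L.hom_to_at_dom_cod[OF objects(2,1) x]
  obtain f where f: "H 0 \<Phi> = CatFun ?X ?Y f" "inf_functor ?X ?Y f"
    using H_Cell[OF A \<Phi>] L.hom_to_at_dom_cod[OF objects(2) A \<Phi>] by (auto elim!: cat_Cell_1E)
  let ?g = "restrict (f \<circ> eta Y) (all_cells ?W)"
  have V0: "V 0 \<Psi> = CatFun ?W (hom L' B0 (G0 A)) ?g"
    by (simp only: V f(1) pre.simps lift_object(2)[OF A])
  have gg: "graded ?W (hom L' B0 (G0 A)) ?g"
    using Cell_B[OF V_B[OF L'.hom_cells_Cell[OF Y \<Psi>]]] unfolding V0 by (auto intro: inf_functor_graded)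
  have "V p (mu L' p (eps A x) ((idn L' ^^ p) \<Psi>)) = cat_cmp (Suc p) (V p (eps A x)) ((cat_idn ^^ p) (V 0 \<Psi>))"
    using L'.hom_from_at_mu[OF objects(3) Y e i'] L'.hom_from_at_idn_pow[OF objects(3) Y \<Psi>, of p] by simp
  also have "\<dots> = pre ?W ?g (V p (eps A x))"
    unfolding V0 by (rule L'.cat_cmp_idn_pow_right[OF objects(3) G e gg])
  also have "\<dots> = post (hom L' B0 Bt) th (pre ?W ?g (H p x))"
    unfolding V_eps[OF A x] using pre_post[OF hx] gg hxd lift_object(2)[OF A] by simp
  also have "pre ?W ?g (H p x) = pre ?W (f \<circ> eta Y) (H p x)" by (rule pre_cong[OF hx]) simp
  also have "\<dots> = pre ?W (eta Y) (pre ?X f (H p x))" using pre_pre[OF hx eta_graded[OF Y]] by simp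
  also have "pre ?X f (H p x) = cat_cmp (Suc p) (H p x) ((cat_idn ^^ p) (CatFun ?X ?Y f))"
    using L.cat_cmp_idn_pow_right_to[OF objects(2,1) x inf_functor_graded[OF f(2)]] by simp
  also have "\<dots> = H p (mu L p ((idn L ^^ p) \<Phi>) x)"
    using L.hom_to_at_mu[OF objects(2,1) i x] L.hom_to_at_idn_pow[OF objects(2) A \<Phi>, of p] f(1) by (simp del: hom_to_at.simps)
  finally have "V p (mu L' p (eps A x) ((idn L' ^^ p) \<Psi>)) = V p (mu L p ((idn L ^^ p) \<Phi>) x)"
    using evaluation_identity[OF Y m] by simp
  then show ?thesis using faithful_hom[OF Y m L'.mu_cell[OF Y e i']] by simp
qed

text \<open>For \<open>\<Phi>\<close> of positive hom-degree, \<open>x\<close> is an object of \<open>L(A0,A)\<close>. After applying \<open>V\<close>, the right hand side is \<open>V \<Psi>\<close>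
  followed by the weak functor \<open>V (\<epsilon>(x)) = \<theta> * L(x,At)\<close>, to which whiskering on the left applies.\<close>

lemma transpose_component_objects:
  assumes A: "A \<in> Cell L 0" and Y: "Y \<in> Cell L' 0" and \<Phi>: "\<Phi> \<in> hom_cells L n A (F0 Y)" and \<Psi>: "\<Psi> \<in> hom_cells L' n Y (G0 A)"
    and V: "V n \<Psi> = transpose_cell Y n \<Phi>" and x: "x \<in> hom_cells L 0 A0 A"
  shows "mu L n \<Phi> ((idn L ^^ n) x) = mu L' n ((idn L' ^^ n) (eps A x)) \<Psi>"
proof -
  let ?Z = "hom L' B0 Bt" and ?Y = "hom L A0 At" and ?T = "hom L A At"
  note F = D.lift_object(1)[OF Y] and G = lift_object(1)[OF A]
  note e = eps_cell[OF A x] and i = L.idn_pow_hom_cells[OF x, of n]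
  note i' = L'.idn_pow_hom_cells[OF e, of n]
  have m: "mu L n \<Phi> ((idn L ^^ n) x) \<in> hom_cells L' n Y Bt" using L.mu_cell[OF objects(1) \<Phi> i] hom_cells_lift[OF Y] by simp
  obtain f where f: "H 0 x = CatFun ?T ?Y f" "inf_functor ?T ?Y f"
    using H_Cell[OF objects(1) x] L.hom_to_at_dom_cod[OF objects(2,1) x] by (auto elim!: cat_Cell_1E)
  let ?g = "restrict (th \<circ> f) (all_cells ?T)"
  have V0: "V 0 (eps A x) = CatFun ?T ?Z ?g" unfolding V_eps[OF A x] f by simp
  have gf: "inf_functor ?T ?Z ?g"
    using Cell_B[OF V_B[OF L'.hom_cells_Cell[OF G e]]] unfolding V0 by auto
  note v = V_Cell[OF Y \<Psi>]
  have vc: "cod_cat (V n \<Psi>) = ?T" using L'.hom_from_at_dom_cod[OF \<Psi> Y] lift_object(2)[OF A] by simp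
  have "V n (mu L' n ((idn L' ^^ n) (eps A x)) \<Psi>) = cat_cmp (Suc n) ((cat_idn ^^ n) (V 0 (eps A x))) (V n \<Psi>)"
    using L'.hom_from_at_mu[OF objects(3) Y i' \<Psi>] L'.hom_from_at_idn_pow[OF objects(3) G e, of n] by simp
  also have "\<dots> = post ?Z ?g (V n \<Psi>)"
    unfolding V0 by (rule cat_cmp_idn_pow_left[OF v vc L'.strict_omega_hom[OF objects(3)] gf])
  also have "\<dots> = post ?Z (th \<circ> f) (V n \<Psi>)" by (rule post_cong[OF v]) (simp add: vc)
  also have "\<dots> = post ?Z th (post ?Y f (V n \<Psi>))" using post_post[OF v] by simp
  also have "post ?Y f (V n \<Psi>) = pre (hom L' B0 Y) (eta Y) (post ?Y f (H n \<Phi>))"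
    unfolding V using pre_post[OF H_Cell[OF A \<Phi>]] eta_graded[OF Y] L.hom_to_at_dom_cod[OF objects(2) A \<Phi>] by simp
  also have "post ?Y f (H n \<Phi>) = cat_cmp (Suc n) ((cat_idn ^^ n) (H 0 x)) (H n \<Phi>)"
    unfolding f(1) using cat_cmp_idn_pow_left[OF H_Cell[OF A \<Phi>] _ L.strict_omega_hom[OF objects(1)] f(2)] L.hom_to_at_dom_cod[OF objects(2) A \<Phi>] by simp
  also have "\<dots> = H n (mu L n \<Phi> ((idn L ^^ n) x))"
    using L.hom_to_at_mu[OF objects(2,1) \<Phi> i] L.hom_to_at_idn_pow[OF objects(2,1) x, of n] by simp
  finally have "V n (mu L' n ((idn L' ^^ n) (eps A x)) \<Psi>) = V n (mu L n \<Phi> ((idn L ^^ n) x))"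
    using evaluation_identity[OF Y m] by simp
  then show ?thesis using faithful_hom[OF Y m L'.mu_cell[OF Y i' \<Psi>]] by simp
qed

text \<open>Being transposes is a symmetric relation: \<open>\<Psi>\<close> lies over \<open>y \<mapsto> \<eta>(y) \<circ> \<Phi>\<close> only if \<open>\<Phi>\<close> lies over \<open>x \<mapsto> \<epsilon>(x) \<circ> \<Psi>\<close>.
  Sources and targets are compared by induction on the degree, components by the two lemmas above.\<close>

lemma transpose_symmetric:
  assumes A: "A \<in> Cell L 0" and Y: "Y \<in> Cell L' 0" and "\<Phi> \<in> hom_cells L n A (F0 Y)" and "\<Psi> \<in> hom_cells L' n Y (G0 A)"
    and "V n \<Psi> = transpose_cell Y n \<Phi>"
  shows "D.V n \<Phi> = pre (hom L A0 A) (eps A) (D.H n \<Psi>)"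
  using assms(3-5)
proof (induction n arbitrary: \<Phi> \<Psi>)
  case 0
  note G = lift_object(1)[OF A]
  obtain f where f: "D.H 0 \<Psi> = CatFun (hom L' (G0 A) Bt) (hom L A0 (F0 Y)) f"
    using D.H_Cell[OF Y 0(2)] L'.hom_to_at_dom_cod[OF objects(4) Y 0(2)] D.lift_object(2)[OF Y] by (auto elim!: cat_Cell_1E)
  have "mu L p ((idn L ^^ p) \<Phi>) x = f (eps A x)" if x: "x \<in> hom_cells L p A0 A" for x p
    using transpose_component_cells[OF A Y 0 x] L'.hom_to_at_map_cells[OF objects(4) Y 0(2) eps_cell[OF A x]] f by (simp del: hom_to_at.simps)
  then show ?case unfolding f L.hom_from_at_1[OF 0(1) objects(1) A]
    by (auto simp: fun_eq_iff all_cells_def L.deg_hom[OF objects(1)])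
next
  case (Suc n)
  let ?N = "Suc n"
  have h: "H ?N \<Phi> = CatMod (H n (dm L \<Phi>)) (H n (cd L \<Phi>)) (cat_map (H ?N \<Phi>))"
    "D.H ?N \<Psi> = CatMod (D.H n (dm L' \<Psi>)) (D.H n (cd L' \<Psi>)) (cat_map (D.H ?N \<Psi>))" by simp_all
  have d: "cat_dm (transpose_cell Y ?N \<Phi>) = transpose_cell Y n (dm L \<Phi>)"
      "cat_cd (transpose_cell Y ?N \<Phi>) = transpose_cell Y n (cd L \<Phi>)" by (subst h(1); simp del: hom_to_at.simps)+
  have v: "V n (dm L' \<Psi>) = transpose_cell Y n (dm L \<Phi>)" "V n (cd L' \<Psi>) = transpose_cell Y n (cd L \<Phi>)"
    using L'.cat_dm_hom_from_at[of B0 ?N \<Psi>] L'.cat_cd_hom_from_at[of B0 ?N \<Psi>] Suc.prems(3) d by simp_all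
  have "mu L ?N \<Phi> ((idn L ^^ ?N) x) = cat_map (D.H ?N \<Psi>) (eps A x)" if x: "x \<in> hom_cells L 0 A0 A" for x
    using transpose_component_objects[OF A Y Suc.prems x] L'.hom_to_at_map_objects[OF objects(4) Y Suc.prems(2) eps_cell[OF A x]] by simp
  then show ?case
    apply (subst h(2))
    unfolding L.hom_from_at_Suc_Suc[OF Suc.prems(1) objects(1) A]
    using Suc.IH[OF L.hom_cells_dm[OF Suc.prems(1)] L'.hom_cells_dm[OF Suc.prems(2)] v(1)]
      Suc.IH[OF L.hom_cells_cd[OF Suc.prems(1)] L'.hom_cells_cd[OF Suc.prems(2)] v(2)]
    by (simp add: fun_eq_iff del: hom_to_at.simps hom_from_at.simps funpow.simps)
qed

end

section \<open>Naturality\<close>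

text \<open>The lifting constructed for the second category is a functor from its opposite; this moves the
  opposite to the other side.\<close>

lemma strict_functor_opp:
  assumes L: "strict_omega L" and M: "strict_omega M" and F: "strict_functor (opp L) M F"
  shows "strict_functor L (opp M) F"
proof -
  interpret L: strict_omega L by fact
  interpret M: strict_omega M by fact
  interpret O: strict_omega "opp L" by (rule L.strict_omega_opp)
  have gr: "graded (opp L) M F" and cell: "x \<in> Cell L n \<Longrightarrow> F x \<in> Cell M n"
    and d: "x \<in> Cell L (Suc n) \<Longrightarrow> F (dm (opp L) x) = dm M (F x)" "x \<in> Cell L (Suc n) \<Longrightarrow> F (cd (opp L) x) = cd M (F x)"
    and i: "x \<in> Cell L n \<Longrightarrow> F (idn (opp L) x) = idn M (F x)"
    and c: "composable (opp L) k n x y \<Longrightarrow> F (cmp (opp L) k x y) = cmp M k (F x) (F y)" for x y k n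
    using F by (auto simp: strict_functor_def graded_def)
  show ?thesis unfolding strict_functor_def M.Cell_opp
  proof (intro conjI allI ballI impI)
    fix n x assume x: "x \<in> Cell L n"
    show "F x \<in> Cell M n" using cell[OF x] .
    show "F (idn L x) = idn (opp M) (F x)" using i[OF x] L.idn_opp[OF x] M.idn_opp[OF cell[OF x]] by simp
  next
    fix n x assume x: "x \<in> Cell L (Suc n)"
    show "F (dm L x) = dm (opp M) (F x)" "F (cd L x) = cd (opp M) (F x)"
      using d[OF x] L.dm_opp[OF x] L.cd_opp[OF x] M.dm_opp[OF cell[OF x]] M.cd_opp[OF cell[OF x]] by (simp_all split: if_splits)
  next
    fix k n x y assume xy: "composable L k n x y"
    \<comment> \<open>In the opposite category the factors are exchanged exactly when \<open>k\<close> is the degree of the cells.\<close>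
    define u where "u = (if k = n then y else x)"
    define v where "v = (if k = n then x else y)"
    have uv: "composable (opp L) k n u v" using xy by (auto simp: u_def v_def L.composable_opp_iff)
    have 1: "cmp (opp L) k u v = cmp L k x y" using L.cmp_opp[OF uv] by (simp add: u_def v_def)
    have 2: "composable M k n (F u) (F v)" using O.composable_map_graded[OF gr _ uv] d by simp
    have 3: "composable (opp M) k n (F x) (F y)" using 2 by (simp add: u_def v_def M.composable_opp_iff split: if_splits)
    show "F (cmp L k x y) = cmp (opp M) k (F x) (F y)"
      using c[OF uv] 1 M.cmp_opp[OF 3] by (simp add: u_def v_def split: if_splits)
  qed
qed

text \<open>To prove naturality up to equivalence it suffices to give strict component functors and an equality of
  whiskered cells: composing \<open>P f\<close> with the component on its left is \<open>post\<close>, and the resulting cell is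
  equivalent to itself since its target category is strict.\<close>

lemma natural_transformation_CAT:
  fixes X :: "'x cells" and P Q :: "'x \<Rightarrow> 'x cat_cell"
  assumes X: "globular X"
    and obj: "\<And>a. a \<in> Cell X 0 \<Longrightarrow> P a = CatObj (M a) \<and> Q a = CatObj (N a) \<and> inf_category (M a) \<and> inf_category (N a) \<and>
      strict_omega (M a) \<and> strict_omega (N a) \<and> strict_functor (M a) (N a) (K a)"
    and P: "\<And>a b k f. \<lbrakk> a \<in> Cell X 0; b \<in> Cell X 0; f \<in> hom_cells X k a b \<rbrakk> \<Longrightarrow>
      P f \<in> cat_Cell (Suc k) \<and> dom_cat (P f) = M a \<and> cod_cat (P f) = M b"
    and Q: "\<And>a b k f. \<lbrakk> a \<in> Cell X 0; b \<in> Cell X 0; f \<in> hom_cells X k a b \<rbrakk> \<Longrightarrow>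
      Q f \<in> cat_Cell (Suc k) \<and> dom_cat (Q f) = N a \<and> cod_cat (Q f) = N b"
    and square: "\<And>a b k f. \<lbrakk> a \<in> Cell X 0; b \<in> Cell X 0; f \<in> hom_cells X k a b \<rbrakk> \<Longrightarrow>
      post (N b) (K b) (P f) = cat_cmp (Suc k) (Q f) ((cat_idn ^^ k) (CatFun (M a) (N a) (restrict (K a) (all_cells (M a)))))"
  shows "natural_transformation X CAT P Q (\<lambda>a. CatFun (M a) (N a) (restrict (K a) (all_cells (M a))))"
proof -
  let ?h = "\<lambda>a. CatFun (M a) (N a) (restrict (K a) (all_cells (M a)))"
  have hf: "inf_functor (M a) (N a) (restrict (K a) (all_cells (M a)))" if a: "a \<in> Cell X 0" for a
  proof -
    interpret Ma: strict_omega "M a" using obj[OF a] by blast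
    have "inf_functor (M a) (N a) (K a)" using strict_functor_inf_functor obj[OF a] by blast
    then show ?thesis by (rule Ma.inf_functor_cong) (simp_all add: Ma.cmp_cell)
  qed
  have h: "?h a \<in> cat_Cell (Suc 0)" if a: "a \<in> Cell X 0" for a
    using hf[OF a] obj[OF a] by simp
  show ?thesis unfolding modification_def
  proof (intro conjI ballI allI)
    fix a assume a: "a \<in> Cell X 0"
    show "dm CAT (?h a) = P a" "cd CAT (?h a) = Q a" using CAT_ops(1,2)[OF h[OF a]] obj[OF a] by simp_all
    then show "?h a \<in> hom_cells CAT 0 (P a) (Q a)"
      using h[OF a] obj[OF a] by (auto simp: hom_cells_def intro!: exI[of _ 0])
  next
    fix a b k f assume a: "a \<in> Cell X 0" and b: "b \<in> Cell X 0" and f0: "f \<in> hom_cells X (0 + k) a b"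
    then have f: "f \<in> hom_cells X k a b" by simp
    note p = P[OF a b f] and q = Q[OF a b f]
    have ia: "(idn CAT ^^ k) (?h a) = (cat_idn ^^ k) (?h a)" "(cat_idn ^^ k) (?h a) \<in> cat_Cell (Suc k)"
      using idn_CAT_pow[OF h[OF a], of k] obj[OF a] by simp_all
    have ib: "(idn CAT ^^ k) (?h b) = (cat_idn ^^ k) (?h b)" "(cat_idn ^^ k) (?h b) \<in> cat_Cell (Suc k)"
      using idn_CAT_pow[OF h[OF b], of k] obj[OF b] by simp_all
    have W: "post (N b) (K b) (P f) \<in> cat_Cell (Suc k)"
      using obj[OF b] by (intro post_in_cat_Cell[OF conjunct1[OF p] conjunct2[OF conjunct2[OF p]]]) blast+
    have 1: "mu CAT k ((idn CAT ^^ k) (?h b)) (P f) = post (N b) (K b) (P f)"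
    proof -
      have "mu CAT k ((idn CAT ^^ k) (?h b)) (P f) = cat_cmp (Suc k) ((cat_idn ^^ k) (?h b)) (P f)"
        unfolding ib(1) using mu_CAT[OF ib(2) conjunct1[OF p]] p cat_idn_pow_CatFun(2) by metis
      also have "\<dots> = post (N b) (restrict (K b) (all_cells (M b))) (P f)"
        using obj[OF b] by (intro cat_cmp_idn_pow_left[OF conjunct1[OF p] _ _ hf[OF b]]) (use p in \<open>blast+\<close>)
      also have "\<dots> = post (N b) (K b) (P f)"
        by (rule post_cong[OF conjunct1[OF p]]) (simp add: conjunct2[OF conjunct2[OF p]])
      finally show ?thesis .
    qed
    have 2: "mu CAT k (Q f) ((idn CAT ^^ k) (?h a)) = post (N b) (K b) (P f)"
      unfolding ia(1) square[OF a b f] using mu_CAT[OF conjunct1[OF q] ia(2)] q cat_idn_pow_CatFun(3) by metis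
    have "eqv CAT (post (N b) (K b) (P f)) (post (N b) (K b) (P f))"
      using eqv_CAT_refl[OF W] cat_post_props(2)[OF conjunct1[OF p]] obj[OF b] by simp
    then show "eqv CAT (mu CAT (0 + k) ((idn CAT ^^ k) (?h b)) (P f)) (mu CAT (0 + k) (Q f) ((idn CAT ^^ k) (?h a)))"
      using 1 2 by simp
  qed
qed

lemma pre_restrict:
  assumes "\<alpha> \<in> cat_Cell (Suc n)"
  shows "pre W (restrict K (all_cells W)) \<alpha> = pre W K \<alpha>"
  using pre_cong[OF assms, of W "restrict K (all_cells W)" K] by simp

context duality begin

text \<open>The inverse is transposition in the opposite direction. The last property transports naturality from
  the inverse to \<open>\<Theta>\<close>.\<close>

lemma \<Theta>_inverse:
  assumes A: "A \<in> Cell L 0" and Y: "Y \<in> Cell L' 0"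
  obtains K where "strict_functor (hom L' Y (G0 A)) (hom L A (F0 Y)) K"
    and "\<And>n \<Phi>. \<Phi> \<in> hom_cells L n A (F0 Y) \<Longrightarrow> K (\<Theta> A Y \<Phi>) = \<Phi>"
    and "\<And>n \<Psi>. \<Psi> \<in> hom_cells L' n Y (G0 A) \<Longrightarrow> \<Theta> A Y (K \<Psi>) = \<Psi>"
    and "\<And>n g Y' \<Psi>. \<lbrakk> g \<in> hom_cells L' n Y Y'; \<Psi> \<in> hom_cells L' n Y' (G0 A) \<rbrakk> \<Longrightarrow>
      \<exists>\<Phi> \<in> hom_cells L n A (F0 Y'). \<Theta> A Y' \<Phi> = \<Psi> \<and> K (mu L' n \<Psi> g) = mu L n (D.G g) \<Phi>"
proof -
  interpret S: duality B L' B0 Bt L A0 At th' F0 eta th G0 eps by (rule swap)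
  have 1: "S.\<Theta> Y A (\<Theta> A Y \<Phi>) = \<Phi>" if \<Phi>: "\<Phi> \<in> hom_cells L n A (F0 Y)" and Y: "Y \<in> Cell L' 0" for n \<Phi> Y
    using S.\<Theta>_eqI[OF Y A \<Theta>_cell(1)[OF A Y \<Phi>] \<Phi>] transpose_symmetric[OF A Y \<Phi> \<Theta>_cell[OF A Y \<Phi>]] by blast
  have 2: "\<Theta> A Y (S.\<Theta> Y A \<Psi>) = \<Psi>" if \<Psi>: "\<Psi> \<in> hom_cells L' n Y (G0 A)" and Y: "Y \<in> Cell L' 0" for n \<Psi> Y
    using \<Theta>_eqI[OF A Y S.\<Theta>_cell(1)[OF Y A \<Psi>] \<Psi>] S.transpose_symmetric[OF Y A \<Psi> S.\<Theta>_cell[OF Y A \<Psi>]] by blast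
  show thesis
  proof (rule that[of "S.\<Theta> Y A"])
    show "strict_functor (hom L' Y (G0 A)) (hom L A (F0 Y)) (S.\<Theta> Y A)" using S.strict_functor_\<Theta>[OF Y A] .
    fix n g Y' \<Psi> assume g: "g \<in> hom_cells L' n Y Y'" and \<Psi>: "\<Psi> \<in> hom_cells L' n Y' (G0 A)"
    have Y': "Y' \<in> Cell L' 0" using L'.hom_cells_target Y g .
    show "\<exists>\<Phi> \<in> hom_cells L n A (F0 Y'). \<Theta> A Y' \<Phi> = \<Psi> \<and> S.\<Theta> Y A (mu L' n \<Psi> g) = mu L n (D.G g) \<Phi>"
      using S.\<Theta>_natural_in_A[OF Y A g \<Psi>] S.\<Theta>_cell(1)[OF Y' A \<Psi>] 2[OF \<Psi> Y'] by blast
  qed (use 1 2 Y in blast)+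
qed

lemma \<Theta>_iso:
  assumes A: "A \<in> Cell L 0" and Y: "Y \<in> Cell L' 0"
  shows "inf_iso (hom L A (F0 Y)) (hom L' Y (G0 A)) (\<Theta> A Y)"
proof -
  let ?M = "hom L A (F0 Y)" and ?N = "hom L' Y (G0 A)"
  obtain K where K: "strict_functor ?N ?M K"
    "\<And>n \<Phi>. \<Phi> \<in> hom_cells L n A (F0 Y) \<Longrightarrow> K (\<Theta> A Y \<Phi>) = \<Phi>" "\<And>n \<Psi>. \<Psi> \<in> hom_cells L' n Y (G0 A) \<Longrightarrow> \<Theta> A Y (K \<Psi>) = \<Psi>"
    by (rule \<Theta>_inverse[OF assms]) (rule that; assumption)
  interpret M: strict_omega ?M using L.strict_omega_hom[OF A] .
  interpret N: strict_omega ?N using L'.strict_omega_hom[OF Y] .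
  have T: "inf_functor ?M ?N (\<Theta> A Y)" and K': "inf_functor ?N ?M K"
    using strict_functor_inf_functor[OF strict_functor_\<Theta>[OF assms]] strict_functor_inf_functor[OF K(1)]
      M.strict_omega_axioms N.strict_omega_axioms by blast+
  have t: "x \<in> all_cells ?M \<Longrightarrow> \<Theta> A Y x \<in> all_cells ?N" "y \<in> all_cells ?N \<Longrightarrow> K y \<in> all_cells ?M" for x y
    using graded_all_cells[OF inf_functor_graded[OF T]] graded_all_cells[OF inf_functor_graded[OF K']] by blast+
  have k: "x \<in> all_cells ?M \<Longrightarrow> K (\<Theta> A Y x) = x" "y \<in> all_cells ?N \<Longrightarrow> \<Theta> A Y (K y) = y" for x y
    using K by (auto simp: all_cells_def)
  have b: "bij_betw (\<Theta> A Y) (all_cells ?M) (all_cells ?N)"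
    by (rule bij_betw_byWitness[of _ K]) (use t k in auto)
  have "K y = inv_into (all_cells ?M) (\<Theta> A Y) y" if "y \<in> all_cells ?N" for y
    using inv_into_f_f[OF bij_betw_imp_inj_on[OF b] t(2)[OF that]] k(2)[OF that] by simp
  then have "inf_functor ?N ?M (inv_into (all_cells ?M) (\<Theta> A Y))"
    using N.inf_functor_cong[OF K'] N.cmp_cell by blast
  then show ?thesis using b T by (simp add: inf_iso_def)
qed

text \<open>For the inverse of \<open>\<Theta>\<close> this is naturality in the contravariant variable of the exchanged situation; inverting
  gives it for \<open>\<Theta>\<close>.\<close>

lemma \<Theta>_natural_in_Y:
  assumes A: "A \<in> Cell L 0" and Y: "Y \<in> Cell L' 0" and g: "g \<in> hom_cells L' n Y Y'" and \<Phi>: "\<Phi> \<in> hom_cells L n A (F0 Y')"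
  shows "\<Theta> A Y (mu L n (D.G g) \<Phi>) = mu L' n (\<Theta> A Y' \<Phi>) g"
proof -
  have Y': "Y' \<in> Cell L' 0" using L'.hom_cells_target Y g .
  obtain K where K: "\<And>n \<Psi>. \<Psi> \<in> hom_cells L' n Y (G0 A) \<Longrightarrow> \<Theta> A Y (K \<Psi>) = \<Psi>"
    "\<And>n g Y' \<Psi>. \<lbrakk> g \<in> hom_cells L' n Y Y'; \<Psi> \<in> hom_cells L' n Y' (G0 A) \<rbrakk> \<Longrightarrow>
      \<exists>\<Phi> \<in> hom_cells L n A (F0 Y'). \<Theta> A Y' \<Phi> = \<Psi> \<and> K (mu L' n \<Psi> g) = mu L n (D.G g) \<Phi>"
    by (rule \<Theta>_inverse[OF A Y]) (rule that; assumption)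
  obtain K' where K': "\<And>n \<Phi>. \<Phi> \<in> hom_cells L n A (F0 Y') \<Longrightarrow> K' (\<Theta> A Y' \<Phi>) = \<Phi>"
    by (rule \<Theta>_inverse[OF A Y']) (rule that; assumption)
  note c = \<Theta>_cell(1)[OF A Y' \<Phi>]
  obtain \<Omega> where \<Omega>: "\<Omega> \<in> hom_cells L n A (F0 Y')" "\<Theta> A Y' \<Omega> = \<Theta> A Y' \<Phi>" "K (mu L' n (\<Theta> A Y' \<Phi>) g) = mu L n (D.G g) \<Omega>"
    using K(2)[OF g c] by (elim bexE conjE) (rule that)
  have "\<Omega> = \<Phi>" using K'[OF \<Omega>(1)] K'[OF \<Phi>] unfolding \<Omega>(2) by (rule trans[OF sym])
  then show ?thesis using \<Omega>(3) K(1)[OF L'.mu_cell[OF Y c g]] by simp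
qed

text \<open>Naturality in \<open>A\<close> as an equality of whiskered hom-functors; its components are \<open>\<Theta>_natural_in_A\<close>, with the cell of
  lower degree replaced by an iterated identity.\<close>

lemma whiskered_naturality_in_A:
  assumes A: "A \<in> Cell L 0" and Y: "Y \<in> Cell L' 0" and "f \<in> hom_cells L n A A'"
  shows "post (hom L' Y (G0 A)) (\<Theta> A Y) (hom_to_at L (F0 Y) (Suc n) f) =
    pre (hom L A' (F0 Y)) (\<Theta> A' Y) (hom_from_at L' Y (Suc n) (G f))"
  using assms(3)
proof (induction n arbitrary: f)
  case 0
  have A': "A' \<in> Cell L 0" using L.hom_cells_target A 0 .
  note F = D.lift_object(1)[OF Y] and g = G_cell(1)[OF A 0] and GA' = lift_object(1)[OF A']
  obtain h where h: "hom_to_at L (F0 Y) (Suc 0) f = CatFun (hom L A' (F0 Y)) (hom L A (F0 Y)) h"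
    using L.hom_to_at_dom_cod[OF F A 0] by simp
  obtain h' where h': "hom_from_at L' Y (Suc 0) (G f) = CatFun (hom L' Y (G0 A')) (hom L' Y (G0 A)) h'"
    using L'.hom_from_at_1[OF g Y GA'] by simp
  have "\<Theta> A Y (h x) = h' (\<Theta> A' Y x)" if x: "x \<in> hom_cells L q A' (F0 Y)" for x q
    using L.hom_to_at_map_cells[OF F A 0 x] L'.hom_from_at_map_cells[OF g Y GA' \<Theta>_cell(1)[OF A' Y x]]
      \<Theta>_natural_in_A[OF A Y L.idn_pow_hom_cells[OF 0] x] G_idn_pow[OF A 0, of q] h h' by (simp del: hom_to_at.simps hom_from_at.simps)
  then show ?case unfolding h h' by (auto simp: fun_eq_iff all_cells_def)
next
  case (Suc n)
  let ?N = "Suc n"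
  have A': "A' \<in> Cell L 0" using L.hom_cells_target A Suc.prems .
  note F = D.lift_object(1)[OF Y] and g = G_cell(1)[OF A Suc.prems] and GA' = lift_object(1)[OF A']
  have h: "hom_to_at L (F0 Y) (Suc ?N) f = CatMod (hom_to_at L (F0 Y) ?N (dm L f)) (hom_to_at L (F0 Y) ?N (cd L f)) (cat_map (hom_to_at L (F0 Y) (Suc ?N) f))"
    "hom_from_at L' Y (Suc ?N) (G f) = CatMod (hom_from_at L' Y ?N (G (dm L f))) (hom_from_at L' Y ?N (G (cd L f))) (cat_map (hom_from_at L' Y (Suc ?N) (G f)))"
    using G_dm[OF A Suc.prems] G_cd[OF A Suc.prems] by simp_all
  have "\<Theta> A Y (cat_map (hom_to_at L (F0 Y) (Suc ?N) f) x) = cat_map (hom_from_at L' Y (Suc ?N) (G f)) (\<Theta> A' Y x)"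
    if x: "x \<in> hom_cells L 0 A' (F0 Y)" for x
    using L.hom_to_at_map_objects[OF F A Suc.prems x] L'.hom_from_at_map_objects[OF g Y GA' \<Theta>_cell(1)[OF A' Y x]]
      \<Theta>_natural_in_A[OF A Y Suc.prems L.idn_pow_hom_cells[OF x]] \<Theta>_idn_pow[OF A' Y x, of ?N] by simp
  then show ?case
    apply (subst h(1))
    apply (subst h(2))
    using Suc.IH[OF L.hom_cells_dm[OF Suc.prems]] Suc.IH[OF L.hom_cells_cd[OF Suc.prems]]
      L.hom_to_at_dom_cod[OF F A L.hom_cells_dm[OF Suc.prems]]
    by (simp add: fun_eq_iff del: hom_to_at.simps hom_from_at.simps funpow.simps)
qed

lemma whiskered_naturality_in_Y:
  assumes A: "A \<in> Cell L 0" and Y: "Y \<in> Cell L' 0" and "g \<in> hom_cells L' n Y Y'"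
  shows "post (hom L' Y (G0 A)) (\<Theta> A Y) (hom_from_at L A (Suc n) (D.G g)) =
    pre (hom L A (F0 Y')) (\<Theta> A Y') (hom_to_at L' (G0 A) (Suc n) g)"
  using assms(3)
proof (induction n arbitrary: g)
  case 0
  have Y': "Y' \<in> Cell L' 0" using L'.hom_cells_target Y 0 .
  note F = D.lift_object(1)[OF Y'] and f = D.G_cell(1)[OF Y 0] and GA = lift_object(1)[OF A]
  obtain h where h: "hom_from_at L A (Suc 0) (D.G g) = CatFun (hom L A (F0 Y')) (hom L A (F0 Y)) h"
    using L.hom_from_at_1[OF f A F] by simp
  obtain h' where h': "hom_to_at L' (G0 A) (Suc 0) g = CatFun (hom L' Y' (G0 A)) (hom L' Y (G0 A)) h'"
    using L'.hom_to_at_dom_cod[OF GA Y 0] by simp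
  have "\<Theta> A Y (h x) = h' (\<Theta> A Y' x)" if x: "x \<in> hom_cells L q A (F0 Y')" for x q
    using L.hom_from_at_map_cells[OF f A F x] L'.hom_to_at_map_cells[OF GA Y 0 \<Theta>_cell(1)[OF A Y' x]]
      \<Theta>_natural_in_Y[OF A Y L'.idn_pow_hom_cells[OF 0] x] D.G_idn_pow[OF Y 0, of q] h h' by (simp del: hom_to_at.simps hom_from_at.simps)
  then show ?case unfolding h h' by (auto simp: fun_eq_iff all_cells_def)
next
  case (Suc n)
  let ?N = "Suc n"
  have Y': "Y' \<in> Cell L' 0" using L'.hom_cells_target Y Suc.prems .
  note F = D.lift_object(1)[OF Y'] and f = D.G_cell(1)[OF Y Suc.prems] and GA = lift_object(1)[OF A]
  have h: "hom_from_at L A (Suc ?N) (D.G g) = CatMod (hom_from_at L A ?N (D.G (dm L' g))) (hom_from_at L A ?N (D.G (cd L' g))) (cat_map (hom_from_at L A (Suc ?N) (D.G g)))"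
    "hom_to_at L' (G0 A) (Suc ?N) g = CatMod (hom_to_at L' (G0 A) ?N (dm L' g)) (hom_to_at L' (G0 A) ?N (cd L' g)) (cat_map (hom_to_at L' (G0 A) (Suc ?N) g))"
    using D.G_dm[OF Y Suc.prems] D.G_cd[OF Y Suc.prems] by simp_all
  have "\<Theta> A Y (cat_map (hom_from_at L A (Suc ?N) (D.G g)) x) = cat_map (hom_to_at L' (G0 A) (Suc ?N) g) (\<Theta> A Y' x)"
    if x: "x \<in> hom_cells L 0 A (F0 Y')" for x
    using L.hom_from_at_map_objects[OF f A F x] L'.hom_to_at_map_objects[OF GA Y Suc.prems \<Theta>_cell(1)[OF A Y' x]]
      \<Theta>_natural_in_Y[OF A Y Suc.prems L.idn_pow_hom_cells[OF x]] \<Theta>_idn_pow[OF A Y' x, of ?N] by simp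
  moreover have "dom_cat (hom_from_at L A ?N (D.G (dm L' g))) = hom L A (F0 Y')"
    using L.hom_from_at_dom_cod[OF D.G_cell(1)[OF Y L'.hom_cells_dm[OF Suc.prems]] F] by blast
  ultimately show ?case
    apply (subst h(1))
    apply (subst h(2))
    using Suc.IH[OF L'.hom_cells_dm[OF Suc.prems]] Suc.IH[OF L'.hom_cells_cd[OF Suc.prems]]
    by (simp add: fun_eq_iff del: hom_to_at.simps hom_from_at.simps funpow.simps)
qed

lemma \<Theta>_graded: "A \<in> Cell L 0 \<Longrightarrow> Y \<in> Cell L' 0 \<Longrightarrow> graded (hom L A (F0 Y)) (hom L' Y (G0 A)) (\<Theta> A Y)"
  using strict_functor_\<Theta> unfolding strict_functor_def graded_def by blast

lemma natural_in_A:
  assumes Y: "Y \<in> Cell L' 0"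
  shows "natural_transformation (opp L) CAT (hom_to L (F0 Y)) (hom_from L' Y \<circ> G)
    (\<lambda>A. CatFun (hom L A (F0 Y)) (hom L' Y (G A)) (restrict (\<Theta> A Y) (all_cells (hom L A (F0 Y)))))"
proof (rule natural_transformation_CAT)
  note F = D.lift_object(1)[OF Y]
  show "globular (opp L)" using L.globular_opp .
  show "hom_to L (F0 Y) a = CatObj (hom L a (F0 Y)) \<and> (hom_from L' Y \<circ> G) a = CatObj (hom L' Y (G a)) \<and>
     inf_category (hom L a (F0 Y)) \<and> inf_category (hom L' Y (G a)) \<and>
      strict_omega (hom L a (F0 Y)) \<and> strict_omega (hom L' Y (G a)) \<and> strict_functor (hom L a (F0 Y)) (hom L' Y (G a)) (\<Theta> a Y)"
    if "a \<in> Cell (opp L) 0" for a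
    using that L.deg_eq[of a 0] L'.deg_eq[OF lift_object(1), of a] G_object[of a] L.inf_category_hom[of a] L'.inf_category_hom[OF Y]
      L.strict_omega_hom[of a] L'.strict_omega_hom[OF Y] strict_functor_\<Theta>[OF _ Y, of a] by (simp add: hom_to_def hom_from_def)
  fix a b k f assume "a \<in> Cell (opp L) 0" "b \<in> Cell (opp L) 0" "f \<in> hom_cells (opp L) k a b"
  then have a: "a \<in> Cell L 0" and b: "b \<in> Cell L 0" and f: "f \<in> hom_cells L k b a" using L.hom_cells_opp by auto
  note fc = L.hom_cells_Cell[OF b f] and g = G_cell(1)[OF b f] and Ga = lift_object(1)[OF a]
  note gc = L'.hom_cells_Cell[OF Ga g]
  have P: "hom_to L (F0 Y) f = hom_to_at L (F0 Y) (Suc k) f" using L.deg_eq[OF fc] by (simp add: hom_to_def)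
  have Q: "(hom_from L' Y \<circ> G) f = hom_from_at L' Y (Suc k) (G f)" using L'.deg_eq[OF gc] by (simp add: hom_from_def)
  have Pc: "hom_to_at L (F0 Y) (Suc k) f \<in> cat_Cell (Suc k)" using L.hom_to_at_in_cat_Cell[OF F L.inf_category_hom fc] .
  have Qc: "hom_from_at L' Y (Suc k) (G f) \<in> cat_Cell (Suc k)" using L'.hom_from_at_in_cat_Cell[OF Y L'.inf_category_hom[OF Y] gc] .
  show "hom_to L (F0 Y) f \<in> cat_Cell (Suc k) \<and> dom_cat (hom_to L (F0 Y) f) = hom L a (F0 Y) \<and> cod_cat (hom_to L (F0 Y) f) = hom L b (F0 Y)"
    using Pc L.hom_to_at_dom_cod[OF F b f] unfolding P by blast
  show "(hom_from L' Y \<circ> G) f \<in> cat_Cell (Suc k) \<and> dom_cat ((hom_from L' Y \<circ> G) f) = hom L' Y (G a) \<and> cod_cat ((hom_from L' Y \<circ> G) f) = hom L' Y (G b)"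
    using Qc L'.hom_from_at_dom_cod[OF g Ga] G_object[OF a] G_object[OF b] unfolding Q by simp
  show "post (hom L' Y (G b)) (\<Theta> b Y) (hom_to L (F0 Y) f) = cat_cmp (Suc k) ((hom_from L' Y \<circ> G) f)
     ((cat_idn ^^ k) (CatFun (hom L a (F0 Y)) (hom L' Y (G a)) (restrict (\<Theta> a Y) (all_cells (hom L a (F0 Y))))))"
  proof -
    have "graded (hom L a (F0 Y)) (hom L' Y (G0 a)) (restrict (\<Theta> a Y) (all_cells (hom L a (F0 Y))))"
      using \<Theta>_graded[OF a Y] by (auto simp: graded_def all_cells_def)
    then show ?thesis unfolding P Q G_object[OF a] G_object[OF b]
      using whiskered_naturality_in_A[OF b Y f] L'.cat_cmp_idn_pow_right[OF Y Ga g] pre_restrict[OF Qc] by simp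
  qed
qed

lemma natural_in_Y:
  assumes A: "A \<in> Cell L 0"
  shows "natural_transformation (opp L') CAT (hom_from L A \<circ> D.G) (hom_to L' (G0 A))
    (\<lambda>Y. CatFun (hom L A (D.G Y)) (hom L' Y (G0 A)) (restrict (\<Theta> A Y) (all_cells (hom L A (D.G Y)))))"
proof (rule natural_transformation_CAT)
  note GA = lift_object(1)[OF A]
  show "globular (opp L')" using L'.globular_opp .
  show "(hom_from L A \<circ> D.G) a = CatObj (hom L A (D.G a)) \<and> hom_to L' (G0 A) a = CatObj (hom L' a (G0 A)) \<and>
     inf_category (hom L A (D.G a)) \<and> inf_category (hom L' a (G0 A)) \<and>
      strict_omega (hom L A (D.G a)) \<and> strict_omega (hom L' a (G0 A)) \<and> strict_functor (hom L A (D.G a)) (hom L' a (G0 A)) (\<Theta> A a)"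
    if "a \<in> Cell (opp L') 0" for a
    using that L'.deg_eq[of a 0] L.deg_eq[OF D.lift_object(1), of a] D.G_object[of a] L.inf_category_hom[OF A] L'.inf_category_hom[of a]
      L.strict_omega_hom[OF A] L'.strict_omega_hom[of a] strict_functor_\<Theta>[OF A, of a] by (simp add: hom_to_def hom_from_def)
  fix a b k g assume "a \<in> Cell (opp L') 0" "b \<in> Cell (opp L') 0" "g \<in> hom_cells (opp L') k a b"
  then have a: "a \<in> Cell L' 0" and b: "b \<in> Cell L' 0" and g: "g \<in> hom_cells L' k b a" using L'.hom_cells_opp by auto
  note gc = L'.hom_cells_Cell[OF b g] and f = D.G_cell(1)[OF b g] and Fa = D.lift_object(1)[OF a]
  note fc = L.hom_cells_Cell[OF Fa f]
  have Q: "hom_to L' (G0 A) g = hom_to_at L' (G0 A) (Suc k) g" using L'.deg_eq[OF gc] by (simp add: hom_to_def)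
  have P: "(hom_from L A \<circ> D.G) g = hom_from_at L A (Suc k) (D.G g)" using L.deg_eq[OF fc] by (simp add: hom_from_def)
  have Qc: "hom_to_at L' (G0 A) (Suc k) g \<in> cat_Cell (Suc k)" using L'.hom_to_at_in_cat_Cell[OF GA L'.inf_category_hom gc] .
  have Pc: "hom_from_at L A (Suc k) (D.G g) \<in> cat_Cell (Suc k)" using L.hom_from_at_in_cat_Cell[OF A L.inf_category_hom[OF A] fc] .
  show "(hom_from L A \<circ> D.G) g \<in> cat_Cell (Suc k) \<and> dom_cat ((hom_from L A \<circ> D.G) g) = hom L A (D.G a) \<and> cod_cat ((hom_from L A \<circ> D.G) g) = hom L A (D.G b)"
    using Pc L.hom_from_at_dom_cod[OF f Fa] D.G_object[OF a] D.G_object[OF b] unfolding P by simp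
  show "hom_to L' (G0 A) g \<in> cat_Cell (Suc k) \<and> dom_cat (hom_to L' (G0 A) g) = hom L' a (G0 A) \<and> cod_cat (hom_to L' (G0 A) g) = hom L' b (G0 A)"
    using Qc L'.hom_to_at_dom_cod[OF GA b g] unfolding Q by blast
  show "post (hom L' b (G0 A)) (\<Theta> A b) ((hom_from L A \<circ> D.G) g) = cat_cmp (Suc k) (hom_to L' (G0 A) g)
     ((cat_idn ^^ k) (CatFun (hom L A (D.G a)) (hom L' a (G0 A)) (restrict (\<Theta> A a) (all_cells (hom L A (D.G a))))))"
  proof -
    have "graded (hom L A (F0 a)) (hom L' a (G0 A)) (restrict (\<Theta> A a) (all_cells (hom L A (F0 a))))"
      using \<Theta>_graded[OF A a] by (auto simp: graded_def all_cells_def)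
    then show ?thesis unfolding P Q D.G_object[OF a]
      using whiskered_naturality_in_Y[OF A b g] L'.cat_cmp_idn_pow_right_to[OF GA b g] pre_restrict[OF Qc] by simp
  qed
qed

lemma dual_adjunction: "strict_concrete_dual_adjunction L A0 At L' B0 Bt G D.G \<Theta>"
  unfolding strict_concrete_dual_adjunction_def
proof (intro conjI ballI)
  show "inf_functor (opp L) L' G"
    using strict_functor_inf_functor[OF strict_functor_G L.strict_omega_opp L'.strict_omega_axioms] .
  show "inf_functor L' (opp L) D.G"
    using strict_functor_inf_functor[OF strict_functor_opp[OF L'.strict_omega_axioms L.strict_omega_axioms D.strict_functor_G] L'.strict_omega_axioms L.strict_omega_opp] .
  show "hom_from L' B0 (G \<alpha>) = hom_to L At \<alpha>" if \<alpha>: "\<alpha> \<in> all_cells L" for \<alpha>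
  proof -
    obtain n where n: "\<alpha> \<in> Cell L n" using \<alpha> by (auto simp: all_cells_def)
    have "G \<alpha> \<in> Cell L' n" using strict_functor_G n by (simp add: strict_functor_def)
    then show ?thesis using V_G_all[OF n] L.deg_eq[OF n] L'.deg_eq by (simp add: hom_from_def hom_to_def)
  qed
  show "hom_from L A0 (D.G \<alpha>) = hom_to L' Bt \<alpha>" if \<alpha>: "\<alpha> \<in> all_cells L'" for \<alpha>
  proof -
    obtain n where n: "\<alpha> \<in> Cell L' n" using \<alpha> by (auto simp: all_cells_def)
    have "D.G \<alpha> \<in> Cell L n" using D.strict_functor_G n by (simp add: strict_functor_def)
    then show ?thesis using D.V_G_all[OF n] L'.deg_eq[OF n] L.deg_eq by (simp add: hom_from_def hom_to_def)
  qed
  show "inf_iso (hom L A (D.G Y)) (hom L' Y (G A)) (\<Theta> A Y)" if "A \<in> Cell L 0" "Y \<in> Cell L' 0" for A Y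
    using \<Theta>_iso[OF that] D.G_object[OF that(2)] G_object[OF that(1)] by simp
  show "natural_transformation (opp L) CAT (hom_to L (D.G Y)) (hom_from L' Y \<circ> G)
        (\<lambda>A. CatFun (hom L A (D.G Y)) (hom L' Y (G A)) (restrict (\<Theta> A Y) (all_cells (hom L A (D.G Y)))))" if Y: "Y \<in> Cell L' 0" for Y
    using natural_in_A[OF Y] D.G_object[OF Y] by simp
  show "natural_transformation (opp L') CAT (hom_from L A \<circ> D.G) (hom_to L' (G A))
        (\<lambda>Y. CatFun (hom L A (D.G Y)) (hom L' Y (G A)) (restrict (\<Theta> A Y) (all_cells (hom L A (D.G Y)))))" if A: "A \<in> Cell L 0" for A
    using natural_in_Y[OF A] G_object[OF A] by simp
qed

end

section \<open>The dual adjunction\<close>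

lemma cat_cmp_dom_cod:
  assumes "x \<in> cat_Cell (Suc n)" "y \<in> cat_Cell (Suc n)"
  shows "dom_cat (cat_cmp (Suc n) x y) = dom_cat y \<and> cod_cat (cat_cmp (Suc n) x y) = cod_cat x"
  using assms
proof (induction n arbitrary: x y)
  case 0
  then show ?case by (auto elim!: cat_Cell_1E)
next
  case (Suc m)
  note a = cat_Cell_Suc_Suc_eq[OF Suc.prems(1)] and b = cat_Cell_Suc_Suc_eq[OF Suc.prems(2)]
  obtain s t h where A: "x = CatMod s t h" using a(1) by metis
  obtain s' t' h' where B: "y = CatMod s' t' h'" using b(1) by metis
  have p: "s \<in> cat_Cell (Suc m)" "s' \<in> cat_Cell (Suc m)" "cat_deg s = Suc m" using a b A B by auto
  show ?case unfolding A B cat_cmp_horizontal[OF p(3)] using Suc.IH[OF p(1,2)] by simp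
qed

text \<open>The hypotheses of the theorem on one side, translated: composites with \<open>\<theta>\<close> in \<open>B\<close> are whiskerings, and
  liftable cells are images under \<open>V\<close> at an explicit degree.\<close>

lemma half_lifting_intro:
  assumes B: "subcategory B CAT" and L: "strict_inf_category L" and L': "strict_inf_category L'"
    and U: "concrete_over B L A0" and V: "concrete_over B L' B0"
    and At: "At \<in> Cell L 0" and Bt: "Bt \<in> Cell L' 0"
    and \<theta>: "\<theta> \<in> hom_cells B 0 (hom_from L A0 At) (hom_from L' B0 Bt)"
    and H: "inf_functor (opp L) B (hom_to L At)"
    and G0: "lifts_objects L At L' B0 G0"
    and init: "initial_lifting B L A0 At L' B0 Bt \<theta> G0"
    and cones: "evaluation_cones_in B L A0 At L' B0 Bt \<theta> G0"
  shows "\<theta> = CatFun (hom L A0 At) (hom L' B0 Bt) (cat_map \<theta>)"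
    and "\<exists>eps. half_lifting B L A0 At L' B0 Bt (cat_map \<theta>) G0 eps"
proof -
  interpret cat_subcategory B by (rule cat_subcategory.intro) fact
  interpret L: strict_inf_category L by fact
  interpret L': strict_inf_category L' by fact
  interpret L: strict_omega L by (rule L.strict_omega)
  interpret L': strict_omega L' by (rule L'.strict_omega)
  let ?Z = "hom L' B0 Bt" and ?Y = "hom L A0 At" and ?th = "cat_map \<theta>"
  have A0: "A0 \<in> Cell L 0" and B0: "B0 \<in> Cell L' 0" using U V by (auto simp: concrete_over_def)
  have from_L': "hom_from L' B0 \<beta> = hom_from_at L' B0 n \<beta>" if "\<beta> \<in> Cell L' n" for \<beta> n
    using L'.deg_eq[OF that] by (simp add: hom_from_def)
  have from_L: "hom_from L A0 A = CatObj (hom L A0 A)" if "A \<in> Cell L 0" for A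
    using L.deg_eq[OF that] by (simp add: hom_from_def)
  have to_L: "hom_to L At \<alpha> = hom_to_at L At n \<alpha>" if "\<alpha> \<in> Cell L n" for \<alpha> n
    using L.deg_eq[OF that] by (simp add: hom_to_def)
  have \<theta>B: "\<theta> \<in> Cell B (Suc 0)" and \<theta>d: "dom_cat \<theta> = ?Y" "cod_cat \<theta> = ?Z"
    using \<theta>[unfolded from_L[OF At] from_L'[OF Bt] hom_from_at.simps hom_cells_B_iff] by auto
  show \<theta>eq: "\<theta> = CatFun ?Y ?Z ?th" using Cell_B[OF \<theta>B] \<theta>d by (auto elim!: cat_Cell_1E)
  then have thf: "inf_functor ?Y ?Z ?th" using Cell_B[OF \<theta>B] by (auto elim!: cat_Cell_1E)
  have V_B: "hom_from_at L' B0 n \<beta> \<in> Cell B n" if "\<beta> \<in> Cell L' n" for \<beta> n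
    using inf_functorD(1)[of L' B "hom_from L' B0" \<beta> n] V that from_L'[OF that] by (simp add: concrete_over_def)
  have H_B: "hom_to_at L At n \<alpha> \<in> Cell B n" if "\<alpha> \<in> Cell L n" for \<alpha> n
    using inf_functorD(1)[OF H, of \<alpha> n] that to_L[OF that] by simp
  have lift: "G0 A \<in> Cell L' 0" "hom L' B0 (G0 A) = hom L A At" if A: "A \<in> Cell L 0" for A
    using G0 A from_L'[of "G0 A" 0] to_L[OF A] by (auto simp: lifts_objects_def)
  have whisker: "hcomp B 0 n \<theta> y = post ?Z ?th y" if y: "y \<in> Cell B (Suc n)" "cod_cat y = ?Y" for y n
  proof -
    have i: "(idn B ^^ n) \<theta> = (cat_idn ^^ n) \<theta>" "(cat_idn ^^ n) \<theta> \<in> Cell B (Suc n)"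
      using idn_B_pow[OF \<theta>B, of n] by simp_all
    have "dom_cat ((cat_idn ^^ n) \<theta>) = cod_cat y" using \<theta>eq cat_idn_pow_CatFun(2) y(2) by metis
    then have "hcomp B 0 n \<theta> y = cat_cmp (Suc n) ((cat_idn ^^ n) \<theta>) y"
      using mu_B(1)[OF i(2) y(1)] i(1) by (simp add: hcomp_def)
    also have "\<dots> = post ?Z ?th y"
      by (subst \<theta>eq) (rule cat_cmp_idn_pow_left[OF Cell_B[OF y(1)] y(2) L'.strict_omega_hom[OF B0] thf])
    finally show ?thesis .
  qed
  have faithful: "\<Phi> = \<Psi>" if "X \<in> Cell L' 0" "Y \<in> Cell L' 0" "\<Phi> \<in> hom_cells L' n X Y" "\<Psi> \<in> hom_cells L' n X Y"
      "hom_from_at L' B0 (Suc n) \<Phi> = hom_from_at L' B0 (Suc n) \<Psi>" for X Y n \<Phi> \<Psi>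
  proof -
    have "inj_on (hom_from L' B0) (all_cells (hom L' X Y))" using V that(1,2) by (simp add: concrete_over_def strictly_faithful_def)
    moreover have "\<Phi> \<in> all_cells (hom L' X Y)" "\<Psi> \<in> all_cells (hom L' X Y)" using that(3,4) by (auto simp: all_cells_def)
    moreover have "hom_from L' B0 \<Phi> = hom_from L' B0 \<Psi>"
      using that(5) from_L'[OF L'.hom_cells_Cell[OF that(1,3)]] from_L'[OF L'.hom_cells_Cell[OF that(1,4)]] by simp
    ultimately show ?thesis by (auto dest: inj_onD)
  qed
  have arrow: "is_arrow L' B0 n X Y f \<longleftrightarrow> (\<exists>\<Psi> \<in> hom_cells L' n X Y. hom_from_at L' B0 (Suc n) \<Psi> = f)" if X: "X \<in> Cell L' 0" for X Y n f
    using from_L'[OF L'.hom_cells_Cell[OF X]] unfolding is_arrow_def by metis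
  have lift_cell: "\<exists>\<Psi> \<in> hom_cells L' n X (G0 A). hom_from_at L' B0 (Suc n) \<Psi> = f"
    if A: "A \<in> Cell L 0" and X: "X \<in> Cell L' 0" and f: "f \<in> Cell B (Suc n)" "dom_cat f = hom L' B0 X" "cod_cat f = hom L A At"
      and e: "\<And>x. x \<in> hom_cells L n A0 A \<Longrightarrow> \<exists>\<Psi> \<in> hom_cells L' n X Bt. hom_from_at L' B0 (Suc n) \<Psi> =
        post ?Z ?th (cat_cmp (Suc n) (hom_to_at L At (Suc n) x) f)" for A X n f
  proof -
    have F: "f \<in> hom_cells B n (hom_from L' B0 X) (hom_to L At A)"
      using f from_L'[OF X] to_L[OF A] by (simp add: hom_cells_B_iff)
    have "is_arrow L' B0 n X Bt (hcomp B 0 n \<theta> (mu B n (hom_to L At x) f))" if x: "x \<in> hom_cells L n A0 A" for x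
    proof -
      note xc = L.hom_cells_Cell[OF A0 x] and xd = L.hom_to_at_dom_cod[OF At A0 x]
      have d: "dom_cat (hom_to_at L At (Suc n) x) = cod_cat f" using xd f(3) by simp
      note m = mu_B[OF H_B[OF xc] f(1) d]
      have "cod_cat (cat_cmp (Suc n) (hom_to_at L At (Suc n) x) f) = ?Y"
        using cat_cmp_dom_cod[OF Cell_B[OF H_B[OF xc]] Cell_B[OF f(1)]] xd by simp
      then show ?thesis unfolding arrow[OF X] to_L[OF xc] m(1) whisker[OF m(2)] using e[OF x] whisker[OF m(2)] by simp
    qed
    then have "is_arrow L' B0 n X (G0 A) f" using init A X F unfolding initial_lifting_def by blast
    then show ?thesis unfolding arrow[OF X] .
  qed
  have "\<exists>e. CatFun (hom L A0 A) (hom L' (G0 A) Bt) e \<in> Cell B 1 \<and>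
     (\<forall>n. \<forall>x \<in> hom_cells L n A0 A. hom_from_at L' B0 (Suc n) (e x) = post ?Z ?th (hom_to_at L At (Suc n) x))" if A: "A \<in> Cell L 0" for A
  proof -
    have t: "hom_to L' Bt (G0 A) = CatObj (hom L' (G0 A) Bt)"
      using L'.deg_eq[OF lift(1)[OF A]] by (simp add: hom_to_def)
    obtain \<eta> where \<eta>: "\<eta> \<in> hom_cells B 0 (hom_from L A0 A) (hom_to L' Bt (G0 A))"
      and ev: "\<And>n x. x \<in> hom_cells L n A0 A \<Longrightarrow> cat_map \<eta> x \<in> hom_cells L' n (G0 A) Bt \<and>
          hom_from L' B0 (cat_map \<eta> x) = ev_at B L At \<theta> n x"
      using cones A unfolding evaluation_cones_in_def by blast
    have \<eta>B: "\<eta> \<in> Cell B (Suc 0)" and d: "dom_cat \<eta> = hom L A0 A" "cod_cat \<eta> = hom L' (G0 A) Bt"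
      using \<eta>[unfolded from_L[OF A] t hom_cells_B_iff] by auto
    have eq: "\<eta> = CatFun (hom L A0 A) (hom L' (G0 A) Bt) (cat_map \<eta>)" using Cell_B[OF \<eta>B] d by (auto elim!: cat_Cell_1E)
    have "hom_from_at L' B0 (Suc n) (cat_map \<eta> x) = post ?Z ?th (hom_to_at L At (Suc n) x)" if x: "x \<in> hom_cells L n A0 A" for n x
    proof -
      note xc = L.hom_cells_Cell[OF A0 x] and xd = L.hom_to_at_dom_cod[OF At A0 x]
      have "hom_from L' B0 (cat_map \<eta> x) = post ?Z ?th (hom_to_at L At (Suc n) x)"
        using conjunct2[OF ev[OF x]] whisker[OF H_B[OF xc] xd(2)] to_L[OF xc] by (simp add: ev_at_def)
      then show ?thesis using from_L'[OF L'.hom_cells_Cell[OF lift(1)[OF A] conjunct1[OF ev[OF x]]]] by simp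
    qed
    then show ?thesis using \<eta>B eq by (intro exI[of _ "cat_map \<eta>"]) auto
  qed
  then obtain eps where eps: "\<And>A. A \<in> Cell L 0 \<Longrightarrow> CatFun (hom L A0 A) (hom L' (G0 A) Bt) (eps A) \<in> Cell B 1"
     "\<And>A n x. A \<in> Cell L 0 \<Longrightarrow> x \<in> hom_cells L n A0 A \<Longrightarrow> hom_from_at L' B0 (Suc n) (eps A x) = post ?Z ?th (hom_to_at L At (Suc n) x)"
    by metis
  have "half_lifting B L A0 At L' B0 Bt ?th G0 eps"
  proof
    show "CatFun ?Y ?Z ?th \<in> Cell B 1" using \<theta>B \<theta>eq by simp
  qed (fact A0 At B0 Bt faithful V_B H_B lift lift_cell eps)+
  then show "\<exists>eps. half_lifting B L A0 At L' B0 Bt ?th G0 eps" by blast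
qed

theorem proposition6p1p1:
  fixes B :: "'x cat_cell cells"
    and L L' :: "'x cells"
    and A0 At B0 Bt :: 'x
    and \<theta> \<theta>' :: "'x cat_cell"
    and G0 F0 :: "'x \<Rightarrow> 'x"
  assumes "subcategory B CAT"
    and "strict_inf_category L" and "strict_inf_category L'"
    and "concrete_over B L A0" and "concrete_over B L' B0"
    and "At \<in> Cell L 0" and "Bt \<in> Cell L' 0"
    and "eqv B (hom_from L A0 At) (hom_from L' B0 Bt)"
    and "identification B (hom_from L A0 At) (hom_from L' B0 Bt) \<theta> \<theta>'"
    and "inf_functor (opp L) B (hom_to L At)" and "inf_functor (opp L') B (hom_to L' Bt)"
    and "initial_lifting_condition B L A0 At L' B0 Bt \<theta> \<theta>' G0 F0"
    and "evaluation_cones_in B L A0 At L' B0 Bt \<theta> G0"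
    and "evaluation_cones_in B L' B0 Bt L A0 At \<theta>' F0"
  shows "\<exists>G F \<Theta>. natural_strict_concrete_dual_adjunction B L A0 At L' B0 Bt \<theta> \<theta>' G F \<Theta>"
proof -
  let ?X = "hom L A0 At" and ?Y = "hom L' B0 Bt"
  have \<theta>: "\<theta> \<in> hom_cells B 0 (hom_from L A0 At) (hom_from L' B0 Bt)"
    and \<theta>': "\<theta>' \<in> hom_cells B 0 (hom_from L' B0 Bt) (hom_from L A0 At)"
    and inv: "cmp B 1 \<theta>' \<theta> = idn B (hom_from L A0 At)" "cmp B 1 \<theta> \<theta>' = idn B (hom_from L' B0 Bt)"
    using assms(9) by (auto simp: identification_def)
  have G0: "lifts_objects L At L' B0 G0" "initial_lifting B L A0 At L' B0 Bt \<theta> G0"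
    and F0: "lifts_objects L' Bt L A0 F0" "initial_lifting B L' B0 Bt L A0 At \<theta>' F0"
    using assms(12) by (auto simp: initial_lifting_condition_def)
  note 1 = half_lifting_intro[OF assms(1-3) assms(4,5) assms(6,7) \<theta> assms(10) G0 assms(13)]
  note 2 = half_lifting_intro[OF assms(1) assms(3,2) assms(5,4) assms(7,6) \<theta>' assms(11) F0 assms(14)]
  obtain eps eta where hl: "half_lifting B L A0 At L' B0 Bt (cat_map \<theta>) G0 eps"
    "half_lifting B L' B0 Bt L A0 At (cat_map \<theta>') F0 eta" using 1(2) 2(2) by blast
  interpret X: half_lifting B L A0 At L' B0 Bt "cat_map \<theta>" G0 eps by (rule hl)
  interpret Y: half_lifting B L' B0 Bt L A0 At "cat_map \<theta>'" F0 eta by (rule hl)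
  have obj: "hom_from L A0 At = CatObj ?X" "hom_from L' B0 Bt = CatObj ?Y" "CatObj ?X \<in> Cell B 0" "CatObj ?Y \<in> Cell B 0"
    using X.L.deg_eq[OF assms(6)] X.L'.deg_eq[OF assms(7)] Y.V_B[OF assms(6)] X.V_B[OF assms(7)] by (auto simp: hom_from_def)
  \<comment> \<open>The two equations of the identification say that the underlying maps are mutually inverse.\<close>
  obtain t where t: "\<theta> = CatFun ?X ?Y t" using 1(1) by blast
  obtain t' where t': "\<theta>' = CatFun ?Y ?X t'" using 2(1) by blast
  have B: "\<theta> \<in> Cell B (Suc 0)" "\<theta>' \<in> Cell B (Suc 0)" using X.th_B Y.th_B t t' by simp_all
  have "cat_cmp 1 \<theta>' \<theta> = cat_idn (CatObj ?X)" "cat_cmp 1 \<theta> \<theta>' = cat_idn (CatObj ?Y)"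
    using inv X.mu_B(1)[OF B(2,1)] X.mu_B(1)[OF B] X.idn_B(1)[OF obj(3)] X.idn_B(1)[OF obj(4)] t t'
    by (simp_all add: mu_def obj)
  then have "restrict (t' \<circ> t) (all_cells ?X) = restrict id (all_cells ?X)"
    "restrict (t \<circ> t') (all_cells ?Y) = restrict id (all_cells ?Y)"
    by (simp_all add: t t')
  then have "w \<in> all_cells ?X \<Longrightarrow> cat_map \<theta>' (cat_map \<theta> w) = w" "w \<in> all_cells ?Y \<Longrightarrow> cat_map \<theta> (cat_map \<theta>' w) = w" for w
    unfolding t t' cat_map.simps by (metis comp_apply id_apply restrict_apply')+
  then interpret duality B L A0 At L' B0 Bt "cat_map \<theta>" G0 eps "cat_map \<theta>'" F0 eta
    by unfold_locales
  have "initial_lifting B L A0 At L' B0 Bt \<theta> X.G" "initial_lifting B L' B0 Bt L A0 At \<theta>' Y.G"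
    using G0(2) F0(2) X.G_object Y.G_object unfolding initial_lifting_def by simp_all
  then show ?thesis using dual_adjunction unfolding natural_strict_concrete_dual_adjunction_def by blast
qed

end
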